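(* Fix $\epsilon\in(0,\epsilon_0]$ and let $(N,M)$ be a covering-exchange pair, with time $T>0$, for the fast–slow system $x'=f(x,y,\epsilon)$, $y'=\epsilon g(x,y,\epsilon)$ ($x\in\mathbb R^n$, $y\in\mathbb R$), with fast-exit face $M^{\mathrm{exit}}$. Then there exists an h-set $\tilde M\subset M$ such that $$N\overset{\varphi_\epsilon(T,\cdot)}{\Longrightarrow}\tilde M\overset{P_\epsilon^M}{\Longrightarrow}M^{\mathrm{exit}}.$$
   Context: $f,g$ are $C^r$ with $f=f_0+\sum_{i=1}^m\epsilon^if_i+o(\epsilon^m)$, $g=g_0+\sum_{i=1}^m\epsilon^ig_i+o(\epsilon^m)$, $f_0,g_0\not\equiv0$; $\varphi_\epsilon$ is the flow. $P_\epsilon^M:M\to\partial M$, $P_\epsilon^M(z)=\varphi_\epsilon(t_\epsilon(z),z)$, $t_\epsilon(z)=\sup\{t\mid\varphi_\epsilon([0,t],z)\subset M\}$. h-sets and covering: $B_m$ is the open unit ball of $\mathbb R^m$, $B_0=\{0\}$, $\partial B_0=\emptyset$. An h-set is a compact $N\subset\mathbb R^m$ with integers $u(N),s(N)\ge0$, $u(N)+s(N)=\dim N\le m$, and a homeomorphism $c_N:\mathbb R^{\dim N}\to\mathbb R^{u(N)}\times\mathbb R^{s(N)}$ with $c_N(N)=N_c:=\overline{B_{u(N)}}\times\overline{B_{s(N)}}$; $N_c^-=\partial B_{u(N)}\times\overline{B_{s(N)}}$, $N_c^+=\overline{B_{u(N)}}\times\partial B_{s(N)}$, $N^\pm=c_N^{-1}(N_c^\pm)$.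 If $u(N)=u(M)=u$ and $F:N\to\mathbb R^{\dim M}$ is continuous, $F_c=c_M\circ F\circ c_N^{-1}$, then $N\overset{F}{\Longrightarrow}M$ means: there is a homotopy $h:[0,1]\times N_c\to\mathbb R^u\times\mathbb R^{s(M)}$ with $h_0=F_c$, $h([0,1],N_c^-)\cap M_c=\emptyset$, $h([0,1],N_c)\cap M_c^+=\emptyset$, and a map $A:\mathbb R^u\to\mathbb R^u$ with $h_1(p,q)=(A(p),0)$, $A(\partial B_u)\subset\mathbb R^u\setminus\overline{B_u}$, $\deg(A,\overline{B_u},0)\ne0$. Local form: by an affine change $x\leftrightarrow(a,b)\in\mathbb R^{u+s}$ ($u+s=n$) the system reads $a'=Aa+F_1(a,b,y,\epsilon)$, $b'=Bb+F_2(a,b,y,\epsilon)$, $y'=\epsilon g$, $\eta'=0$, $\epsilon=\eta\sigma$, $\sigma=\epsilon_0$, $\eta\in[0,1]$, $A$, $B$ diagonal with eigenvalues of positive, resp. negative real part; $0<\lambda_A<\mathrm{Re}\,\lambda$ on $\mathrm{Spec}(A)$ and $0>\mu_B>\mathrm{Re}\,\mu$ on $\mathrm{Spec}(B)$. Fast-saddle-type block (real eigenvalues $\mu_j^a>0,\mu_j^b<0$): for compact $W\subset\mathbb R^n$, a compact interval $K$ and numbers with $\delta_{i,j}^-<F_{i,j}<\delta_{i,j}^+$ on $W\times K\times[0,\epsilon_0]$, put $D_c=\prod[a_j^-,a_j^+]\times\prod[b_j^-,b_j^+]\times K$, $a_j^\pm=-\delta_{1,j}^\mp/\mu_j^a$,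 $b_j^\pm=-\delta_{2,j}^\pm/\mu_j^b$ (possibly with each interval enlarged at its ends by positive amounts); $D_c$, or $D=c_D^{-1}(D_c)$ in original coordinates, is a fast-saddle-type block if $D\subset W\times K$. Its fast-exit $D^{f,-}$ is the part of the boundary with some $a_j\in\{a_j^\pm\}$; its fast-entrance $D^{f,+}$ the part with some $b_j\in\{b_j^\pm\}$. Cone conditions on $M$: $\sigma_\bullet$ is the maximal singular value, $\sup$ over $M\times[0,\epsilon_0]$. With $\mathbb A_1^u=\partial_aF_1$, $\mathbb A_2^u=(\partial_bF_1\ \partial_yF_1\ \partial_\eta F_1)$, $\mathbb B_1^u=\partial_aF_2$, $\mathbb B_2^u=(\partial_bF_2\ \partial_yF_2\ \partial_\eta F_2)$, $g_1^u=\partial_ag$, $g_2^u=(\partial_bg\ \partial_yg\ \partial_\eta g)$, the unstable cone condition is $\lambda_A-(\sup\sigma_{\mathbb A_1^u}+\sup\sigma_{\mathbb A_2^u})>0$ and $\lambda_A+|\mu_B|-\{\sup\sigma_{\mathbb A_1^u}+\sup\sigma_{\mathbb A_2^u}+\sup\sigma_{\mathbb B_1^u}+\sup\sigma_{\mathbb B_2^u}+\sigma(\sup\sigma_{g_1^u}+\sup\sigma_{g_2^u})\}>0$. With $\mathbb A_1^s=\partial_bF_1$, $\mathbb A_2^s=(\partial_aF_1\ \partial_yF_1\ \partial_\eta F_1)$, $\mathbb B_1^s=\partial_bF_2$, $\mathbb B_2^s=(\partial_aF_2\ \partial_yF_2\ \partial_\eta F_2)$, $g_1^s=\partial_bg$,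 $g_2^s=(\partial_ag\ \partial_yg\ \partial_\eta g)$, the stable cone condition is $|\mu_B|-(\sup\sigma_{\mathbb B_1^s}+\sup\sigma_{\mathbb B_2^s})>0$ and $\lambda_A+|\mu_B|-\{\sup\sigma_{\mathbb A_1^s}+\sup\sigma_{\mathbb A_2^s}+\sup\sigma_{\mathbb B_1^s}+\sup\sigma_{\mathbb B_2^s}+\sigma(\sup\sigma_{g_1^s}+\sup\sigma_{g_2^s})\}>0$. Fast-exit face: for an $(n+1)$-dimensional h-set $M$ with $c_M(M)=\overline{B_1}\times\overline{B_s}\times[0,1]$ ($u(M)=1$ in direction $a$, $s(M)=s+1$), a fast-exit face is an h-set $M^a$ with $u(M^a)=1$ (direction $y$), $s(M^a)=s$ and $c_M(M^a)=\{a\}\times\overline{B_s}\times K_0$, $a\in\partial B_1$, $K_0\subset(0,1)$ a compact interval. Covering-exchange pair $(N,M)$ with time $T>0$ and fast-exit face $M^a$: $N$ is an h-set in $\mathbb R^{n+1}$ with $u(N)=1$ and: (CE1) $M$ is a fast-saddle-type block with coordinates $M_c=\overline{B_1}\times\overline{B_s}\times[0,1]\ni(a,b,y)$, $u(M)=1$; (CE2) the stable and unstable cone conditions hold in $M$; (CE3) for some $q\in\{\pm1\}$, $q\cdot g(x,y,\epsilon)>0$ in $M$; (CE4) $N\overset{\varphi_\epsilon(T,\cdot)}{\Longrightarrow}M$; (CE5) $M$ has a fast-exit face $M^a\subset M^{f,-}$ with $c_M(M^a)=\{a\}\times\overline{B_s}\times[y^-,y^+]$, $[y^-,y^+]\subset(0,1)$,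 such that $\sup\pi_y(\varphi_\epsilon(T,N)\cap M)<y^-$ if $q=+1$, and $\inf\pi_y(\varphi_\epsilon(T,N)\cap M)>y^+$ if $q=-1$. *)

theory Defs
  imports "HOL-Analysis.Analysis" "HOL-Homology.Homology"
begin

section \<open>h-sets and covering relations\<close>

text \<open>
  The space \<open>\<real>\<^sup>k\<close> of coordinates is the library's \<^term>\<open>Euclidean_space k\<close>, which makes sense for every
  \<open>k \<ge> 0\<close>. For \<open>k = 0\<close> the closed ball is the singleton of the origin and the sphere is empty.
\<close>

definition unit_cball :: "nat \<Rightarrow> (nat \<Rightarrow> real) set" where
  "unit_cball k = {x \<in> topspace (Euclidean_space k). (\<Sum>i<k. (x i)\<^sup>2) \<le> 1}"

definition unit_sphere :: "nat \<Rightarrow> (nat \<Rightarrow> real) set" where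
  "unit_sphere k = {x \<in> topspace (Euclidean_space k). (\<Sum>i<k. (x i)\<^sup>2) = 1}"

abbreviation split_space :: "nat \<Rightarrow> nat \<Rightarrow> ((nat \<Rightarrow> real) \<times> (nat \<Rightarrow> real)) topology" where
  "split_space u s \<equiv> prod_topology (Euclidean_space u) (Euclidean_space s)"

text \<open>
  The field \<open>hs_space\<close> is the copy of \<open>\<real>\<^bsup>dim N\<^esup>\<close> inside the ambient space on which \<open>c\<^sub>N\<close> is defined: an
  affine subspace of dimension \<open>u + s\<close>. It is the whole space if \<open>u + s\<close> is the ambient dimension.
\<close>

record 'v hset =
  hs_set :: "'v set"
  hs_u :: nat
  hs_s :: nat
  hs_space :: "'v set"
  hs_coord :: "'v \<Rightarrow> (nat \<Rightarrow> real) \<times> (nat \<Rightarrow> real)"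

definition hs_model :: "'v hset \<Rightarrow> ((nat \<Rightarrow> real) \<times> (nat \<Rightarrow> real)) set" where
  "hs_model H = unit_cball (hs_u H) \<times> unit_cball (hs_s H)"

definition hs_model_minus :: "'v hset \<Rightarrow> ((nat \<Rightarrow> real) \<times> (nat \<Rightarrow> real)) set" where
  "hs_model_minus H = unit_sphere (hs_u H) \<times> unit_cball (hs_s H)"

definition hs_model_plus :: "'v hset \<Rightarrow> ((nat \<Rightarrow> real) \<times> (nat \<Rightarrow> real)) set" where
  "hs_model_plus H = unit_cball (hs_u H) \<times> unit_sphere (hs_s H)"

definition is_hset :: "('v::euclidean_space) hset \<Rightarrow> bool" where
  "is_hset H \<longleftrightarrow>
     compact (hs_set H) \<and>
     hs_u H + hs_s H \<le> DIM('v) \<and>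
     affine (hs_space H) \<and>
     aff_dim (hs_space H) = int (hs_u H + hs_s H) \<and>
     hs_set H \<subseteq> hs_space H \<and>
     homeomorphic_map (top_of_set (hs_space H)) (split_space (hs_u H) (hs_s H)) (hs_coord H) \<and>
     hs_coord H ` hs_set H = hs_model H"

text \<open>
  \<open>deg (A, closed unit ball of \<real>\<^sup>u, 0)\<close> for a continuous map \<open>A\<close> without zeros on the unit sphere: the
  Brouwer degree of \<open>A / \<bar>A\<bar>\<close> as a self-map of \<open>S\<^bsup>u-1\<^esup>\<close>. For \<open>u = 0\<close> the only map is \<open>0 \<mapsto> 0\<close>, of degree 1.
\<close>

definition ball_degree :: "nat \<Rightarrow> ((nat \<Rightarrow> real) \<Rightarrow> (nat \<Rightarrow> real)) \<Rightarrow> int" where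
  "ball_degree u A =
     (if u = 0 then 1
      else Brouwer_degree2 (u - 1) (\<lambda>x i. A x i / sqrt (\<Sum>j<u. (A x j)\<^sup>2)))"

definition covers ::
    "('v::euclidean_space \<Rightarrow> 'v) \<Rightarrow> 'v hset \<Rightarrow> 'v hset \<Rightarrow> bool" where
  "covers F N M \<longleftrightarrow>
     hs_u N = hs_u M \<and>
     continuous_on (hs_set N) F \<and>
     F ` hs_set N \<subseteq> hs_space M \<and>
     (\<exists>h A.
        continuous_map
          (prod_topology (top_of_set {0..1::real})
             (subtopology (split_space (hs_u N) (hs_s N)) (hs_model N)))
          (split_space (hs_u M) (hs_s M)) h \<and>
        (\<forall>w\<in>hs_model N. h (0, w) = hs_coord M (F (inv_into (hs_set N) (hs_coord N) w))) \<and>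
        h ` ({0..1} \<times> hs_model_minus N) \<inter> hs_model M = {} \<and>
        h ` ({0..1} \<times> hs_model N) \<inter> hs_model_plus M = {} \<and>
        continuous_map (Euclidean_space (hs_u M)) (Euclidean_space (hs_u M)) A \<and>
        (\<forall>(p, q)\<in>hs_model N. h (1, (p, q)) = (A p, (\<lambda>_. 0))) \<and>
        A ` unit_sphere (hs_u M) \<subseteq> topspace (Euclidean_space (hs_u M)) - unit_cball (hs_u M) \<and>
        ball_degree (hs_u M) A \<noteq> 0)"

section \<open>Fast-slow systems and their flows\<close>

text \<open>
  \<open>C\<^sup>r\<close> on a set with derivatives taken within the set; it is applied to \<open>\<real>\<^sup>n \<times> \<real> \<times> [0, \<epsilon>\<^sub>0]\<close>, where these
  derivatives are unique (and one-sided in \<open>\<epsilon>\<close> at the ends).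
\<close>

primrec Cr_on ::
    "nat \<Rightarrow> ('a::euclidean_space \<Rightarrow> 'b::real_normed_vector) \<Rightarrow> 'a set \<Rightarrow> bool" where
  "Cr_on 0 f S = continuous_on S f"
| "Cr_on (Suc r) f S =
     (\<exists>D. (\<forall>x\<in>S. (f has_derivative D x) (at x within S)) \<and>
          (\<forall>v\<in>Basis. Cr_on r (\<lambda>x. D x v) S))"

text \<open>\<open>f = f\<^sub>0 + \<epsilon> f\<^sub>1 + \<dots> + \<epsilon>\<^sup>m f\<^sub>m + o(\<epsilon>\<^sup>m)\<close> as \<open>\<epsilon>\<close> decreases to 0, at each point \<open>(x, y)\<close>.\<close>

definition eps_expansion ::
    "('x \<times> 'y \<times> real \<Rightarrow> 'b::real_normed_vector) \<Rightarrow> nat \<Rightarrow> (nat \<Rightarrow> 'x \<times> 'y \<Rightarrow> 'b) \<Rightarrow> bool" where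
  "eps_expansion f m fc \<longleftrightarrow>
     (\<forall>x y. ((\<lambda>\<epsilon>. (f (x, y, \<epsilon>) - (\<Sum>i\<le>m. \<epsilon> ^ i *\<^sub>R fc i (x, y))) /\<^sub>R \<epsilon> ^ m) \<longlongrightarrow> 0) (at_right 0))"

definition fast_slow_field ::
    "('x \<times> real \<times> real \<Rightarrow> 'x) \<Rightarrow> ('x \<times> real \<times> real \<Rightarrow> real) \<Rightarrow> real \<Rightarrow> 'x \<times> real \<Rightarrow> 'x \<times> real" where
  "fast_slow_field f g \<epsilon> = (\<lambda>(x, y). (f (x, y, \<epsilon>), \<epsilon> * g (x, y, \<epsilon>)))"

text \<open>
  The flow is the local flow of the vector field; no completeness is assumed. \<open>flow X t z\<close> is meaningful
  when \<open>flow_defined X t z\<close> holds.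
\<close>

definition solves_from ::
    "('v::real_normed_vector \<Rightarrow> 'v) \<Rightarrow> real \<Rightarrow> 'v \<Rightarrow> (real \<Rightarrow> 'v) \<Rightarrow> bool" where
  "solves_from X t z \<gamma> \<longleftrightarrow>
     \<gamma> 0 = z \<and>
     (\<forall>\<tau>\<in>closed_segment 0 t. (\<gamma> has_vector_derivative X (\<gamma> \<tau>)) (at \<tau> within closed_segment 0 t))"

definition flow_defined :: "('v::real_normed_vector \<Rightarrow> 'v) \<Rightarrow> real \<Rightarrow> 'v \<Rightarrow> bool" where
  "flow_defined X t z \<longleftrightarrow> (\<exists>\<gamma>. solves_from X t z \<gamma>)"

definition flow :: "('v::real_normed_vector \<Rightarrow> 'v) \<Rightarrow> real \<Rightarrow> 'v \<Rightarrow> 'v" where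
  "flow X t z = (THE w. \<exists>\<gamma>. solves_from X t z \<gamma> \<and> \<gamma> t = w)"

definition exit_time :: "('v::real_normed_vector \<Rightarrow> 'v) \<Rightarrow> 'v set \<Rightarrow> 'v \<Rightarrow> real" where
  "exit_time X S z = Sup {t. 0 \<le> t \<and> flow_defined X t z \<and> (\<forall>\<tau>\<in>{0..t}. flow X \<tau> z \<in> S)}"

definition exit_map :: "('v::real_normed_vector \<Rightarrow> 'v) \<Rightarrow> 'v set \<Rightarrow> 'v \<Rightarrow> 'v" where
  "exit_map X S z = flow X (exit_time X S z) z"

section \<open>Local form and fast-saddle-type blocks\<close>

text \<open>
  The coordinates \<open>(a, b)\<close> are kept in one vector \<open>c :: real^'n\<close>, with \<open>x = fb_base + fb_lin *v c\<close>: the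
  components with index in \<open>fb_unst\<close> form \<open>a\<close>, the remaining ones \<open>b\<close> (possibly none). Accordingly
  \<open>fb_eig\<close> holds the diagonals of \<open>A\<close> and \<open>B\<close>, and \<open>fb_lo\<close>, \<open>fb_hi\<close> the ends of the intervals of the block
  in the \<open>a\<close>- and \<open>b\<close>-directions; \<open>fb_ylo\<close> and \<open>fb_yhi\<close> are the ends of \<open>K\<close>.
\<close>

record 'n fs_block =
  fb_base :: "real^'n"
  fb_lin :: "real^'n^'n"
  fb_unst :: "'n set"
  fb_eig :: "real^'n"
  fb_lo :: "real^'n"
  fb_hi :: "real^'n"
  fb_ylo :: real
  fb_yhi :: real

definition to_local :: "('n::finite) fs_block \<Rightarrow> real^'n \<Rightarrow> real^'n" where
  "to_local D x = matrix_inv (fb_lin D) *v (x - fb_base D)"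

definition from_local :: "('n::finite) fs_block \<Rightarrow> real^'n \<Rightarrow> real^'n" where
  "from_local D c = fb_base D + fb_lin D *v c"

text \<open>\<open>F = (F\<^sub>1, F\<^sub>2)\<close>: what remains of the fast equation in local coordinates after the diagonal linear part.\<close>

definition local_F ::
    "('n::finite) fs_block \<Rightarrow> ((real^'n) \<times> real \<times> real \<Rightarrow> real^'n) \<Rightarrow> (real^'n) \<times> real \<times> real \<Rightarrow> real^'n" where
  "local_F D f = (\<lambda>(c, y, \<epsilon>).
     matrix_inv (fb_lin D) *v f (from_local D c, y, \<epsilon>) - (\<chi> i. fb_eig D $ i * c $ i))"

definition local_g ::
    "('n::finite) fs_block \<Rightarrow> ((real^'n) \<times> real \<times> real \<Rightarrow> real) \<Rightarrow> (real^'n) \<times> real \<times> real \<Rightarrow> real" where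
  "local_g D g = (\<lambda>(c, y, \<epsilon>). g (from_local D c, y, \<epsilon>))"

definition block_local :: "('n::finite) fs_block \<Rightarrow> ((real^'n) \<times> real) set" where
  "block_local D = {(c, y). (\<forall>i. fb_lo D $ i \<le> c $ i \<and> c $ i \<le> fb_hi D $ i) \<and> fb_ylo D \<le> y \<and> y \<le> fb_yhi D}"

definition block_set :: "('n::finite) fs_block \<Rightarrow> ((real^'n) \<times> real) set" where
  "block_set D = (\<lambda>(c, y). (from_local D c, y)) ` block_local D"

definition fast_exit :: "('n::finite) fs_block \<Rightarrow> ((real^'n) \<times> real) set" where
  "fast_exit D = (\<lambda>(c, y). (from_local D c, y)) `
     {(c, y) \<in> block_local D. \<exists>i\<in>fb_unst D. c $ i = fb_lo D $ i \<or> c $ i = fb_hi D $ i}"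

text \<open>The inequalities for \<open>fb_lo\<close> and \<open>fb_hi\<close> (instead of equalities) allow the intervals to be enlarged.\<close>

definition fast_saddle_block ::
    "((real^'n) \<times> real \<times> real \<Rightarrow> real^'n) \<Rightarrow> real \<Rightarrow> ('n::finite) fs_block \<Rightarrow> bool" where
  "fast_saddle_block f \<epsilon>\<^sub>0 D \<longleftrightarrow>
     invertible (fb_lin D) \<and>
     (\<forall>i\<in>fb_unst D. 0 < fb_eig D $ i) \<and>
     (\<forall>i\<in>- fb_unst D. fb_eig D $ i < 0) \<and>
     fb_ylo D < fb_yhi D \<and>
     (\<exists>W (\<delta>\<^sub>m :: real^'n) (\<delta>\<^sub>p :: real^'n).
        compact W \<and>
        (\<forall>x\<in>W. \<forall>y\<in>{fb_ylo D..fb_yhi D}. \<forall>\<epsilon>\<in>{0..\<epsilon>\<^sub>0}. \<forall>i.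
           \<delta>\<^sub>m $ i < local_F D f (to_local D x, y, \<epsilon>) $ i \<and>
           local_F D f (to_local D x, y, \<epsilon>) $ i < \<delta>\<^sub>p $ i) \<and>
        (\<forall>i\<in>fb_unst D. fb_lo D $ i \<le> - \<delta>\<^sub>p $ i / fb_eig D $ i \<and> - \<delta>\<^sub>m $ i / fb_eig D $ i \<le> fb_hi D $ i) \<and>
        (\<forall>i\<in>- fb_unst D. fb_lo D $ i \<le> - \<delta>\<^sub>m $ i / fb_eig D $ i \<and> - \<delta>\<^sub>p $ i / fb_eig D $ i \<le> fb_hi D $ i) \<and>
        block_set D \<subseteq> W \<times> {fb_ylo D..fb_yhi D})"

section \<open>Cone conditions\<close>

definition max_singular_value :: "('a::euclidean_space \<Rightarrow> 'b::euclidean_space) \<Rightarrow> real" where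
  "max_singular_value L = sqrt (Max {l. \<exists>v. v \<noteq> 0 \<and> adjoint L (L v) = l *\<^sub>R v})"

definition sup_sigma :: "'p set \<Rightarrow> ('p \<Rightarrow> 'a::euclidean_space \<Rightarrow> 'b::euclidean_space) \<Rightarrow> real" where
  "sup_sigma S L = (SUP p\<in>S. max_singular_value (L p))"

definition coord_proj :: "'n set \<Rightarrow> real^'n \<Rightarrow> real^('n::finite)" where
  "coord_proj I v = (\<chi> i. if i \<in> I then v $ i else 0)"

text \<open>
  The derivative in \<open>(c, y, \<eta>)\<close> with \<open>\<epsilon> = \<eta> \<sigma>\<close>, \<open>\<eta> \<in> [0,1]\<close>, followed by its blocks: the columns with index
  in \<open>I\<close>, and the columns with index in \<open>I\<close> together with those of \<open>y\<close> and \<open>\<eta>\<close>. A block is padded with zero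
  rows and columns, which does not change the maximal singular value (and makes it 0 for an empty block).
\<close>

definition eta_derivative ::
    "real \<Rightarrow> ('x::real_normed_vector \<times> real \<times> real \<Rightarrow> 'b::real_normed_vector)
      \<Rightarrow> 'x \<times> real \<times> real \<Rightarrow> 'x \<times> real \<times> real \<Rightarrow> 'b" where
  "eta_derivative \<sigma> H p =
     frechet_derivative (\<lambda>(c, y, \<eta>). H (c, y, \<eta> * \<sigma>)) (at p within UNIV \<times> UNIV \<times> {0..1})"

definition cols :: "'n set \<Rightarrow> ((real^('n::finite)) \<times> real \<times> real \<Rightarrow> 'b) \<Rightarrow> real^'n \<Rightarrow> 'b" where
  "cols I L = (\<lambda>v. L (coord_proj I v, 0, 0))"

definition cols_y_eta ::
    "'n set \<Rightarrow> ((real^('n::finite)) \<times> real \<times> real \<Rightarrow> 'b) \<Rightarrow> (real^'n) \<times> real \<times> real \<Rightarrow> 'b" where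
  "cols_y_eta I L = (\<lambda>(v, y, \<eta>). L (coord_proj I v, y, \<eta>))"

definition unstable_cone_condition ::
    "('n::finite) fs_block \<Rightarrow> ((real^'n) \<times> real \<times> real \<Rightarrow> real^'n) \<Rightarrow> ((real^'n) \<times> real \<times> real \<Rightarrow> real)
      \<Rightarrow> real \<Rightarrow> real \<Rightarrow> real \<Rightarrow> bool" where
  "unstable_cone_condition D f g \<epsilon>\<^sub>0 lam\<^sub>A mu\<^sub>B \<longleftrightarrow>
     (let \<sigma> = \<epsilon>\<^sub>0;
          U = fb_unst D;
          S = {(c, y, \<eta>). (c, y) \<in> block_local D \<and> \<eta> \<in> {0..1}};
          DF1 = (\<lambda>p. coord_proj U \<circ> eta_derivative \<sigma> (local_F D f) p);
          DF2 = (\<lambda>p. coord_proj (- U) \<circ> eta_derivative \<sigma> (local_F D f) p);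
          Dg = eta_derivative \<sigma> (local_g D g);
          sA1 = sup_sigma S (\<lambda>p. cols U (DF1 p));
          sA2 = sup_sigma S (\<lambda>p. cols_y_eta (- U) (DF1 p));
          sB1 = sup_sigma S (\<lambda>p. cols U (DF2 p));
          sB2 = sup_sigma S (\<lambda>p. cols_y_eta (- U) (DF2 p));
          sg1 = sup_sigma S (\<lambda>p. cols U (Dg p));
          sg2 = sup_sigma S (\<lambda>p. cols_y_eta (- U) (Dg p))
      in lam\<^sub>A - (sA1 + sA2) > 0 \<and>
         lam\<^sub>A + \<bar>mu\<^sub>B\<bar> - (sA1 + sA2 + sB1 + sB2 + \<sigma> * (sg1 + sg2)) > 0)"

definition stable_cone_condition ::
    "('n::finite) fs_block \<Rightarrow> ((real^'n) \<times> real \<times> real \<Rightarrow> real^'n) \<Rightarrow> ((real^'n) \<times> real \<times> real \<Rightarrow> real)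
      \<Rightarrow> real \<Rightarrow> real \<Rightarrow> real \<Rightarrow> bool" where
  "stable_cone_condition D f g \<epsilon>\<^sub>0 lam\<^sub>A mu\<^sub>B \<longleftrightarrow>
     (let \<sigma> = \<epsilon>\<^sub>0;
          U = fb_unst D;
          S = {(c, y, \<eta>). (c, y) \<in> block_local D \<and> \<eta> \<in> {0..1}};
          DF1 = (\<lambda>p. coord_proj U \<circ> eta_derivative \<sigma> (local_F D f) p);
          DF2 = (\<lambda>p. coord_proj (- U) \<circ> eta_derivative \<sigma> (local_F D f) p);
          Dg = eta_derivative \<sigma> (local_g D g);
          sA1 = sup_sigma S (\<lambda>p. cols (- U) (DF1 p));
          sA2 = sup_sigma S (\<lambda>p. cols_y_eta U (DF1 p));
          sB1 = sup_sigma S (\<lambda>p. cols (- U) (DF2 p));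
          sB2 = sup_sigma S (\<lambda>p. cols_y_eta U (DF2 p));
          sg1 = sup_sigma S (\<lambda>p. cols (- U) (Dg p));
          sg2 = sup_sigma S (\<lambda>p. cols_y_eta U (Dg p))
      in \<bar>mu\<^sub>B\<bar> - (sB1 + sB2) > 0 \<and>
         lam\<^sub>A + \<bar>mu\<^sub>B\<bar> - (sA1 + sA2 + sB1 + sB2 + \<sigma> * (sg1 + sg2)) > 0)"

section \<open>Blocks as h-sets, fast-exit faces, covering-exchange pairs\<close>

text \<open>
  From here on \<open>u = 1\<close>; \<open>i\<close> is the index of the single unstable direction and \<open>s = n - 1\<close>.
  The intervals for \<open>a\<close> and \<open>y\<close> are normalised by increasing affine maps; a homeomorphism \<open>\<beta>\<close> carries the
  \<open>b\<close>-space onto \<open>\<real>\<^sup>s\<close> and the box of \<open>b\<close>'s onto the closed unit ball.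
\<close>

definition norm_a :: "('n::finite) fs_block \<Rightarrow> 'n \<Rightarrow> (real^'n) \<times> real \<Rightarrow> real" where
  "norm_a D i z = (2 * to_local D (fst z) $ i - fb_lo D $ i - fb_hi D $ i) / (fb_hi D $ i - fb_lo D $ i)"

definition norm_y :: "('n::finite) fs_block \<Rightarrow> (real^'n) \<times> real \<Rightarrow> real" where
  "norm_y D z = (snd z - fb_ylo D) / (fb_yhi D - fb_ylo D)"

definition norm_b ::
    "('n::finite) fs_block \<Rightarrow> 'n \<Rightarrow> (real^'n \<Rightarrow> nat \<Rightarrow> real) \<Rightarrow> (real^'n) \<times> real \<Rightarrow> nat \<Rightarrow> real" where
  "norm_b D i \<beta> z = \<beta> (coord_proj (- {i}) (to_local D (fst z)))"

definition block_coord ::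
    "('n::finite) fs_block \<Rightarrow> 'n \<Rightarrow> (real^'n \<Rightarrow> nat \<Rightarrow> real)
      \<Rightarrow> (real^'n) \<times> real \<Rightarrow> real \<times> (nat \<Rightarrow> real) \<times> real" where
  "block_coord D i \<beta> z = (norm_a D i z, norm_b D i \<beta> z, norm_y D z)"

definition line_embed :: "real \<Rightarrow> nat \<Rightarrow> real" where
  "line_embed r = (\<lambda>j. if j = 0 then r else 0)"

text \<open>
  The block \<open>D\<close>, in coordinates with image \<open>[-1,1] \<times> closed unit ball of \<real>\<^sup>s \<times> [0,1]\<close>, as the h-set \<open>M\<close> with
  \<open>u(M) = 1\<close>, \<open>s(M) = s + 1\<close>. The homeomorphism \<open>\<theta>\<close> is the identification of
  \<open>closed unit ball of \<real>\<^sup>s \<times> [0,1]\<close> with the closed unit ball of \<open>\<real>\<^bsup>s+1\<^esup>\<close>.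
\<close>

definition block_hset ::
    "('n::finite) fs_block \<Rightarrow> 'n \<Rightarrow> (real^'n \<Rightarrow> nat \<Rightarrow> real) \<Rightarrow> ((nat \<Rightarrow> real) \<times> real \<Rightarrow> nat \<Rightarrow> real)
      \<Rightarrow> ((real^'n) \<times> real) hset \<Rightarrow> bool" where
  "block_hset D i \<beta> \<theta> M \<longleftrightarrow>
     (let s = CARD('n) - 1 in
        fb_unst D = {i} \<and>
        homeomorphic_map (top_of_set {b. b $ i = 0}) (Euclidean_space s) \<beta> \<and>
        \<beta> ` {b. b $ i = 0 \<and> (\<forall>j. j \<noteq> i \<longrightarrow> fb_lo D $ j \<le> b $ j \<and> b $ j \<le> fb_hi D $ j)} = unit_cball s \<and>
        homeomorphic_map (prod_topology (Euclidean_space s) euclideanreal) (Euclidean_space (Suc s)) \<theta> \<and>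
        \<theta> ` (unit_cball s \<times> {0..1}) = unit_cball (Suc s) \<and>
        is_hset M \<and>
        hs_set M = block_set D \<and>
        hs_u M = 1 \<and> hs_s M = Suc s \<and>
        (\<forall>z. hs_coord M z = (line_embed (norm_a D i z), \<theta> (norm_b D i \<beta> z, norm_y D z))) \<and>
        block_coord D i \<beta> ` hs_set M = {-1..1} \<times> unit_cball s \<times> {0..1})"

text \<open>
  The unstable coordinate of a fast-exit face is a function of \<open>y\<close> and its stable coordinate a function of
  \<open>b\<close>; both are then automatically homeomorphisms.
\<close>

definition fast_exit_face ::
    "('n::finite) fs_block \<Rightarrow> 'n \<Rightarrow> (real^'n \<Rightarrow> nat \<Rightarrow> real) \<Rightarrow> real \<Rightarrow> real \<Rightarrow> real
      \<Rightarrow> ((real^'n) \<times> real) hset \<Rightarrow> bool" where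
  "fast_exit_face D i \<beta> a y\<^sub>m y\<^sub>p E \<longleftrightarrow>
     is_hset E \<and>
     hs_u E = 1 \<and> hs_s E = CARD('n) - 1 \<and>
     a \<in> {-1, 1} \<and> 0 < y\<^sub>m \<and> y\<^sub>m < y\<^sub>p \<and> y\<^sub>p < 1 \<and>
     hs_set E \<subseteq> block_set D \<and>
     block_coord D i \<beta> ` hs_set E = {a} \<times> unit_cball (CARD('n) - 1) \<times> {y\<^sub>m..y\<^sub>p} \<and>
     (\<exists>l \<rho>. \<forall>z\<in>hs_space E. hs_coord E z = (line_embed (l (norm_y D z)), \<rho> (norm_b D i \<beta> z)))"

definition covering_exchange_pair ::
    "((real^('n::finite)) \<times> real \<times> real \<Rightarrow> real^'n) \<Rightarrow> ((real^'n) \<times> real \<times> real \<Rightarrow> real) \<Rightarrow> real \<Rightarrow> real \<Rightarrow> real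
      \<Rightarrow> ((real^'n) \<times> real) hset \<Rightarrow> ((real^'n) \<times> real) hset \<Rightarrow> ((real^'n) \<times> real) hset \<Rightarrow> bool" where
  "covering_exchange_pair f g \<epsilon>\<^sub>0 \<epsilon> T N M E \<longleftrightarrow>
     (let \<phi> = flow (fast_slow_field f g \<epsilon>) in
        0 < T \<and> is_hset N \<and> hs_u N = 1 \<and>
        (\<exists>D i \<beta> \<theta> lam\<^sub>A mu\<^sub>B q a y\<^sub>m y\<^sub>p.
           fast_saddle_block f \<epsilon>\<^sub>0 D \<and> block_hset D i \<beta> \<theta> M \<and>
           0 < lam\<^sub>A \<and> (\<forall>j\<in>fb_unst D. lam\<^sub>A < fb_eig D $ j) \<and>
           mu\<^sub>B < 0 \<and> (\<forall>j\<in>- fb_unst D. fb_eig D $ j < mu\<^sub>B) \<and>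
           unstable_cone_condition D f g \<epsilon>\<^sub>0 lam\<^sub>A mu\<^sub>B \<and> stable_cone_condition D f g \<epsilon>\<^sub>0 lam\<^sub>A mu\<^sub>B \<and>
           q \<in> {-1, 1} \<and> (\<forall>(x, y)\<in>hs_set M. q * g (x, y, \<epsilon>) > 0) \<and>
           (\<forall>z\<in>hs_set N. flow_defined (fast_slow_field f g \<epsilon>) T z) \<and> covers (\<phi> T) N M \<and>
           fast_exit_face D i \<beta> a y\<^sub>m y\<^sub>p E \<and> hs_set E \<subseteq> fast_exit D \<and>
           (q = 1 \<longrightarrow> (SUP z\<in>\<phi> T ` hs_set N \<inter> hs_set M. norm_y D z) < y\<^sub>m) \<and>
           (q = -1 \<longrightarrow> (INF z\<in>\<phi> T ` hs_set N \<inter> hs_set M. norm_y D z) > y\<^sub>p)))"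

end

theory Submission
  imports Defs
begin

text \<open>
  On the faces of the block \<open>M\<close> the field points strictly outwards (fast-exit faces and the far end of the slow
  interval) or strictly inwards (all other faces), and every orbit in \<open>M\<close> leaves because the slow variable is
  monotone. Hence the exit map of \<open>M\<close> is continuous (Wazewski). Slowing the field down so that it vanishes on the
  boundary gives homeomorphisms \<open>\<Theta>\<close> of the whole space that are the identity outside \<open>M\<close>, commute with the exit map,
  and push any compact part of \<open>M\<close> off the entrance faces as close to the exit faces as desired.

  Next to the face containing \<open>M_exit\<close> take a thin box \<open>M\<^sub>0\<close> with the slow direction as unstable one, slightly longer than
  the slow extent of \<open>M_exit\<close>. On it the exit map is close to the identity, so \<open>M\<^sub>0\<close> covers \<open>M_exit\<close>. The image of
  \<open>N\<close> crosses \<open>M\<close> from one fast-exit face to the other below \<open>M_exit\<close>; after \<open>\<Theta>\<close> it runs along the exit faces, around the far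
  end of the slow interval, and therefore across \<open>M\<^sub>0\<close>. So \<open>\<Theta>\<^sup>-\<^sup>1(M\<^sub>0)\<close> is the required h-set.
\<close>

section \<open>Flows of bounded Lipschitz fields\<close>

text \<open>The covering of \<open>M\<close> stretches the fast direction, \<open>M_exit\<close> the
  slow one, so an intermediate set has to exchange the unstable directions. The image of
  \<open>N\<close> may cross the block far from the exit faces, so a plain box next to a face need
  not be met by it; this is why the h-set is the preimage of a box under a homeomorphism. As
  \<Theta> fixes the exit faces and the complement of \<open>M\<close>, it preserves the boundary
  conditions of covering homotopies, and as it moves points along orbits, the exit map on the
  preimage is the one on the box.

  Closeness to the exit faces is measured by the slow distance \<nu> (P z) - \<nu> z still to be
  travelled. It vanishes exactly at fixed points of \<open>P\<close>, so by compactness its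
  smallness makes the whole displacement small.

  In unstable dimension 1 the degree reduces to a sign: the two ends of \<open>N\<close> land on
  opposite sides of the block. The tilt turns the sides \<alpha> > 1 and \<alpha> < -1 into below
  and above the slow window and thus carries this sign from one unstable direction to the
  other.\<close>

lemma norm_gronwall:
  fixes u u' :: "real \<Rightarrow> 'a::real_inner"
  assumes "0 \<le> T"
    and der: "\<And>t. t \<in> {0..T} \<Longrightarrow> (u has_vector_derivative u' t) (at t within {0..T})"
    and bound: "\<And>t. t \<in> {0..T} \<Longrightarrow> norm (u' t) \<le> C * norm (u t)"
  shows "norm (u T) \<le> exp (C * T) * norm (u 0)"
proof -
  \<comment> \<open>The squared norm is differentiable even where \<open>u\<close> vanishes, which
    the norm need not be; the weight cancels the growth that \<open>bound\<close> allows.\<close>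
  define w where "w t = exp (-2 * C * t) * (u t \<bullet> u t)" for t
  have cont_u: "continuous_on {0..T} u"
    using der by (meson continuous_on_eq_continuous_within has_vector_derivative_continuous)
  have "w T \<le> w 0"
  proof (rule DERIV_nonpos_imp_decreasing_open [OF \<open>0 \<le> T\<close>])
    fix t assume t: "0 < t" "t < T"
    have "(u has_vector_derivative u' t) (at t)"
      using der [of t] t by (simp add: at_within_Icc_at)
    then have d: "(u has_derivative (\<lambda>h. h *\<^sub>R u' t)) (at t)"
      by (simp add: has_vector_derivative_def)
    have "((\<lambda>t. u t \<bullet> u t) has_derivative (\<lambda>h. h * (2 * (u t \<bullet> u' t)))) (at t)"
      by (rule derivative_eq_intros d refl | simp add: inner_commute algebra_simps)+
    then have "((\<lambda>t. u t \<bullet> u t) has_real_derivative 2 * (u t \<bullet> u' t)) (at t)"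
      by (simp add: has_field_derivative_def mult.commute [of _ "2 * (u t \<bullet> u' t)"])
    then have "(w has_real_derivative exp (-2 * C * t) * (2 * (u t \<bullet> u' t) - 2 * C * (u t \<bullet> u t))) (at t)"
      unfolding w_def by (auto intro!: derivative_eq_intros simp: algebra_simps)
    moreover
    have "u t \<bullet> u' t \<le> C * (u t \<bullet> u t)"
    proof -
      have "u t \<bullet> u' t \<le> norm (u t) * norm (u' t)"
        by (rule norm_cauchy_schwarz)
      also have "\<dots> \<le> norm (u t) * (C * norm (u t))"
        using bound [of t] t by (intro mult_left_mono) auto
      also have "\<dots> = C * (u t \<bullet> u t)"
        by (simp add: power2_norm_eq_inner [symmetric] power2_eq_square)
      finally show ?thesis .
    qed
    then have "exp (-2 * C * t) * (2 * (u t \<bullet> u' t) - 2 * C * (u t \<bullet> u t)) \<le> 0"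
      by (simp add: mult_le_0_iff)
    ultimately show "\<exists>y. (w has_real_derivative y) (at t) \<and> y \<le> 0" by blast
  qed (auto simp: w_def intro!: continuous_intros cont_u)
  then have "u T \<bullet> u T \<le> exp (2 * C * T) * (u 0 \<bullet> u 0)"
    by (simp add: w_def exp_minus field_simps)
  also have "\<dots> = (exp (C * T) * norm (u 0))\<^sup>2"
    by (simp add: power_mult_distrib power2_norm_eq_inner exp_double [symmetric] mult.assoc)
  finally have "(norm (u T))\<^sup>2 \<le> (exp (C * T) * norm (u 0))\<^sup>2"
    by (simp add: power2_norm_eq_inner)
  then show ?thesis
    by (rule power2_le_imp_le) simp
qed

text \<open>Picard iteration in the weight \<open>exp (- k t)\<close> is a contraction on the whole half line.\<close>

lemma lipschitz_ode_solution_exists: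
  fixes Z :: "'a::euclidean_space \<Rightarrow> 'a"
  assumes lip: "L-lipschitz_on UNIV Z" and bdd: "bounded (range Z)"
  shows "\<exists>\<gamma>. \<gamma> 0 = z \<and> (\<forall>t\<ge>0. (\<gamma> has_vector_derivative Z (\<gamma> t)) (at t within {0..}))"
proof -
  \<comment> \<open>The iteration contracts with factor at most \<open>L / k\<close>; this choice
    makes it at most 1/2 and stays positive for \<open>L = 0\<close>.\<close>
  define k where "k = 2 * L + 1"
  have L: "0 \<le> L" using lip by (rule lipschitz_on_nonneg)
  then have k: "0 < k" by (simp add: k_def)
  obtain B where B: "\<And>x. norm (Z x) \<le> B" using bdd by (auto simp: bounded_iff)
  have contZ: "continuous_on UNIV Z" using lip by (rule lipschitz_on_continuous_on)
  \<comment> \<open>The unknown is the rescaled \<open>u\<close> with \<gamma> t = z + exp (k t) u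
    t, so the weight sits inside the argument of \<open>Z\<close>.\<close>
  define J where "J u s = Z (z + exp (k * s) *\<^sub>R u s)" for u :: "real \<Rightarrow> 'a" and s
  define I where "I u t = integral {0..t} (J u)" for u t
  \<comment> \<open>Bounded continuous functions form a type of functions on the whole line, so the
    iterate is continued as a constant to negative times. It is bounded because the weight damps the
    linear growth of \<open>I\<close>.\<close>
  define G where "G u t = exp (- k * max 0 t) *\<^sub>R I u (max 0 t)" for u t
  have contJ: "continuous_on S (J u)" if "continuous_on UNIV u" for u S
    unfolding J_def using that
    by (intro continuous_on_compose2 [OF contZ]) (auto intro!: continuous_intros intro: continuous_on_subset)
  have dI: "(I u has_vector_derivative J u t) (at t within {0..})"
    if u: "continuous_on UNIV u" and "0 \<le> t" for u t
  proof -
    have "(I u has_vector_derivative J u t) (at t within {0..t+1})"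
      unfolding I_def by (rule integral_has_vector_derivative [OF contJ [OF u]]) (use \<open>0 \<le> t\<close> in auto)
    also have "at t within {0..t+1} = at t within {0..}"
      by (rule at_within_nhd [of t "{..<t+1}"]) auto
    finally show ?thesis .
  qed
  have contI: "continuous_on {0..} (I u)" if "continuous_on UNIV u" for u
    using dI [OF that] by (auto simp: continuous_on_eq_continuous_within intro: has_vector_derivative_continuous)
  have normI: "norm (I u t) \<le> B * t" if "continuous_on UNIV u" "0 \<le> t" for u t
  proof -
    have "norm (I u t) \<le> integral {0..t} (\<lambda>_. B)"
      unfolding I_def using B that
      by (intro integral_norm_bound_integral integrable_continuous_interval contJ) (auto simp: J_def)
    then show ?thesis using that by (simp add: mult.commute)
  qed
  have G_bcontfun: "G u \<in> bcontfun" if u: "continuous_on UNIV u" for u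
  proof -
    have "continuous_on UNIV (G u)"
      unfolding G_def
      by (intro continuous_intros continuous_on_compose2 [OF contI [OF u], of UNIV "\<lambda>t. max 0 t"]) auto
    moreover have "norm (G u t) \<le> B / k" for t
    proof -
      define p where "p = max 0 t"
      have "0 \<le> B" using B [of 0] norm_ge_zero order_trans by blast
      have "k * p \<le> exp (k * p)" using exp_ge_add_one_self [of "k * p"] by linarith
      then have "exp (- k * p) * p \<le> 1 / k" using k by (simp add: exp_minus field_simps)
      then have "B * (exp (- k * p) * p) \<le> B * (1 / k)" using \<open>0 \<le> B\<close> by (rule mult_left_mono)
      moreover have "norm (G u t) \<le> exp (- k * p) * (B * p)"
        unfolding G_def p_def [symmetric] using normI [OF u, of p] by (simp add: p_def)
      ultimately show ?thesis by (simp add: mult_ac)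
    qed
    ultimately show ?thesis by (auto simp: bcontfun_def bounded_iff)
  qed
  define GG where "GG u = Bcontfun (G (apply_bcontfun u))" for u :: "real \<Rightarrow>\<^sub>C 'a"
  have GG: "apply_bcontfun (GG u) = G (apply_bcontfun u)" for u
    unfolding GG_def by (rule Bcontfun_inverse [OF G_bcontfun]) simp
  have contraction: "dist (GG u) (GG v) \<le> 1/2 * dist u v" for u v
  proof (rule dist_bound)
    fix t :: real
    define p where "p = max 0 t"
    define d where "d = dist u v"
    have p: "0 \<le> p" by (simp add: p_def)
    have "((\<lambda>s. L * d * exp (k * s)) has_integral L * d * exp (k * p) / k - L * d * exp (k * 0) / k) {0..p}"
      (is "(_ has_integral ?v) _")
      using k p by (intro fundamental_theorem_of_calculus)
        (auto intro!: derivative_eq_intros simp: has_real_derivative_iff_has_vector_derivative [symmetric])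
    moreover have "?v = L * d * (exp (k * p) - 1) / k"
      by (simp add: diff_divide_distrib right_diff_distrib)
    ultimately have int_exp: "(\<lambda>s. L * d * exp (k * s)) integrable_on {0..p}"
      "integral {0..p} (\<lambda>s. L * d * exp (k * s)) = L * d * (exp (k * p) - 1) / k"
      by (auto simp: integrable_on_def dest: integral_unique)
    have "norm (I u p - I v p) = norm (integral {0..p} (\<lambda>s. J u s - J v s))"
      unfolding I_def by (subst Henstock_Kurzweil_Integration.integral_diff) (auto intro!: integrable_continuous_interval contJ)
    also have "\<dots> \<le> integral {0..p} (\<lambda>s. L * d * exp (k * s))"
    proof (rule integral_norm_bound_integral)
      fix s assume "s \<in> {0..p}"
      have "norm (J u s - J v s) \<le> L * norm (exp (k * s) *\<^sub>R u s - exp (k * s) *\<^sub>R v s)"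
        unfolding J_def using lipschitz_onD [OF lip, of "z + exp (k * s) *\<^sub>R u s" "z + exp (k * s) *\<^sub>R v s"]
        by (simp add: dist_norm)
      also have "\<dots> = L * (exp (k * s) * dist (u s) (v s))"
        by (simp add: dist_norm scaleR_diff_right [symmetric])
      also have "\<dots> \<le> L * (exp (k * s) * d)"
        unfolding d_def using L by (intro mult_left_mono dist_bounded) auto
      finally show "norm (J u s - J v s) \<le> L * d * exp (k * s)" by (simp add: mult_ac)
    qed (use int_exp in \<open>auto intro!: integrable_continuous_interval contJ continuous_intros\<close>)
    finally have le: "norm (I u p - I v p) \<le> L * d * (exp (k * p) - 1) / k" using int_exp by simp
    have "dist (apply_bcontfun (GG u) t) (apply_bcontfun (GG v) t) = exp (- k * p) * norm (I u p - I v p)"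
      unfolding GG G_def p_def [symmetric] by (simp add: dist_norm scaleR_diff_right [symmetric])
    also have "\<dots> \<le> exp (- k * p) * (L * d * (exp (k * p) - 1) / k)"
      using le by (intro mult_left_mono) auto
    also have "\<dots> = L * d * (1 - exp (- k * p)) / k"
      by (simp add: exp_minus field_simps)
    also have "\<dots> \<le> L * d * 1 / k"
      using L k by (intro divide_right_mono mult_left_mono) (auto simp: d_def)
    also have "\<dots> \<le> 1/2 * d"
      using L k by (simp add: k_def field_simps d_def)
    finally show "dist (apply_bcontfun (GG u) t) (apply_bcontfun (GG v) t) \<le> 1/2 * dist u v"
      by (simp add: d_def)
  qed
  obtain u where u: "GG u = u"
    using banach_fix_type [of "1/2" GG] contraction by auto
  define \<gamma> where "\<gamma> t = z + exp (k * t) *\<^sub>R u t" for t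
  have \<gamma>: "\<gamma> t = z + I u t" if "0 \<le> t" for t
  proof -
    have "u t = exp (- k * t) *\<^sub>R I u t" using fun_cong [OF GG [of u], of t] that by (simp add: u G_def)
    then show ?thesis by (simp add: \<gamma>_def exp_minus)
  qed
  have "(\<gamma> has_vector_derivative Z (\<gamma> t)) (at t within {0..})" if "0 \<le> t" for t
  proof -
    have "((\<lambda>t. z + I u t) has_vector_derivative Z (\<gamma> t)) (at t within {0..})"
      using dI [of u t] that by (auto intro!: derivative_eq_intros simp: J_def \<gamma>_def)
    then show ?thesis
      by (rule has_vector_derivative_transform [rotated 2]) (use that \<gamma> in auto)
  qed
  moreover have "\<gamma> 0 = z" by (simp add: \<gamma> I_def)
  ultimately show ?thesis by blast
qed

section \<open>Semiflows of globally Lipschitz fields\<close>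

definition is_semiflow :: "('a::real_normed_vector \<Rightarrow> 'a) \<Rightarrow> ('a \<Rightarrow> real \<Rightarrow> 'a) \<Rightarrow> bool" where
  "is_semiflow Z \<Phi> \<longleftrightarrow>
     (\<forall>z. \<Phi> z 0 = z \<and> (\<forall>t\<ge>0. (\<Phi> z has_vector_derivative Z (\<Phi> z t)) (at t within {0..})))"

lemma lipschitz_semiflow_exists:
  fixes Z :: "'a::euclidean_space \<Rightarrow> 'a"
  assumes "L-lipschitz_on UNIV Z" "bounded (range Z)"
  obtains \<Phi> where "is_semiflow Z \<Phi>"
  using lipschitz_ode_solution_exists [OF assms] unfolding is_semiflow_def by metis

text \<open>Gronwall for the difference of two solutions. The set \<open>S\<close> is kept general
  because the original field is Lipschitz only on balls, whereas the modified fields are so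
  globally.\<close>

lemma ode_unique:
  fixes Z :: "'a::real_inner \<Rightarrow> 'a"
  assumes "0 \<le> T" "L-lipschitz_on S Z"
    and "\<And>t. t \<in> {0..T} \<Longrightarrow> (u has_vector_derivative Z (u t)) (at t within {0..T})"
    and "\<And>t. t \<in> {0..T} \<Longrightarrow> (v has_vector_derivative Z (v t)) (at t within {0..T})"
    and "\<And>t. t \<in> {0..T} \<Longrightarrow> u t \<in> S" "\<And>t. t \<in> {0..T} \<Longrightarrow> v t \<in> S"
  shows "dist (u T) (v T) \<le> exp (L * T) * dist (u 0) (v 0)"
  unfolding dist_norm
  by (rule norm_gronwall [where u' = "\<lambda>t. Z (u t) - Z (v t)"])
    (use assms lipschitz_onD [OF assms(2)] in \<open>auto intro!: derivative_intros simp: dist_norm\<close>)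

lemma semiflow_derivative:
  "is_semiflow Z \<Phi> \<Longrightarrow> 0 \<le> t \<Longrightarrow> S \<subseteq> {0..} \<Longrightarrow> (\<Phi> z has_vector_derivative Z (\<Phi> z t)) (at t within S)"
  unfolding is_semiflow_def by (meson has_vector_derivative_within_subset)

lemma semiflow_0 [simp]: "is_semiflow Z \<Phi> \<Longrightarrow> \<Phi> z 0 = z"
  by (simp add: is_semiflow_def)

lemma continuous_on_semiflow_time:
  "is_semiflow Z \<Phi> \<Longrightarrow> S \<subseteq> {0..} \<Longrightarrow> continuous_on S (\<Phi> z)"
  by (meson continuous_on_eq_continuous_within has_vector_derivative_continuous semiflow_derivative subset_iff atLeast_iff)

context
  fixes Z :: "'a::euclidean_space \<Rightarrow> 'a" and L \<Phi>
  assumes lip: "L-lipschitz_on UNIV Z" and sf: "is_semiflow Z \<Phi>"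
begin

lemma semiflow_dist_le: "0 \<le> t \<Longrightarrow> dist (\<Phi> x t) (\<Phi> y t) \<le> exp (L * t) * dist x y"
  using ode_unique [OF _ lip, of t "\<Phi> x" "\<Phi> y"] sf by (simp add: semiflow_derivative)

lemma semiflow_unique:
  assumes "0 \<le> T" "\<And>t. t \<in> {0..T} \<Longrightarrow> (u has_vector_derivative Z (u t)) (at t within {0..T})"
  shows "u T = \<Phi> (u 0) T"
  using ode_unique [OF assms(1) lip assms(2), of "\<Phi> (u 0)"] sf by (simp add: semiflow_derivative)

lemma continuous_on_semiflow: "0 \<le> t \<Longrightarrow> continuous_on UNIV (\<lambda>z. \<Phi> z t)"
  by (intro lipschitz_on_continuous_on [of "exp (L * t)"] lipschitz_onI) (auto intro!: semiflow_dist_le)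

lemma semiflow_shift_derivative:
  assumes "0 \<le> s" "0 \<le> t"
  shows "((\<lambda>t. \<Phi> z (s + t)) has_vector_derivative Z (\<Phi> z (s + t))) (at t within {0..})"
proof -
  have "(\<Phi> z has_vector_derivative Z (\<Phi> z (s + t))) (at (s + t) within (\<lambda>t. s + t) ` {0..})"
    using assms sf by (intro semiflow_derivative) auto
  then have "((\<Phi> z \<circ> (\<lambda>t. s + t)) has_vector_derivative 1 *\<^sub>R Z (\<Phi> z (s + t))) (at t within {0..})"
    by (intro vector_diff_chain_within) (auto intro!: derivative_eq_intros)
  then show ?thesis by (simp add: o_def)
qed

lemma semiflow_add: "0 \<le> s \<Longrightarrow> 0 \<le> t \<Longrightarrow> \<Phi> z (s + t) = \<Phi> (\<Phi> z s) t"
  using semiflow_unique [of t "\<lambda>t. \<Phi> z (s + t)"]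
    has_vector_derivative_within_subset [OF semiflow_shift_derivative [of s _ z], of _ "{0..t}"]
  by simp

text \<open>Inserting the point \<Phi> z at the varying time separates the variables: one distance
  is controlled by the Lipschitz bound in space, the other by continuity of a single orbit.\<close>

lemma continuous_on_semiflow_joint:
  shows "continuous_on (UNIV \<times> {0..}) (\<lambda>(z, t). \<Phi> z t)"
proof (clarsimp simp: continuous_on_eq_continuous_within continuous_within)
  fix z and t :: real assume t: "0 \<le> t"
  have "((\<lambda>p. exp (L * snd p) * dist (fst p) z + dist (\<Phi> z (snd p)) (\<Phi> z t)) \<longlongrightarrow> exp (L * t) * dist z z + dist (\<Phi> z t) (\<Phi> z t))
      (at (z, t) within UNIV \<times> {0..})"
  proof (intro tendsto_intros)
    have "continuous_on ((UNIV :: 'a set) \<times> {0..}) (\<lambda>p. \<Phi> z (snd p))"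
      by (intro continuous_on_compose2 [OF continuous_on_semiflow_time [OF sf, of "{0..}" z]])
        (auto intro: continuous_intros)
    then have "continuous (at (z, t) within UNIV \<times> {0..}) (\<lambda>p. \<Phi> z (snd p))"
      using t unfolding continuous_on_eq_continuous_within by blast
    then show "((\<lambda>p. \<Phi> z (snd p)) \<longlongrightarrow> \<Phi> z t) (at (z, t) within UNIV \<times> {0..})"
      by (simp add: continuous_within)
  qed (auto intro!: tendsto_eq_intros)
  then have *: "((\<lambda>p. exp (L * snd p) * dist (fst p) z + dist (\<Phi> z (snd p)) (\<Phi> z t)) \<longlongrightarrow> 0) (at (z, t) within UNIV \<times> {0..})"
    by simp
  have "((\<lambda>p. dist (\<Phi> (fst p) (snd p)) (\<Phi> z t)) \<longlongrightarrow> 0) (at (z, t) within UNIV \<times> {0..})"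
  proof (rule Lim_null_comparison [OF _ *])
    show "\<forall>\<^sub>F p in at (z, t) within UNIV \<times> {0..}. norm (dist (\<Phi> (fst p) (snd p)) (\<Phi> z t)) \<le>
      exp (L * snd p) * dist (fst p) z + dist (\<Phi> z (snd p)) (\<Phi> z t)"
      unfolding eventually_at_filter
    proof (intro always_eventually allI impI)
      fix p :: "'a \<times> real" assume "p \<in> UNIV \<times> {0..}"
      then have "dist (\<Phi> (fst p) (snd p)) (\<Phi> z (snd p)) \<le> exp (L * snd p) * dist (fst p) z"
        by (intro semiflow_dist_le) auto
      then show "norm (dist (\<Phi> (fst p) (snd p)) (\<Phi> z t))
          \<le> exp (L * snd p) * dist (fst p) z + dist (\<Phi> z (snd p)) (\<Phi> z t)"
        using dist_triangle [of "\<Phi> (fst p) (snd p)" "\<Phi> z t" "\<Phi> z (snd p)"] by simp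
    qed
  qed
  then show "((\<lambda>(z, t). \<Phi> z t) \<longlongrightarrow> \<Phi> z t) (at (z, t) within UNIV \<times> {0..})"
    by (subst tendsto_dist_iff) (simp add: case_prod_beta)
qed

end

text \<open>The orbit run backwards from its end point solves the negated field, so it is the orbit
  of \<Psi>. Semiflows know only forward time, yet in this way they yield homeomorphisms.\<close>

lemma semiflow_reverse:
  fixes Z :: "'a::euclidean_space \<Rightarrow> 'a"
  assumes lip: "L-lipschitz_on UNIV Z" and "is_semiflow Z \<Phi>" "is_semiflow (\<lambda>z. - Z z) \<Psi>" "0 \<le> T"
  shows "\<Psi> (\<Phi> z T) T = z"
proof -
  have lip': "L-lipschitz_on UNIV (\<lambda>z. - Z z)"
    using lip by (simp add: lipschitz_on_def dist_norm norm_minus_commute)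
  have "((\<lambda>t. \<Phi> z (T - t)) has_vector_derivative - Z (\<Phi> z (T - t))) (at t within {0..T})"
    if t: "t \<in> {0..T}" for t
  proof -
    have "(\<Phi> z has_vector_derivative Z (\<Phi> z (T - t))) (at (T - t) within (\<lambda>t. T - t) ` {0..T})"
      using assms t by (intro semiflow_derivative) auto
    then have "((\<Phi> z \<circ> (\<lambda>t. T - t)) has_vector_derivative (-1) *\<^sub>R Z (\<Phi> z (T - t))) (at t within {0..T})"
      by (intro vector_diff_chain_within) (auto intro!: derivative_eq_intros)
    then show ?thesis by (simp add: o_def)
  qed
  from semiflow_unique [OF lip' assms(3) assms(4) this] show ?thesis
    using assms by simp
qed

section \<open>Isolating polytopes\<close>

text \<open>A pair in \<open>Hin\<close> or \<open>Hout\<close> is an outer normal with the level of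
  its half-space. The strict signs hold on whole faces, edges included, so a point may lie on an
  entrance and an exit face at once. The direction \<open>n\<close> acts as a Lyapunov function: it
  excludes orbits that stay in \<open>M\<close> for ever.\<close>

locale isolating_polytope =
  fixes X :: "'a::euclidean_space \<Rightarrow> 'a" and Hin Hout :: "('a \<times> real) set" and n :: 'a and M :: "'a set"
  assumes finite_faces: "finite Hin" "finite Hout"
    and M_def: "M = {z. \<forall>(a, r) \<in> Hin \<union> Hout. a \<bullet> z \<le> r}"
    and compact_M: "compact M" and M_nonempty: "M \<noteq> {}"
    and locally_lipschitz: "\<And>R. \<exists>L. L-lipschitz_on (cball 0 R) X"
    and inward: "\<And>a r z. (a, r) \<in> Hin \<Longrightarrow> z \<in> M \<Longrightarrow> a \<bullet> z = r \<Longrightarrow> a \<bullet> X z < 0"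
    and outward: "\<And>a r z. (a, r) \<in> Hout \<Longrightarrow> z \<in> M \<Longrightarrow> a \<bullet> z = r \<Longrightarrow> a \<bullet> X z > 0"
    and transit: "\<And>z. z \<in> M \<Longrightarrow> n \<bullet> X z > 0"
begin

definition exits where "exits = {z \<in> M. \<exists>(a, r) \<in> Hout. a \<bullet> z = r}"

definition ents where "ents = {z \<in> M. \<exists>(a, r) \<in> Hin. a \<bullet> z = r}"

text \<open>Nearest-point projection onto a convex set is 1-Lipschitz, so this extension of the
  field from \<open>M\<close> is globally Lipschitz and bounded and has a semiflow for all times;
  its orbits solve the original equation as long as they remain in \<open>M\<close>.\<close>

definition Xc where "Xc z = X (closest_point M z)"

definition \<Phi> where "\<Phi> = (SOME \<Phi>. is_semiflow Xc \<Phi>)"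

definition stays where "stays z t \<longleftrightarrow> (\<forall>\<tau>\<in>{0..t}. \<Phi> z \<tau> \<in> M)"

lemma closed_M: "closed M" and convex_M: "convex M"
proof -
  show "closed M" using compact_M by (rule compact_imp_closed)
  have "M = (\<Inter>(a, r) \<in> Hin \<union> Hout. {z. a \<bullet> z \<le> r})" unfolding M_def by auto
  also have "convex \<dots>" by (intro convex_INT) (auto simp: convex_halfspace_le)
  finally show "convex M" .
qed

lemma Xc_eq: "z \<in> M \<Longrightarrow> Xc z = X z"
  by (simp add: Xc_def closest_point_self)

lemma closest_in_M: "closest_point M z \<in> M"
  using closed_M M_nonempty by (rule closest_point_in_set)

lemma Xc_lipschitz: obtains L where "0 \<le> L" "L-lipschitz_on UNIV Xc"
proof -
  obtain R where "M \<subseteq> cball 0 R" using compact_M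
    by (meson bounded_iff compact_imp_bounded mem_cball_0 subsetI)
  moreover obtain L where L: "L-lipschitz_on (cball 0 R) X" using locally_lipschitz by blast
  ultimately have LM: "L-lipschitz_on M X" by (meson lipschitz_on_subset)
  have L0: "0 \<le> L" using L by (rule lipschitz_on_nonneg)
  have "L-lipschitz_on UNIV Xc"
  proof (rule lipschitz_onI [OF _ L0])
    fix x y
    have "dist (Xc x) (Xc y) \<le> L * dist (closest_point M x) (closest_point M y)"
      unfolding Xc_def by (rule lipschitz_onD [OF LM]) (auto simp: closest_in_M)
    also have "\<dots> \<le> L * dist x y"
      using closest_point_lipschitz [OF convex_M closed_M M_nonempty] L0 by (intro mult_left_mono) auto
    finally show "dist (Xc x) (Xc y) \<le> L * dist x y" .
  qed
  with L0 that show ?thesis by blast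
qed

lemma continuous_Xc: "continuous_on S Xc"
proof -
  obtain L where "L-lipschitz_on UNIV Xc" using Xc_lipschitz .
  then show ?thesis by (meson continuous_on_subset lipschitz_on_continuous_on subset_UNIV)
qed

lemma bounded_Xc: obtains B where "0 < B" "\<And>z. norm (Xc z) \<le> B"
proof -
  have "compact (Xc ` M)" using compact_M continuous_Xc by (rule compact_continuous_image [rotated])
  then obtain B where "0 < B" and B: "\<And>z. z \<in> M \<Longrightarrow> norm (Xc z) \<le> B"
    by (auto simp: bounded_pos dest!: compact_imp_bounded)
  have "norm (Xc z) \<le> B" for z
    using B [OF closest_in_M [of z]] by (simp add: Xc_def closest_point_self closest_in_M)
  with \<open>0 < B\<close> that show ?thesis by blast
qed

lemma semiflow: "is_semiflow Xc \<Phi>"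
proof -
  obtain L where "L-lipschitz_on UNIV Xc" using Xc_lipschitz .
  moreover obtain B where "\<And>z. norm (Xc z) \<le> B" using bounded_Xc by blast
  then have "bounded (range Xc)" by (auto simp: bounded_iff)
  ultimately obtain \<Psi> where "is_semiflow Xc \<Psi>" using lipschitz_semiflow_exists by blast
  then show ?thesis unfolding \<Phi>_def by (rule someI [of "is_semiflow Xc"])
qed

lemma \<Phi>_0 [simp]: "\<Phi> z 0 = z"
  using semiflow by simp

lemma \<Phi>_add: "0 \<le> s \<Longrightarrow> 0 \<le> t \<Longrightarrow> \<Phi> z (s + t) = \<Phi> (\<Phi> z s) t"
  by (rule Xc_lipschitz) (rule semiflow_add [OF _ semiflow])

lemma continuous_\<Phi>: "continuous_on (UNIV \<times> {0..}) (\<lambda>(z, t). \<Phi> z t)"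
  by (rule Xc_lipschitz) (rule continuous_on_semiflow_joint [OF _ semiflow])

lemma continuous_on_\<Phi> [continuous_intros]:
  assumes "continuous_on S f" "continuous_on S h" "\<And>x. x \<in> S \<Longrightarrow> 0 \<le> h x"
  shows "continuous_on S (\<lambda>x. \<Phi> (f x) (h x))"
  using continuous_on_compose2 [OF continuous_\<Phi> continuous_on_Pair [OF assms(1,2)]] assms(3) by auto

lemma inner_\<Phi>_derivative:
  assumes "0 \<le> t" "S \<subseteq> {0..}"
  shows "((\<lambda>t. a \<bullet> \<Phi> z t) has_real_derivative a \<bullet> Xc (\<Phi> z t)) (at t within S)"
proof -
  have "(\<Phi> z has_derivative (\<lambda>h. h *\<^sub>R Xc (\<Phi> z t))) (at t within S)"
    using semiflow_derivative [OF semiflow assms] by (simp add: has_vector_derivative_def)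
  then have "((\<lambda>t. a \<bullet> \<Phi> z t) has_derivative (\<lambda>h. a \<bullet> (h *\<^sub>R Xc (\<Phi> z t)))) (at t within S)"
    by (rule has_derivative_inner_right)
  then show ?thesis by (simp add: has_field_derivative_def mult.commute [of _ "a \<bullet> Xc _"])
qed

lemma stays_mono: "stays z t \<Longrightarrow> s \<le> t \<Longrightarrow> stays z s"
  by (auto simp: stays_def)

lemma stays_0 [simp]: "stays z 0 \<longleftrightarrow> z \<in> M"
  by (auto simp: stays_def)

lemma staysD: "stays z t \<Longrightarrow> 0 \<le> t \<Longrightarrow> \<Phi> z t \<in> M \<and> z \<in> M"
  using \<Phi>_0 by (force simp: stays_def)

section \<open>Progress along \<open>n\<close> and behaviour at the faces\<close>

lemma transit_speed: obtains v where "0 < v" "\<And>z. z \<in> M \<Longrightarrow> v \<le> n \<bullet> X z"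
proof -
  have "continuous_on M (\<lambda>z. n \<bullet> Xc z)" by (intro continuous_intros continuous_Xc)
  then obtain z0 where "z0 \<in> M" "\<And>z. z \<in> M \<Longrightarrow> n \<bullet> Xc z0 \<le> n \<bullet> Xc z"
    using continuous_attains_inf [OF compact_M M_nonempty] by blast
  then show ?thesis using that [of "n \<bullet> X z0"] transit by (simp add: Xc_eq)
qed

lemma transit_growth:
  assumes v: "\<And>z. z \<in> M \<Longrightarrow> v \<le> n \<bullet> X z" and "0 \<le> t" "stays z t"
  shows "n \<bullet> z + v * t \<le> n \<bullet> \<Phi> z t"
proof -
  have "n \<bullet> \<Phi> z 0 - v * 0 \<le> n \<bullet> \<Phi> z t - v * t"
  proof (rule DERIV_nonneg_imp_increasing_open [OF \<open>0 \<le> t\<close>])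
    fix x assume x: "0 < x" "x < t"
    have "((\<lambda>t. n \<bullet> \<Phi> z t) has_real_derivative n \<bullet> Xc (\<Phi> z x)) (at x)"
      using inner_\<Phi>_derivative [of x "{0..t}" n z] x by (simp add: at_within_Icc_at)
    then have "((\<lambda>t. n \<bullet> \<Phi> z t - v * t) has_real_derivative n \<bullet> Xc (\<Phi> z x) - v) (at x)"
      by (auto intro!: derivative_eq_intros)
    moreover have "0 \<le> n \<bullet> Xc (\<Phi> z x) - v"
      using v [of "\<Phi> z x"] assms x by (simp add: stays_def Xc_eq)
    ultimately show "\<exists>y. ((\<lambda>t. n \<bullet> \<Phi> z t - v * t) has_real_derivative y) (at x) \<and> 0 \<le> y" by blast
  qed (intro continuous_intros continuous_on_semiflow_time [OF semiflow], auto)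
  then show ?thesis by simp
qed

text \<open>Since the field points inwards on an entrance face, just before reaching it the orbit
  would have been strictly beyond it; hence entrance points occur at time 0 only.
  \<open>leaves_at_exit\<close> is the mirror argument just after an exit face.\<close>

lemma later_not_entrance:
  assumes "0 < t" "stays z t"
  shows "\<Phi> z t \<notin> ents"
proof
  assume "\<Phi> z t \<in> ents"
  then obtain a r where ar: "(a, r) \<in> Hin" "a \<bullet> \<Phi> z t = r" "\<Phi> z t \<in> M" by (auto simp: ents_def)
  have "((\<lambda>t. a \<bullet> \<Phi> z t) has_real_derivative a \<bullet> Xc (\<Phi> z t)) (at t within {0..})"
    using assms by (intro inner_\<Phi>_derivative) auto
  moreover have "a \<bullet> Xc (\<Phi> z t) < 0" using inward ar by (simp add: Xc_eq)
  ultimately obtain d where "d > 0" and d: "\<And>h. 0 < h \<Longrightarrow> t - h \<in> {0..} \<Longrightarrow> h < d \<Longrightarrow> a \<bullet> \<Phi> z t < a \<bullet> \<Phi> z (t - h)"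
    by (meson has_real_derivative_neg_dec_left)
  define h where "h = min (d/2) t"
  have h: "0 < h" "h < d" "h \<le> t" using \<open>d > 0\<close> assms by (auto simp: h_def)
  then have "\<Phi> z (t - h) \<in> M" using assms by (auto simp: stays_def)
  then have "a \<bullet> \<Phi> z (t - h) \<le> r" using ar by (auto simp: M_def)
  with d [of h] h ar show False by auto
qed

lemma leaves_at_exit:
  assumes "0 \<le> t" "\<Phi> z t \<in> exits" "t < t'"
  shows "\<not> stays z t'"
proof
  assume st: "stays z t'"
  obtain a r where ar: "(a, r) \<in> Hout" "a \<bullet> \<Phi> z t = r" "\<Phi> z t \<in> M" using assms by (auto simp: exits_def)
  have "((\<lambda>t. a \<bullet> \<Phi> z t) has_real_derivative a \<bullet> Xc (\<Phi> z t)) (at t within {0..})"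
    using assms by (intro inner_\<Phi>_derivative) auto
  moreover have "a \<bullet> Xc (\<Phi> z t) > 0" using outward ar by (simp add: Xc_eq)
  ultimately obtain d where "d > 0" and d: "\<And>h. 0 < h \<Longrightarrow> t + h \<in> {0..} \<Longrightarrow> h < d \<Longrightarrow> a \<bullet> \<Phi> z t < a \<bullet> \<Phi> z (t + h)"
    by (meson has_real_derivative_pos_inc_right)
  define h where "h = min (d/2) (t' - t)"
  have h: "0 < h" "h < d" "t + h \<le> t'" using \<open>d > 0\<close> assms by (auto simp: h_def)
  then have "\<Phi> z (t + h) \<in> M" using st assms by (auto simp: stays_def)
  then have "a \<bullet> \<Phi> z (t + h) \<le> r" using ar by (auto simp: M_def)
  with d [of h] h ar assms show False by auto
qed

text \<open>Off the exit faces every active constraint belongs to an entrance face, where the inner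
  product with the normal decreases; inactive constraints stay inactive for a while by
  continuity.\<close>

lemma prolong:
  assumes "0 \<le> t" "stays z t" "\<Phi> z t \<notin> exits"
  shows "\<exists>t'>t. stays z t'"
proof -
  have tM: "\<Phi> z t \<in> M" using assms by (auto simp: stays_def)
  have "\<exists>d>0. \<forall>h. 0 < h \<and> h < d \<longrightarrow> a \<bullet> \<Phi> z (t + h) \<le> r" if ar: "(a, r) \<in> Hin \<union> Hout" for a r
  proof -
    have der: "((\<lambda>t. a \<bullet> \<Phi> z t) has_real_derivative a \<bullet> Xc (\<Phi> z t)) (at t within {0..})"
      using assms by (intro inner_\<Phi>_derivative) auto
    have "a \<bullet> \<Phi> z t \<le> r" using tM ar by (auto simp: M_def)
    then consider "a \<bullet> \<Phi> z t < r" | "a \<bullet> \<Phi> z t = r" by linarith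
    then show ?thesis
    proof cases
      case 1
      have "continuous_on {0..} (\<lambda>t. a \<bullet> \<Phi> z t)"
        by (intro continuous_intros continuous_on_semiflow_time [OF semiflow]) auto
      then obtain d where "d > 0" and d: "\<And>t'. t' \<in> {0..} \<Longrightarrow> dist t' t < d \<Longrightarrow> dist (a \<bullet> \<Phi> z t') (a \<bullet> \<Phi> z t) < r - a \<bullet> \<Phi> z t"
        unfolding continuous_on_iff using 1 assms(1) by (metis atLeast_iff diff_gt_0_iff_gt)
      have "a \<bullet> \<Phi> z (t + h) \<le> r" if "0 < h" "h < d" for h
        using d [of "t + h"] that assms(1) by (auto simp: dist_real_def abs_less_iff)
      with \<open>d > 0\<close> show ?thesis by blast
    next
      case 2
      then have "(a, r) \<in> Hin" using assms ar tM by (auto simp: exits_def)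
      then have "a \<bullet> Xc (\<Phi> z t) < 0" using inward 2 tM by (simp add: Xc_eq)
      then obtain d where "d > 0" "\<And>h. 0 < h \<Longrightarrow> t + h \<in> {0..} \<Longrightarrow> h < d \<Longrightarrow> a \<bullet> \<Phi> z (t + h) < a \<bullet> \<Phi> z t"
        using der by (meson has_real_derivative_neg_dec_right)
      with 2 assms(1) show ?thesis by (intro exI [of _ d]) (auto intro!: less_imp_le)
    qed
  qed
  then have "\<forall>p\<in>Hin \<union> Hout. \<exists>d>0. \<forall>h. 0 < h \<and> h < d \<longrightarrow> fst p \<bullet> \<Phi> z (t + h) \<le> snd p"
    by (metis prod.collapse)
  then obtain d where d: "\<And>p. p \<in> Hin \<union> Hout \<Longrightarrow> d p > 0"
      "\<And>p h. p \<in> Hin \<union> Hout \<Longrightarrow> 0 < h \<Longrightarrow> h < d p \<Longrightarrow> fst p \<bullet> \<Phi> z (t + h) \<le> snd p"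
    by metis
  \<comment> \<open>The 1 keeps the set nonempty if there are no faces; halving turns
    \<open>h \<le> e\<close> into the strict \<open>h < d p\<close>.\<close>
  define e where "e = Min (insert 1 (d ` (Hin \<union> Hout))) / 2"
  have fin: "finite (insert 1 (d ` (Hin \<union> Hout)))" using finite_faces by simp
  have "0 < e" using d fin by (auto simp: e_def)
  have e_less: "e < d p" if "p \<in> Hin \<union> Hout" for p
  proof -
    have "2 * e \<le> d p" unfolding e_def using fin that by (simp add: Min_le_iff)
    with \<open>0 < e\<close> show ?thesis by simp
  qed
  have later: "\<Phi> z (t + h) \<in> M" if h: "0 < h" "h \<le> e" for h
  proof -
    have "a \<bullet> \<Phi> z (t + h) \<le> r" if "(a, r) \<in> Hin \<union> Hout" for a r
      using d(2) [OF that, of h] e_less [OF that] h by simp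
    then show ?thesis by (auto simp: M_def)
  qed
  have "\<Phi> z \<tau> \<in> M" if "\<tau> \<in> {0..t + e}" for \<tau>
    using assms that later [of "\<tau> - t"] by (cases "\<tau> \<le> t") (auto simp: stays_def)
  then have "stays z (t + e)" by (simp add: stays_def)
  with \<open>0 < e\<close> show ?thesis by (intro exI [of _ "t + e"]) simp
qed

section \<open>The time and the point of exit\<close>

lemma stay_time_bound: "\<exists>C. \<forall>z t. 0 \<le> t \<longrightarrow> stays z t \<longrightarrow> t \<le> C"
proof -
  obtain v where v: "0 < v" "\<And>z. z \<in> M \<Longrightarrow> v \<le> n \<bullet> X z" using transit_speed by blast
  obtain R where R: "0 < R" "\<And>z. z \<in> M \<Longrightarrow> norm z \<le> R"
    using compact_M by (metis bounded_pos compact_imp_bounded)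
  have nb: "\<bar>n \<bullet> z\<bar> \<le> norm n * R" if "z \<in> M" for z
    using Cauchy_Schwarz_ineq2 [of n z] R(2) [OF that] by (meson mult_left_mono norm_ge_zero order_trans)
  have "t \<le> 2 * norm n * R / v" if "0 \<le> t" "stays z t" for z t
  proof -
    have "v * t \<le> n \<bullet> \<Phi> z t - n \<bullet> z" using transit_growth [OF v(2) that] by linarith
    also have "\<dots> \<le> 2 * norm n * R" using nb [of z] nb [of "\<Phi> z t"] staysD [OF that(2,1)] by linarith
    finally show ?thesis using v by (simp add: field_simps)
  qed
  then show ?thesis by blast
qed

text \<open>The supremum of the staying times works: it is itself a staying time because
  \<open>M\<close> is closed, and if the orbit were not on an exit face then, \<open>prolong\<close>
  would exceed it.\<close>

lemma exit_time_exists: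
  assumes "z \<in> M"
  shows "\<exists>t\<ge>0. stays z t \<and> \<Phi> z t \<in> exits"
proof -
  obtain C where C: "\<And>z t. 0 \<le> t \<Longrightarrow> stays z t \<Longrightarrow> t \<le> C" using stay_time_bound by auto
  define S where "S = {t. 0 \<le> t \<and> stays z t}"
  define T where "T = Sup S"
  have S: "0 \<in> S" "bdd_above S" using assms C by (auto simp: S_def bdd_above_def)
  have "0 \<le> T" unfolding T_def using S by (rule cSup_upper)
  have before: "\<Phi> z \<tau> \<in> M" if \<tau>: "0 \<le> \<tau>" "\<tau> < T" for \<tau>
  proof -
    obtain t where "t \<in> S" "\<tau> < t" using less_cSup_iff [of S \<tau>] S \<tau> unfolding T_def by blast
    then show ?thesis using \<tau> by (auto simp: S_def stays_def)
  qed
  have "\<Phi> z T \<in> M"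
  proof (cases "T = 0")
    case False
    have "continuous_on {0..T} (\<Phi> z)" by (intro continuous_on_semiflow_time [OF semiflow]) auto
    moreover have "closure {0..<T} = {0..T}" using False \<open>0 \<le> T\<close> by simp
    moreover have "\<Phi> z ` {0..<T} \<subseteq> M" using before by auto
    ultimately have "\<Phi> z ` {0..T} \<subseteq> M"
      using image_closure_subset [of "{0..<T}" "\<Phi> z" M] closed_M by simp
    with \<open>0 \<le> T\<close> show ?thesis by auto
  qed (simp add: assms)
  with before have st: "stays z T" using assms unfolding stays_def by (auto simp: le_less)
  moreover have "\<Phi> z T \<in> exits"
  proof (rule ccontr)
    assume "\<Phi> z T \<notin> exits"
    then obtain t' where "t' > T" "stays z t'" using prolong st \<open>0 \<le> T\<close> by blast
    then have "t' \<in> S" using \<open>0 \<le> T\<close> by (simp add: S_def)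
    then have "t' \<le> T" unfolding T_def using S by (intro cSup_upper)
    with \<open>t' > T\<close> show False by simp
  qed
  ultimately show ?thesis using \<open>0 \<le> T\<close> by blast
qed

definition dwell where "dwell z = (THE t. 0 \<le> t \<and> stays z t \<and> \<Phi> z t \<in> exits)"

definition P where "P z = \<Phi> z (dwell z)"

lemma dwell_eqI: "0 \<le> t \<Longrightarrow> stays z t \<Longrightarrow> \<Phi> z t \<in> exits \<Longrightarrow> dwell z = t"
  unfolding dwell_def
proof (rule the_equality)
  fix s assume "0 \<le> t" "stays z t" "\<Phi> z t \<in> exits" "0 \<le> s \<and> stays z s \<and> \<Phi> z s \<in> exits"
  then show "s = t" using leaves_at_exit [of s z t] leaves_at_exit [of t z s] by (cases s t rule: linorder_cases) auto
qed auto

lemma dwell: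
  assumes "z \<in> M" shows "0 \<le> dwell z" "stays z (dwell z)" "P z \<in> exits"
proof -
  obtain t where t: "0 \<le> t" "stays z t" "\<Phi> z t \<in> exits" using exit_time_exists [OF assms] by blast
  then have "dwell z = t" by (rule dwell_eqI)
  with t show "0 \<le> dwell z" "stays z (dwell z)" "P z \<in> exits" by (auto simp: P_def)
qed

lemma stays_iff: "z \<in> M \<Longrightarrow> 0 \<le> t \<Longrightarrow> stays z t \<longleftrightarrow> t \<le> dwell z"
  using dwell [of z] leaves_at_exit [of "dwell z" z t] stays_mono [of z "dwell z" t] unfolding P_def by (auto simp: not_less [symmetric])

lemma P_in_M: "z \<in> M \<Longrightarrow> P z \<in> M"
  using dwell(3) by (auto simp: exits_def)

lemma dwell_exit: "z \<in> exits \<Longrightarrow> dwell z = 0"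
  by (rule dwell_eqI) (auto simp: exits_def)

lemma P_exit: "z \<in> exits \<Longrightarrow> P z = z"
  by (simp add: P_def dwell_exit)

lemma dwell_pos: "z \<in> M \<Longrightarrow> z \<notin> exits \<Longrightarrow> 0 < dwell z"
  using dwell [of z] by (cases "dwell z = 0") (auto simp: P_def)

lemma P_not_entrance: "z \<in> M \<Longrightarrow> z \<notin> exits \<Longrightarrow> P z \<notin> ents"
  unfolding P_def using later_not_entrance dwell_pos dwell(2) by blast

lemma P_\<Phi>:
  assumes "0 \<le> s" "stays z s"
  shows "P (\<Phi> z s) = P z" "dwell (\<Phi> z s) = dwell z - s"
proof -
  have z: "z \<in> M" using staysD assms by blast
  then have s: "s \<le> dwell z" using stays_iff assms by blast
  show *: "dwell (\<Phi> z s) = dwell z - s"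
  proof (rule dwell_eqI)
    show "stays (\<Phi> z s) (dwell z - s)"
      unfolding stays_def using assms dwell(2) [OF z] by (auto simp: \<Phi>_add [symmetric] stays_def)
    show "\<Phi> (\<Phi> z s) (dwell z - s) \<in> exits"
      using dwell [OF z] s assms by (simp add: \<Phi>_add [symmetric] P_def)
  qed (use s in simp)
  show "P (\<Phi> z s) = P z"
    using s assms by (simp add: P_def * \<Phi>_add [symmetric])
qed

lemma closed_exits: "closed exits"
proof -
  have "exits = (\<Union>(a, r) \<in> Hout. M \<inter> {z. a \<bullet> z = r})" by (auto simp: exits_def)
  also have "closed \<dots>" using finite_faces closed_M by (auto intro!: closed_UN closed_Int simp: closed_hyperplane)
  finally show ?thesis .
qed

text \<open>The values lie in a compact interval, so a closed graph suffices. It is closed because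
  \<open>dwell z\<close> is the only time at which the orbit, having stayed in \<open>M\<close> so
  far, is in the closed set \<open>exits\<close>.\<close>

lemma continuous_dwell: "continuous_on M dwell"
proof -
  obtain C where C: "\<And>z t. 0 \<le> t \<Longrightarrow> stays z t \<Longrightarrow> t \<le> C" using stay_time_bound by auto
  have cont: "continuous_on (M \<times> {0..}) (\<lambda>(z, t). \<Phi> z (s * t))" if "s \<in> {0..1}" for s
    unfolding case_prod_beta using that by (intro continuous_intros) auto
  \<comment> \<open>Scaling turns the condition on the varying interval [0, t] into one closed
    condition for each \<open>s\<close> in [0, 1].\<close>
  have graph: "(\<lambda>z. (z, dwell z)) ` M = (\<Inter>s\<in>{0..1}. (M \<times> {0..}) \<inter> (\<lambda>(z, t). \<Phi> z (s * t)) -` M)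
      \<inter> ((M \<times> {0..}) \<inter> (\<lambda>(z, t). \<Phi> z (1 * t)) -` exits)" (is "_ = ?G")
  proof (intro equalityI subsetI)
    fix p assume "p \<in> (\<lambda>z. (z, dwell z)) ` M"
    then show "p \<in> ?G"
      using dwell by (auto simp: stays_def P_def mult_le_cancel_right1 mult_left_le_one_le)
  next
    fix p assume p: "p \<in> ?G"
    obtain z t where [simp]: "p = (z, t)" by fastforce
    have "stays z t"
      unfolding stays_def
    proof
      fix \<tau> assume \<tau>: "\<tau> \<in> {0..t}"
      then have \<tau>t: "\<tau> / t \<in> {0..1}" "\<tau> / t * t = \<tau>" by (auto simp: divide_le_eq_1)
      have "\<forall>s\<in>{0..1}. \<Phi> z (s * t) \<in> M" using p by auto
      from bspec [OF this \<tau>t(1)] show "\<Phi> z \<tau> \<in> M" by (simp only: \<tau>t(2))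
    qed
    then have "dwell z = t" using p by (intro dwell_eqI) auto
    with p show "p \<in> (\<lambda>z. (z, dwell z)) ` M" by auto
  qed
  have "closed ?G"
    by (intro closed_Int closed_INT ballI continuous_closed_preimage cont closed_Times closed_M closed_exits) auto
  then have "closed ((\<lambda>z. (z, dwell z)) ` M)" by (simp only: graph)
  moreover have "dwell \<in> M \<rightarrow> {0..C}"
  proof
    fix z assume "z \<in> M"
    from C [OF dwell(1,2) [OF this]] dwell(1) [OF this] show "dwell z \<in> {0..C}" by (simp only: atLeastAtMost_iff)
  qed
  ultimately show ?thesis
    by (intro continuous_from_closed_graph [where T = "{0..C}"] compact_Icc)
qed

lemma continuous_P: "continuous_on M P"
  unfolding P_def by (intro continuous_intros continuous_dwell dwell)

lemma transit_P:
  assumes "z \<in> M" shows "n \<bullet> z \<le> n \<bullet> P z" "n \<bullet> z = n \<bullet> P z \<Longrightarrow> P z = z"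
proof -
  obtain v where v: "0 < v" "\<And>z. z \<in> M \<Longrightarrow> v \<le> n \<bullet> X z" using transit_speed by blast
  have *: "n \<bullet> z + v * dwell z \<le> n \<bullet> P z"
    unfolding P_def using assms by (intro transit_growth v dwell)
  then show "n \<bullet> z \<le> n \<bullet> P z" using v dwell(1) [OF assms] by (smt (verit) mult_nonneg_nonneg)
  assume "n \<bullet> z = n \<bullet> P z"
  with * v dwell(1) [OF assms] have "dwell z = 0" by (smt (verit) mult_pos_pos)
  then show "P z = z" by (simp add: P_def)
qed

subsection \<open>The exit map\<close>

text \<open>The field is Lipschitz only on balls, but two solutions over a compact time interval lie
  in a common ball.\<close>

lemma solution_unique:
  assumes "0 \<le> t" "solves_from X t z \<gamma>" "solves_from X t z \<delta>"
  shows "\<gamma> t = \<delta> t"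
proof -
  have d: "\<And>s. s \<in> {0..t} \<Longrightarrow> (\<gamma> has_vector_derivative X (\<gamma> s)) (at s within {0..t})"
    "\<And>s. s \<in> {0..t} \<Longrightarrow> (\<delta> has_vector_derivative X (\<delta> s)) (at s within {0..t})"
    using assms by (auto simp: solves_from_def closed_segment_eq_real_ivl)
  then have "continuous_on {0..t} \<gamma>" "continuous_on {0..t} \<delta>"
    by (meson continuous_on_eq_continuous_within has_vector_derivative_continuous)+
  then have "compact (\<gamma> ` {0..t} \<union> \<delta> ` {0..t})"
    by (intro compact_Un compact_continuous_image) auto
  then obtain R where R: "\<gamma> ` {0..t} \<union> \<delta> ` {0..t} \<subseteq> cball 0 R"
    by (meson bounded_iff compact_imp_bounded mem_cball_0 subsetI)
  obtain L where L: "L-lipschitz_on (cball 0 R) X" using locally_lipschitz by blast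
  have "dist (\<gamma> t) (\<delta> t) \<le> exp (L * t) * dist (\<gamma> 0) (\<delta> 0)"
    using R by (intro ode_unique [OF \<open>0 \<le> t\<close> L] d) (simp_all add: image_subset_iff)
  then show ?thesis using assms by (simp add: solves_from_def)
qed

lemma flow_eq:
  assumes "0 \<le> t" "solves_from X t z \<gamma>" shows "flow X t z = \<gamma> t"
  unfolding flow_def
proof (rule the_equality)
  show "\<exists>\<delta>. solves_from X t z \<delta> \<and> \<delta> t = \<gamma> t" using assms(2) by (intro exI [of _ \<gamma>]) simp
  fix w assume "\<exists>\<delta>. solves_from X t z \<delta> \<and> \<delta> t = w"
  then obtain \<delta> where \<delta>: "solves_from X t z \<delta>" "\<delta> t = w" by (elim exE conjE)
  show "w = \<gamma> t" using solution_unique [OF assms(1) \<delta>(1) assms(2)] \<delta>(2) by simp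
qed

lemma solves_from_\<Phi>:
  assumes "0 \<le> t" "stays z t"
  shows "solves_from X t z (\<Phi> z)"
proof -
  have "(\<Phi> z has_vector_derivative X (\<Phi> z s)) (at s within {0..t})" if "s \<in> {0..t}" for s
    using semiflow_derivative [OF semiflow, of s "{0..t}" z] assms that
    by (simp add: stays_def Xc_eq)
  then show ?thesis using assms by (simp add: solves_from_def closed_segment_eq_real_ivl)
qed

text \<open>\<open>exit_map\<close> refers to arbitrary solutions of \<open>X\<close> and to a
  supremum of times. A solution that stays in \<open>M\<close> also solves the extended equation and
  so is the orbit of \<Phi>; conversely that orbit solves the original equation while in
  \<open>M\<close>. Hence the times in question form the interval from 0 to \<open>dwell z\<close>,
  and the supremum is attained.\<close>

lemma exit_map_eq:
  assumes "z \<in> M"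
  shows "exit_map X M z = P z"
proof -
  have "{t. 0 \<le> t \<and> flow_defined X t z \<and> (\<forall>\<tau>\<in>{0..t}. flow X \<tau> z \<in> M)} = {0..dwell z}"
  proof (intro equalityI subsetI)
    fix t assume t: "t \<in> {0..dwell z}"
    then have st: "stays z \<tau>" if "\<tau> \<in> {0..t}" for \<tau> using that assms by (simp add: stays_iff)
    have "flow_defined X t z"
      unfolding flow_defined_def using solves_from_\<Phi> [of t z] st [of t] t by auto
    moreover have "flow X \<tau> z \<in> M" if "\<tau> \<in> {0..t}" for \<tau>
    proof -
      have "0 \<le> \<tau>" using that by simp
      then have "flow X \<tau> z = \<Phi> z \<tau>" by (intro flow_eq solves_from_\<Phi> st that)
      with staysD [OF st [OF that] \<open>0 \<le> \<tau>\<close>] show ?thesis by simp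
    qed
    ultimately show "t \<in> {t. 0 \<le> t \<and> flow_defined X t z \<and> (\<forall>\<tau>\<in>{0..t}. flow X \<tau> z \<in> M)}"
      using t by simp
  next
    fix t assume "t \<in> {t. 0 \<le> t \<and> flow_defined X t z \<and> (\<forall>\<tau>\<in>{0..t}. flow X \<tau> z \<in> M)}"
    then have t: "0 \<le> t" "\<forall>\<tau>\<in>{0..t}. flow X \<tau> z \<in> M" and "flow_defined X t z" by simp_all
    then obtain \<gamma> where \<gamma>: "solves_from X t z \<gamma>"
      unfolding flow_defined_def by (elim exE)
    have der: "(\<gamma> has_vector_derivative X (\<gamma> s)) (at s within {0..t})" if "s \<in> {0..t}" for s
      using \<gamma> that t by (simp add: solves_from_def closed_segment_eq_real_ivl)
    have sub: "solves_from X \<tau> z \<gamma>" if \<tau>: "\<tau> \<in> {0..t}" for \<tau>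
    proof -
      have "(\<gamma> has_vector_derivative X (\<gamma> s)) (at s within {0..\<tau>})" if "s \<in> {0..\<tau>}" for s
        by (rule has_vector_derivative_within_subset [OF der]) (use \<tau> that in auto)
      then show ?thesis
        using \<gamma> \<tau> by (simp add: solves_from_def closed_segment_eq_real_ivl)
    qed
    have \<gamma>M: "\<gamma> \<tau> \<in> M" if "\<tau> \<in> {0..t}" for \<tau>
      using flow_eq [OF _ sub [OF that]] bspec [OF t(2) that] that by simp
    obtain L where L: "L-lipschitz_on UNIV Xc" using Xc_lipschitz .
    have "\<gamma> \<tau> = \<Phi> z \<tau>" if "\<tau> \<in> {0..t}" for \<tau>
    proof -
      have "(\<gamma> has_vector_derivative Xc (\<gamma> s)) (at s within {0..\<tau>})" if "s \<in> {0..\<tau>}" for s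
        using sub [OF \<open>\<tau> \<in> {0..t}\<close>] that \<gamma>M [of s] \<open>\<tau> \<in> {0..t}\<close>
        by (simp add: solves_from_def closed_segment_eq_real_ivl Xc_eq)
      then show ?thesis
        using semiflow_unique [OF L semiflow, of \<tau> \<gamma>] that \<gamma> by (simp add: solves_from_def)
    qed
    then have "stays z t" using \<gamma>M by (simp add: stays_def)
    then show "t \<in> {0..dwell z}" using t assms by (simp add: stays_iff)
  qed
  then have "exit_time X M z = dwell z" unfolding exit_time_def using dwell(1) [OF assms] by simp
  then show ?thesis
    unfolding exit_map_def P_def using dwell [OF assms] by (simp add: flow_eq solves_from_\<Phi>)
qed

end

context isolating_polytope begin

subsection \<open>Pushing towards the exit faces\<close>

text \<open>The field is slowed down to rest on the boundary, so that its flow is the identity outside \<open>M\<close>.\<close>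

definition cut where "cut z = infdist z (- M)"

definition Z where "Z z = cut z *\<^sub>R Xc z"

definition \<Psi> where "\<Psi> = (SOME \<Psi>. is_semiflow Z \<Psi>)"

definition \<Psi>' where "\<Psi>' = (SOME \<Psi>. is_semiflow (\<lambda>z. - Z z) \<Psi>)"

section \<open>The slowed flow as a family of homeomorphisms\<close>

lemma outside_nonempty: "- M \<noteq> {}"
proof
  assume "- M = {}"
  then have "M = UNIV" by auto
  then show False using compact_M not_compact_UNIV by auto
qed

lemma cut_eq_0_iff: "cut z = 0 \<longleftrightarrow> z \<notin> interior M"
  using outside_nonempty by (simp add: cut_def in_closure_iff_infdist_zero [symmetric] closure_complement)

lemma cut_nonneg: "0 \<le> cut z"
  by (simp add: cut_def infdist_nonneg)

lemma cut_bounded: obtains C where "0 \<le> C" "\<And>z. cut z \<le> C"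
proof -
  have "continuous_on M cut" unfolding cut_def by (intro continuous_intros)
  then obtain z0 where z0: "\<And>z. z \<in> M \<Longrightarrow> cut z \<le> cut z0"
    using continuous_attains_sup [OF compact_M M_nonempty] by blast
  have "cut z \<le> cut z0" for z
  proof (cases "z \<in> M")
    case False
    then have "cut z = 0" using interior_subset by (auto simp: cut_eq_0_iff)
    then show ?thesis using cut_nonneg by simp
  qed (rule z0)
  then show ?thesis using that cut_nonneg by blast
qed

lemma Z_lipschitz: obtains L where "L-lipschitz_on UNIV Z"
proof -
  obtain L where L: "0 \<le> L" "L-lipschitz_on UNIV Xc" using Xc_lipschitz by blast
  obtain B where B: "0 < B" "\<And>z. norm (Xc z) \<le> B" using bounded_Xc by blast
  obtain C where C: "0 \<le> C" "\<And>z. cut z \<le> C" using cut_bounded by blast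
  have "(C * L + B)-lipschitz_on UNIV Z"
  proof (rule lipschitz_onI)
    fix x y
    have "dist (Z x) (Z y) = norm (cut x *\<^sub>R (Xc x - Xc y) + (cut x - cut y) *\<^sub>R Xc y)"
      by (simp add: Z_def dist_norm algebra_simps)
    also have "\<dots> \<le> cut x * norm (Xc x - Xc y) + \<bar>cut x - cut y\<bar> * norm (Xc y)"
      by (rule order_trans [OF norm_triangle_ineq]) (simp add: cut_nonneg)
    also have "\<dots> \<le> C * (L * dist x y) + dist x y * B"
    proof (intro add_mono mult_mono)
      show "norm (Xc x - Xc y) \<le> L * dist x y"
        using lipschitz_onD [OF L(2), of x y] by (simp add: dist_norm)
      show "\<bar>cut x - cut y\<bar> \<le> dist x y"
        unfolding cut_def using infdist_triangle_abs by blast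
    qed (use B C cut_nonneg in auto)
    finally show "dist (Z x) (Z y) \<le> (C * L + B) * dist x y" by (simp add: algebra_simps)
  qed (use B C L in auto)
  with that show ?thesis .
qed

lemma Z_bounded: "bounded (range Z)"
proof -
  obtain B where B: "0 < B" "\<And>z. norm (Xc z) \<le> B" using bounded_Xc by blast
  obtain C where C: "0 \<le> C" "\<And>z. cut z \<le> C" using cut_bounded by blast
  have "norm (Z z) \<le> C * B" for z
    unfolding Z_def using mult_mono [OF C(2) B(2)] C cut_nonneg by simp
  then show ?thesis by (auto simp: bounded_iff)
qed

lemma semiflow_\<Psi>: "is_semiflow Z \<Psi>" and semiflow_\<Psi>': "is_semiflow (\<lambda>z. - Z z) \<Psi>'"
proof -
  obtain L where L: "L-lipschitz_on UNIV Z" using Z_lipschitz .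
  obtain \<Psi>1 where "is_semiflow Z \<Psi>1" using lipschitz_semiflow_exists [OF L Z_bounded] .
  then show "is_semiflow Z \<Psi>" unfolding \<Psi>_def by (rule someI [of "is_semiflow Z"])
  have "L-lipschitz_on UNIV (\<lambda>z. - Z z)"
    using L by (simp add: lipschitz_on_def dist_norm norm_minus_commute)
  moreover have "bounded (range (\<lambda>z. - Z z))" using Z_bounded by (auto simp: bounded_iff)
  ultimately obtain \<Psi>2 where "is_semiflow (\<lambda>z. - Z z) \<Psi>2" using lipschitz_semiflow_exists by blast
  then show "is_semiflow (\<lambda>z. - Z z) \<Psi>'" unfolding \<Psi>'_def by (rule someI [of "is_semiflow (\<lambda>z. - Z z)"])
qed

lemma homeomorphism_\<Psi>:
  assumes "0 \<le> T" shows "homeomorphism UNIV UNIV (\<lambda>z. \<Psi> z T) (\<lambda>z. \<Psi>' z T)"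
proof -
  obtain L where L: "L-lipschitz_on UNIV Z" using Z_lipschitz .
  have L': "L-lipschitz_on UNIV (\<lambda>z. - Z z)"
    using L by (simp add: lipschitz_on_def dist_norm norm_minus_commute)
  have 1: "\<Psi>' (\<Psi> z T) T = z" for z
    by (rule semiflow_reverse [OF L semiflow_\<Psi> semiflow_\<Psi>' assms])
  have 2: "\<Psi> (\<Psi>' z T) T = z" for z
    by (rule semiflow_reverse [OF L' semiflow_\<Psi>' _ assms]) (simp add: semiflow_\<Psi>)
  show ?thesis
    by (intro homeomorphismI continuous_on_semiflow [OF L semiflow_\<Psi>] continuous_on_semiflow [OF L' semiflow_\<Psi>'] assms)
      (auto simp: 1 2)
qed

lemma \<Psi>_fixed:
  assumes "z \<notin> interior M" "0 \<le> T"
  shows "\<Psi> z T = z"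
proof -
  obtain L where L: "L-lipschitz_on UNIV Z" using Z_lipschitz .
  have "((\<lambda>_. z) has_vector_derivative Z z) (at t within {0..T})" for t
    using assms by (auto simp: Z_def cut_eq_0_iff [THEN iffD2])
  from semiflow_unique [OF L semiflow_\<Psi> assms(2) this] show ?thesis by simp
qed

text \<open>Points outside the interior are fixed by the time \<open>T\<close> map, which is
  injective, so none of them can also be the image of an interior point.\<close>

lemma \<Psi>_interior:
  assumes "z \<in> interior M" "0 \<le> T" shows "\<Psi> z T \<in> interior M"
proof (rule ccontr)
  assume "\<Psi> z T \<notin> interior M"
  then have "\<Psi> (\<Psi> z T) T = \<Psi> z T" using \<Psi>_fixed assms by blast
  then have "\<Psi> z T = z"
    using homeomorphism_apply1 [OF homeomorphism_\<Psi> [OF assms(2)]] by (metis UNIV_I)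
  with \<open>\<Psi> z T \<notin> interior M\<close> assms show False by simp
qed

lemma \<Psi>_M: "z \<in> M \<Longrightarrow> 0 \<le> T \<Longrightarrow> \<Psi> z T \<in> M"
  using \<Psi>_interior \<Psi>_fixed interior_subset by (cases "z \<in> interior M") force+

lemma face_not_interior:
  assumes "z \<in> exits \<union> ents" shows "z \<notin> interior M"
proof -
  obtain a r where ar: "(a, r) \<in> Hin \<union> Hout" "a \<bullet> z = r" "z \<in> M"
    using assms by (auto simp: exits_def ents_def)
  \<comment> \<open>The strict sign of \<open>a \<bullet> X z\<close> excludes a zero normal, for
    which the interior of the half-space would not be the open half-space.\<close>
  then have "a \<noteq> 0" using inward [of a r z] outward [of a r z] by auto
  have "M \<subseteq> {x. a \<bullet> x \<le> r}" using ar by (auto simp: M_def)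
  then have "interior M \<subseteq> {x. a \<bullet> x < r}"
    using interior_mono interior_halfspace_le [OF \<open>a \<noteq> 0\<close>] by metis
  with ar show ?thesis by auto
qed

lemma interior_if_no_face:
  assumes "z \<in> M" "z \<notin> exits" "z \<notin> ents" shows "z \<in> interior M"
proof (rule interiorI)
  show "open (\<Inter>(a, r) \<in> Hin \<union> Hout. {x. a \<bullet> x < r})"
    using finite_faces by (intro open_INT) (auto simp: open_halfspace_lt)
  have "a \<bullet> z < r" if "(a, r) \<in> Hin \<union> Hout" for a r
  proof -
    have "a \<bullet> z \<le> r" using assms that by (auto simp: M_def)
    moreover have "a \<bullet> z \<noteq> r" using assms that by (auto simp: exits_def ents_def)
    ultimately show ?thesis by simp
  qed
  then show "z \<in> (\<Inter>(a, r) \<in> Hin \<union> Hout. {x. a \<bullet> x < r})" by auto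
  show "(\<Inter>(a, r) \<in> Hin \<union> Hout. {x. a \<bullet> x < r}) \<subseteq> M"
    unfolding M_def by (auto intro: less_imp_le)
qed

lemma \<Psi>_not_entrance:
  assumes "z \<in> M" "z \<notin> ents" "0 \<le> T" shows "\<Psi> z T \<notin> ents"
proof (cases "z \<in> interior M")
  case True
  then show ?thesis using \<Psi>_interior assms face_not_interior by blast
qed (simp add: \<Psi>_fixed assms)

text \<open>With \<open>s\<close> the integral of \<open>cut\<close> along the slowed orbit, both sides solve \<open>v' = cut (\<Psi> z t) Xc v\<close>.\<close>

lemma \<Psi>_reparametrised:
  assumes "z \<in> M" "0 \<le> t"
  shows "\<exists>s\<ge>0. stays z s \<and> \<Psi> z t = \<Phi> z s"
proof -
  obtain L where L: "0 \<le> L" "L-lipschitz_on UNIV Xc" using Xc_lipschitz by blast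
  obtain C where C: "0 \<le> C" "\<And>z. cut z \<le> C" using cut_bounded by blast
  have cont\<Psi>: "continuous_on {0..t} (\<Psi> z)" by (intro continuous_on_semiflow_time [OF semiflow_\<Psi>]) auto
  define k where "k \<tau> = cut (\<Psi> z \<tau>)" for \<tau>
  define \<sigma> where "\<sigma> \<tau> = integral {0..\<tau>} k" for \<tau>
  have contk: "continuous_on {0..t} k"
    unfolding k_def cut_def using cont\<Psi> by (intro continuous_intros)
  have \<sigma>_der: "(\<sigma> has_vector_derivative k \<tau>) (at \<tau> within {0..t})" if "\<tau> \<in> {0..t}" for \<tau>
    unfolding \<sigma>_def using integral_has_vector_derivative [OF contk that] .
  have \<sigma>_nonneg: "0 \<le> \<sigma> \<tau>" if "\<tau> \<in> {0..t}" for \<tau>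
    unfolding \<sigma>_def using that
    by (intro integral_nonneg integrable_continuous_interval continuous_on_subset [OF contk]) (auto simp: k_def cut_nonneg)
  have eq: "\<Psi> z T = \<Phi> z (\<sigma> T)" if T: "T \<in> {0..t}" for T
  proof -
    define u where "u \<tau> = \<Phi> z (\<sigma> \<tau>) - \<Psi> z \<tau>" for \<tau>
    have "norm (u T) \<le> exp (C * L * T) * norm (u 0)"
    proof (rule norm_gronwall)
      fix \<tau> assume "\<tau> \<in> {0..T}"
      then have \<tau>: "\<tau> \<in> {0..t}" using T by auto
      have "(\<Phi> z has_vector_derivative Xc (\<Phi> z (\<sigma> \<tau>))) (at (\<sigma> \<tau>) within \<sigma> ` {0..t})"
        using \<sigma>_nonneg \<tau> by (intro semiflow_derivative [OF semiflow]) auto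
      from vector_diff_chain_within [OF \<sigma>_der [OF \<tau>] this]
      have "((\<lambda>\<tau>. \<Phi> z (\<sigma> \<tau>)) has_vector_derivative k \<tau> *\<^sub>R Xc (\<Phi> z (\<sigma> \<tau>))) (at \<tau> within {0..t})"
        by (simp add: o_def)
      moreover have "(\<Psi> z has_vector_derivative k \<tau> *\<^sub>R Xc (\<Psi> z \<tau>)) (at \<tau> within {0..t})"
        using semiflow_derivative [OF semiflow_\<Psi>, of \<tau> "{0..t}" z] \<tau> by (simp add: Z_def k_def)
      ultimately have "(u has_vector_derivative k \<tau> *\<^sub>R (Xc (\<Phi> z (\<sigma> \<tau>)) - Xc (\<Psi> z \<tau>))) (at \<tau> within {0..t})"
        unfolding u_def scaleR_diff_right by (rule has_vector_derivative_diff)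
      then show "(u has_vector_derivative k \<tau> *\<^sub>R (Xc (\<Phi> z (\<sigma> \<tau>)) - Xc (\<Psi> z \<tau>))) (at \<tau> within {0..T})"
        using T by (auto intro: has_vector_derivative_within_subset)
      have "norm (Xc (\<Phi> z (\<sigma> \<tau>)) - Xc (\<Psi> z \<tau>)) \<le> L * norm (u \<tau>)"
        using lipschitz_onD [OF L(2), of "\<Phi> z (\<sigma> \<tau>)" "\<Psi> z \<tau>"] by (simp add: u_def dist_norm)
      then have "k \<tau> * norm (Xc (\<Phi> z (\<sigma> \<tau>)) - Xc (\<Psi> z \<tau>)) \<le> C * (L * norm (u \<tau>))"
        using C L by (intro mult_mono) (auto simp: k_def)
      then show "norm (k \<tau> *\<^sub>R (Xc (\<Phi> z (\<sigma> \<tau>)) - Xc (\<Psi> z \<tau>))) \<le> C * L * norm (u \<tau>)"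
        by (simp add: k_def cut_nonneg mult.assoc)
    qed (use T in auto)
    moreover have "u 0 = 0" by (simp add: u_def \<sigma>_def semiflow_0 [OF semiflow_\<Psi>])
    ultimately show ?thesis by (simp add: u_def)
  qed
  have "stays z (\<sigma> t)"
    unfolding stays_def
  proof
    fix s assume s: "s \<in> {0..\<sigma> t}"
    \<comment> \<open>By the intermediate value theorem every earlier time \<open>s\<close> is some
      \<open>\<sigma> \<tau>\<close>, and the orbit point at that time equals \<Psi> z \<tau>, which
      lies in \<open>M\<close>.\<close>
    have "continuous_on {0..t} \<sigma>"
      unfolding continuous_on_eq_continuous_within
      using \<sigma>_der has_vector_derivative_continuous by blast
    then obtain \<tau> where "0 \<le> \<tau>" "\<tau> \<le> t" "\<sigma> \<tau> = s"
      using IVT' [of \<sigma> 0 s t] s assms by (auto simp: \<sigma>_def)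
    then show "\<Phi> z s \<in> M" using eq [of \<tau>] \<Psi>_M [OF assms(1), of \<tau>] by simp
  qed
  moreover have "\<Psi> z t = \<Phi> z (\<sigma> t)" "0 \<le> \<sigma> t" using eq [of t] \<sigma>_nonneg [of t] assms by simp_all
  ultimately show ?thesis by blast
qed

lemma P_\<Psi>:
  assumes "z \<in> M" "0 \<le> t" shows "P (\<Psi> z t) = P z"
proof -
  obtain s where s: "0 \<le> s" "stays z s" and eq: "\<Psi> z t = \<Phi> z s" using \<Psi>_reparametrised [OF assms] by blast
  show ?thesis unfolding eq by (rule P_\<Phi>(1) [OF s])
qed

section \<open>Convergence of slowed orbits to the exit faces\<close>

lemma inner_\<Psi>_derivative:
  assumes "0 \<le> t"
  shows "((\<lambda>t. a \<bullet> \<Psi> z t) has_real_derivative cut (\<Psi> z t) * (a \<bullet> Xc (\<Psi> z t))) (at t within {0..})"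
proof -
  have "(\<Psi> z has_derivative (\<lambda>h. h *\<^sub>R Z (\<Psi> z t))) (at t within {0..})"
    using semiflow_derivative [OF semiflow_\<Psi> assms, of "{0..}"] by (simp add: has_vector_derivative_def)
  then have "((\<lambda>t. a \<bullet> \<Psi> z t) has_derivative (\<lambda>h. a \<bullet> (h *\<^sub>R Z (\<Psi> z t)))) (at t within {0..})"
    by (rule has_derivative_inner_right)
  moreover have "(\<lambda>h. a \<bullet> (h *\<^sub>R Z (\<Psi> z t))) = (*) (cut (\<Psi> z t) * (a \<bullet> Xc (\<Psi> z t)))"
    by (auto simp: Z_def)
  ultimately show ?thesis by (simp add: has_field_derivative_def)
qed

lemma transit_\<Psi>_growth:
  assumes v: "\<And>t. t \<in> {0..<T} \<Longrightarrow> v \<le> cut (\<Psi> z t) * (n \<bullet> Xc (\<Psi> z t))" and "0 \<le> S" "S \<le> T"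
  shows "n \<bullet> \<Psi> z S + v * (T - S) \<le> n \<bullet> \<Psi> z T"
proof -
  have "n \<bullet> \<Psi> z S - v * S \<le> n \<bullet> \<Psi> z T - v * T"
  proof (rule DERIV_nonneg_imp_increasing_open [OF \<open>S \<le> T\<close>])
    fix x assume x: "S < x" "x < T"
    have "at x within {0..} = at x" using x assms by (intro at_within_interior) auto
    then have "((\<lambda>t. n \<bullet> \<Psi> z t) has_real_derivative cut (\<Psi> z x) * (n \<bullet> Xc (\<Psi> z x))) (at x)"
      using inner_\<Psi>_derivative [of x n z] x assms by simp
    then have "((\<lambda>t. n \<bullet> \<Psi> z t - v * t) has_real_derivative cut (\<Psi> z x) * (n \<bullet> Xc (\<Psi> z x)) - v) (at x)"
      by (auto intro!: derivative_eq_intros)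
    then show "\<exists>y. ((\<lambda>t. n \<bullet> \<Psi> z t - v * t) has_real_derivative y) (at x) \<and> 0 \<le> y"
      using v [of x] x assms by auto
  qed (use assms in \<open>auto intro!: continuous_intros continuous_on_semiflow_time [OF semiflow_\<Psi>]\<close>)
  then show ?thesis by (simp add: algebra_simps)
qed

lemma transit_\<Psi>_mono:
  assumes "z \<in> M" "0 \<le> S" "S \<le> T" shows "n \<bullet> \<Psi> z S \<le> n \<bullet> \<Psi> z T"
proof -
  have "0 \<le> cut (\<Psi> z t) * (n \<bullet> Xc (\<Psi> z t))" if "t \<in> {0..<T}" for t
    using \<Psi>_M [OF assms(1), of t] transit [of "\<Psi> z t"] that
    by (intro mult_nonneg_nonneg) (auto simp: cut_nonneg Xc_eq less_imp_le)
  from transit_\<Psi>_growth [OF this, where S = S] assms show ?thesis by simp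
qed

text \<open>Otherwise the slowed orbit stays in the arc \<open>C\<close> of the true orbit on which
  \<open>n\<close> is still \<eta> short of its exit value. For a start off the entrance faces this
  arc is a compact part of the interior, so the slowed speed along \<open>n\<close> has a positive
  lower bound \<open>v\<close> there, and unbounded linear growth follows. At an entrance point that
  is no exit the slowed flow would rest.\<close>

lemma \<Psi>_approaches_exit:
  assumes "z \<in> M" "z \<notin> ents" "0 < \<eta>"
  shows "\<exists>T\<ge>0. n \<bullet> P z - n \<bullet> \<Psi> z T < \<eta>"
proof (cases "z \<in> exits")
  case True
  then have "\<Psi> z 0 = z" "P z = z" by (simp_all add: semiflow_0 [OF semiflow_\<Psi>] P_exit)
  with assms show ?thesis by (intro exI [of _ 0]) simp
next
  case False
  obtain B where B: "0 < B" "\<And>z. norm (Xc z) \<le> B" using bounded_Xc by blast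
  show ?thesis
  proof (rule ccontr)
    assume "\<not> ?thesis"
    then have far: "\<eta> \<le> n \<bullet> P z - n \<bullet> \<Psi> z T" if "0 \<le> T" for T using that by (force simp: not_less)
    have cont: "continuous_on {0..dwell z} (\<lambda>s. n \<bullet> \<Phi> z s)" by (intro continuous_intros) auto
    define C where "C = {s \<in> {0..dwell z}. n \<bullet> \<Phi> z s \<le> n \<bullet> P z - \<eta>}"
    have "closed C" unfolding C_def
      using continuous_closed_preimage [OF cont, of "{..n \<bullet> P z - \<eta>}"] by (simp add: vimage_def Int_def conj_commute)
    moreover have "bounded C" by (rule bounded_subset [of "{0..dwell z}"]) (auto simp: C_def)
    ultimately have "compact C" by (simp add: compact_eq_bounded_closed)
    have C: "\<exists>s\<in>C. \<Psi> z t = \<Phi> z s" if "0 \<le> t" for t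
      using \<Psi>_reparametrised [OF assms(1) that] far [OF that] assms(1) by (force simp: C_def stays_iff)
    have C_int: "\<Phi> z s \<in> interior M" if "s \<in> C" for s
    proof -
      have s: "0 \<le> s" "s \<le> dwell z" "n \<bullet> \<Phi> z s \<le> n \<bullet> P z - \<eta>" using that by (auto simp: C_def)
      then have st: "stays z s" using assms by (simp add: stays_iff)
      have "s \<noteq> dwell z" using s assms by (auto simp: P_def)
      then have "\<Phi> z s \<notin> exits" using dwell_eqI [OF s(1) st] by blast
      moreover have "\<Phi> z s \<notin> ents"
        using later_not_entrance [of s z] st s assms by (cases "s = 0") auto
      ultimately show ?thesis using interior_if_no_face staysD [OF st s(1)] by blast
    qed
    have "C \<noteq> {}" using C [of 0] by auto
    moreover have "continuous_on C (\<lambda>s. cut (\<Phi> z s) * (n \<bullet> Xc (\<Phi> z s)))"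
      unfolding cut_def
      by (intro continuous_intros continuous_on_compose2 [OF continuous_Xc [of UNIV]]) (auto simp: C_def)
    ultimately obtain s0 where s0: "s0 \<in> C"
        "\<And>s. s \<in> C \<Longrightarrow> cut (\<Phi> z s0) * (n \<bullet> Xc (\<Phi> z s0)) \<le> cut (\<Phi> z s) * (n \<bullet> Xc (\<Phi> z s))"
      using continuous_attains_inf [OF \<open>compact C\<close>] by blast
    define v where "v = cut (\<Phi> z s0) * (n \<bullet> Xc (\<Phi> z s0))"
    have "\<Phi> z s0 \<in> M" using C_int [OF s0(1)] interior_subset by auto
    have "0 < v"
      unfolding v_def using C_int [OF s0(1)] cut_nonneg [of "\<Phi> z s0"] cut_eq_0_iff [of "\<Phi> z s0"] transit [OF \<open>\<Phi> z s0 \<in> M\<close>] \<open>\<Phi> z s0 \<in> M\<close>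
      by (auto simp: Xc_eq less_le)
    have "v \<le> cut (\<Psi> z t) * (n \<bullet> Xc (\<Psi> z t))" if "0 \<le> t" for t
      using C [OF that] s0(2) unfolding v_def by auto
    then have grow: "n \<bullet> \<Psi> z 0 + v * (T - 0) \<le> n \<bullet> \<Psi> z T" if "0 \<le> T" for T
      using that by (intro transit_\<Psi>_growth) auto
    \<comment> \<open>The time after which growth at speed \<open>v\<close> has used up the whole
      distance along \<open>n\<close> to \<open>P z\<close>.\<close>
    define T where "T = (n \<bullet> P z - n \<bullet> z) / v"
    have "0 \<le> T" using \<open>0 < v\<close> transit_P [OF assms(1)] by (simp add: T_def)
    moreover have "v * T = n \<bullet> P z - n \<bullet> z" using \<open>0 < v\<close> by (simp add: T_def)
    ultimately show False using grow [of T] far [of T] assms by (simp add: semiflow_0 [OF semiflow_\<Psi>])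
  qed
qed

text \<open>Pointwise approach becomes uniform on \<open>K\<close> as in Dini's theorem: progress
  along \<open>n\<close> is monotone, so the sets of points not yet within \<eta> at times 0, 1, 2,
  ... are compact and nested, and a common point would contradict
  \<open>\<Psi>_approaches_exit\<close>. \<Theta> is the slowed flow at one such time.\<close>

lemma push_towards_exit:
  assumes K: "compact K" "K \<subseteq> M - ents" and "0 < \<eta>"
  obtains \<Theta> \<Theta>' where "homeomorphism UNIV UNIV \<Theta> \<Theta>'"
    "\<And>z. z \<notin> M \<or> z \<in> exits \<Longrightarrow> \<Theta> z = z"
    "\<And>z. z \<in> M \<Longrightarrow> \<Theta> z \<in> M \<and> P (\<Theta> z) = P z"
    "\<And>z. z \<in> M - ents \<Longrightarrow> \<Theta> z \<notin> ents"
    "\<And>z. z \<in> K \<Longrightarrow> n \<bullet> P z - n \<bullet> \<Theta> z < \<eta>"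
proof -
  have "\<exists>k. \<forall>z\<in>K. n \<bullet> P z - n \<bullet> \<Psi> z (real k) < \<eta>"
  proof (rule ccontr)
    assume "\<not> ?thesis"
    then have bad: "\<forall>k. \<exists>z\<in>K. \<eta> \<le> n \<bullet> P z - n \<bullet> \<Psi> z (real k)" by (force simp: not_less)
    define F where "F k = {z \<in> K. \<eta> \<le> n \<bullet> P z - n \<bullet> \<Psi> z (real k)}" for k
    obtain L where L: "L-lipschitz_on UNIV Z" using Z_lipschitz .
    have "compact (F k) \<and> F k \<noteq> {}" for k
    proof
      have "continuous_on K (\<lambda>z. n \<bullet> P z - n \<bullet> \<Psi> z (real k))"
        using K by (intro continuous_intros continuous_on_subset [OF continuous_P]
            continuous_on_subset [OF continuous_on_semiflow [OF L semiflow_\<Psi>]]) auto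
      then have "closed (K \<inter> (\<lambda>z. n \<bullet> P z - n \<bullet> \<Psi> z (real k)) -` {\<eta>..})"
        using K compact_imp_closed by (intro continuous_closed_preimage) auto
      moreover have "F k = K \<inter> (K \<inter> (\<lambda>z. n \<bullet> P z - n \<bullet> \<Psi> z (real k)) -` {\<eta>..})"
        by (auto simp: F_def)
      ultimately show "compact (F k)" using K by (metis compact_Int_closed)
      show "F k \<noteq> {}" using bad by (auto simp: F_def)
    qed
    moreover have "F k \<subseteq> F l" if "l \<le> k" for k l
    proof
      fix z assume z: "z \<in> F k"
      then have "n \<bullet> \<Psi> z (real l) \<le> n \<bullet> \<Psi> z (real k)"
        using K that by (intro transit_\<Psi>_mono) (auto simp: F_def)
      with z show "z \<in> F l" by (auto simp: F_def)
    qed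
    ultimately have "\<Inter> (range F) \<noteq> {}" by (intro compact_nest) auto
    then obtain z where z: "\<And>k. z \<in> F k" by blast
    then have zK: "z \<in> M" "z \<notin> ents" using K by (auto simp: F_def)
    obtain T where T: "0 \<le> T" "n \<bullet> P z - n \<bullet> \<Psi> z T < \<eta>"
      using \<Psi>_approaches_exit [OF zK \<open>0 < \<eta>\<close>] by blast
    have "n \<bullet> \<Psi> z T \<le> n \<bullet> \<Psi> z (real (nat \<lceil>T\<rceil>))"
      using T zK by (intro transit_\<Psi>_mono) auto
    with T z [of "nat \<lceil>T\<rceil>"] show False by (auto simp: F_def)
  qed
  then obtain k where k: "\<And>z. z \<in> K \<Longrightarrow> n \<bullet> P z - n \<bullet> \<Psi> z (real k) < \<eta>" by blast
  show ?thesis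
  proof (rule that [OF homeomorphism_\<Psi> [of "real k"]])
    show "\<Psi> z (real k) = z" if "z \<notin> M \<or> z \<in> exits" for z
      using that face_not_interior interior_subset by (intro \<Psi>_fixed) auto
  qed (auto simp: k \<Psi>_M P_\<Psi> \<Psi>_not_entrance)
qed

end

section \<open>Balls and degrees in coordinate space\<close>

lemma continuous_map_Euclidean_space_componentwise:
  "continuous_map X (Euclidean_space n) f \<longleftrightarrow>
     (\<forall>i. continuous_map X euclideanreal (\<lambda>x. f x i)) \<and> f ` topspace X \<subseteq> topspace (Euclidean_space n)"
  unfolding Euclidean_space_def continuous_map_in_subtopology continuous_map_componentwise_UNIV
  by (auto simp: topspace_subtopology)

lemma continuous_map_Euclidean_space_coordinate:
  "continuous_map X (Euclidean_space n) f \<Longrightarrow> continuous_map X euclideanreal (\<lambda>x. f x i)"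
  by (simp add: continuous_map_Euclidean_space_componentwise)

lemma continuous_map_Euclidean_space_scale:
  assumes "continuous_map X (Euclidean_space n) f" "continuous_map X euclideanreal c"
  shows "continuous_map X (Euclidean_space n) (\<lambda>x i. c x * f x i)"
  using assms unfolding continuous_map_Euclidean_space_componentwise
  by (auto intro!: continuous_map_real_mult simp: topspace_Euclidean_space)

lemma line_embed_0 [simp]: "line_embed r 0 = r"
  by (simp add: line_embed_def)

lemma line_embed_in_space [simp]: "line_embed r \<in> topspace (Euclidean_space 1)"
  by (simp add: line_embed_def topspace_Euclidean_space)

declare line_embed_in_space [unfolded One_nat_def, simp]

lemma line_embed_coordinate: "x \<in> topspace (Euclidean_space 1) \<Longrightarrow> line_embed (x 0) = x"
  by (auto simp: line_embed_def topspace_Euclidean_space)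

lemma continuous_map_line_embed:
  "continuous_map X euclideanreal f \<Longrightarrow> continuous_map X (Euclidean_space 1) (\<lambda>x. line_embed (f x))"
  unfolding continuous_map_Euclidean_space_componentwise
  by (auto simp: line_embed_def topspace_Euclidean_space)

lemma unit_cball_subset: "unit_cball k \<subseteq> topspace (Euclidean_space k)"
  and unit_sphere_subset: "unit_sphere k \<subseteq> unit_cball k"
  by (auto simp: unit_cball_def unit_sphere_def)

lemma unit_cball_1: "x \<in> unit_cball 1 \<longleftrightarrow> x \<in> topspace (Euclidean_space 1) \<and> \<bar>x 0\<bar> \<le> 1"
  by (simp add: unit_cball_def abs_square_le_1)

lemma unit_sphere_1: "x \<in> unit_sphere 1 \<longleftrightarrow> x \<in> topspace (Euclidean_space 1) \<and> (x 0 = 1 \<or> x 0 = -1)"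
  by (auto simp: unit_sphere_def power2_eq_1_iff)

lemmas unit_ball_Suc_0 = unit_cball_1 [unfolded One_nat_def] unit_sphere_1 [unfolded One_nat_def]

lemma sum_scaled_squares: "(\<Sum>i<k. (c * x i)\<^sup>2) = c\<^sup>2 * (\<Sum>i<k. (x i :: real)\<^sup>2)"
  by (simp add: power_mult_distrib sum_distrib_left)

lemma scale_in_space: "x \<in> topspace (Euclidean_space k) \<Longrightarrow> (\<lambda>i. c * x i) \<in> topspace (Euclidean_space k)"
  by (simp add: topspace_Euclidean_space)

lemma scale_in_open_ball:
  assumes "x \<in> unit_cball k - unit_sphere k" "0 \<le> c" "c \<le> 1"
  shows "(\<lambda>i. c * x i) \<in> unit_cball k - unit_sphere k"
proof -
  have "c\<^sup>2 * (\<Sum>i<k. (x i)\<^sup>2) \<le> 1 * (\<Sum>i<k. (x i)\<^sup>2)"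
    using assms by (intro mult_right_mono sum_nonneg) (auto simp: power_le_one)
  moreover have "(\<Sum>i<k. (x i)\<^sup>2) < 1" using assms by (auto simp: unit_cball_def unit_sphere_def)
  ultimately show ?thesis
    using assms by (auto simp: unit_cball_def unit_sphere_def sum_scaled_squares scale_in_space)
qed

text \<open>Makes the sphere a topological notion: a homeomorphism of whole coordinate spaces that
  is only known to match closed boxes and balls also matches interiors, which locates the preimage
  of the sphere. It is applied in this way to \<beta>, \<theta> and the coordinates of the exit
  face.\<close>

lemma open_ball_interior: "Euclidean_space k interior_of unit_cball k = unit_cball k - unit_sphere k"
proof
  define N where "N x = (\<Sum>i<k. (x i :: real)\<^sup>2)" for x :: "nat \<Rightarrow> real"
  have "continuous_map (Euclidean_space k) euclideanreal N"
    unfolding N_def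
    by (intro continuous_map_sum continuous_map_real_pow continuous_map_Euclidean_space_coordinate [where n = k]) auto
  then have "openin (Euclidean_space k) {x \<in> topspace (Euclidean_space k). N x \<in> {..<1}}"
    by (rule openin_continuous_map_preimage) (simp add: open_openin [symmetric])
  moreover have "{x \<in> topspace (Euclidean_space k). N x \<in> {..<1}} = unit_cball k - unit_sphere k"
    by (auto simp: N_def unit_cball_def unit_sphere_def)
  ultimately show "unit_cball k - unit_sphere k \<subseteq> Euclidean_space k interior_of unit_cball k"
    by (simp add: interior_of_maximal)
  show "Euclidean_space k interior_of unit_cball k \<subseteq> unit_cball k - unit_sphere k"
  proof
    fix x assume x: "x \<in> Euclidean_space k interior_of unit_cball k"
    then obtain U where U: "openin (Euclidean_space k) U" "x \<in> U" "U \<subseteq> unit_cball k"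
      by (auto simp: interior_of_def)
    have xk: "x \<in> topspace (Euclidean_space k)" using U unit_cball_subset by blast
    have "continuous_map euclideanreal (Euclidean_space k) (\<lambda>c i. c * x i)"
      using xk by (intro continuous_map_Euclidean_space_scale) auto
    then have "openin euclideanreal {c \<in> topspace euclideanreal. (\<lambda>i. c * x i) \<in> U}"
      using U(1) by (rule openin_continuous_map_preimage)
    then have "open {c. (\<lambda>i. c * x i) \<in> U}" by simp
    moreover have "1 \<in> {c. (\<lambda>i. c * x i) \<in> U}" using U by simp
    ultimately obtain e where e: "0 < e" "\<And>c. dist c 1 < e \<Longrightarrow> (\<lambda>i. c * x i) \<in> U"
      unfolding open_dist by blast
    \<comment> \<open>An interior point may be scaled slightly outwards without leaving the ball,
      which is impossible for norm 1.\<close>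
    have "(\<lambda>i. (1 + e/2) * x i) \<in> unit_cball k" using e U by (auto simp: dist_real_def)
    then have "(1 + e/2)\<^sup>2 * N x \<le> 1" by (simp add: unit_cball_def sum_scaled_squares N_def)
    moreover have "1 < (1 + e/2)\<^sup>2" using e by (auto simp: power2_eq_square algebra_simps intro!: add_pos_pos)
    ultimately have "N x \<noteq> 1" by auto
    then show "x \<in> unit_cball k - unit_sphere k"
      using U by (auto simp: unit_sphere_def N_def)
  qed
qed

text \<open>The sphere in question consists of two points, so on it the normalised map is a
  constant, the identity or the reflection, of degree 0, 1 or -1.\<close>

lemma ball_degree_1:
  assumes A: "continuous_map (Euclidean_space 1) (Euclidean_space 1) A"
    and nz: "A (line_embed 1) 0 \<noteq> 0" "A (line_embed (-1)) 0 \<noteq> 0"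
  shows "ball_degree 1 A \<noteq> 0 \<longleftrightarrow> A (line_embed 1) 0 * A (line_embed (-1)) 0 < 0"
proof -
  define f where "f = (\<lambda>x i. A x i / sqrt (\<Sum>j<1. (A x j)\<^sup>2))"
  have deg: "ball_degree 1 A = Brouwer_degree2 0 f" by (simp add: ball_degree_def f_def)
  have sphere: "x = line_embed 1 \<or> x = line_embed (-1)" if "x \<in> topspace (nsphere 0)" for x
  proof -
    have "(x 0)\<^sup>2 = 1" and xE: "x \<in> topspace (Euclidean_space 1)"
      using that by (auto simp: nsphere_def)
    then have "x 0 = 1 \<or> x 0 = -1" by (simp add: power2_eq_1_iff)
    with line_embed_coordinate [OF xE] show ?thesis by metis
  qed
  have f: "f x = line_embed (sgn (A x 0))" if "x \<in> topspace (Euclidean_space 1)" for x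
  proof -
    have "A x \<in> topspace (Euclidean_space 1)" using A that by (auto simp: continuous_map_def)
    then show ?thesis
      by (auto simp: f_def line_embed_def topspace_Euclidean_space fun_eq_iff sgn_if)
  qed
  define p m where "p = A (line_embed 1) 0" and "m = A (line_embed (-1)) 0"
  have fp: "f (line_embed 1) = line_embed (sgn p)" and fm: "f (line_embed (-1)) = line_embed (sgn m)"
    unfolding p_def m_def by (rule f [OF line_embed_in_space])+
  consider "p > 0" "m > 0" | "p > 0" "m < 0" | "p < 0" "m > 0" | "p < 0" "m < 0"
    using nz p_def m_def by linarith
  then show ?thesis
  proof cases
    case 1
    then have "Brouwer_degree2 0 f = Brouwer_degree2 0 (\<lambda>x. line_embed 1)"
      using fp fm by (intro Brouwer_degree2_eq) (auto dest!: sphere)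
    with 1 show ?thesis
      unfolding deg p_def [symmetric] m_def [symmetric] by (simp add: Brouwer_degree2_const mult_less_0_iff)
  next
    case 2
    then have "Brouwer_degree2 0 f = Brouwer_degree2 0 id"
      using fp fm by (intro Brouwer_degree2_eq) (auto dest!: sphere)
    with 2 show ?thesis
      unfolding deg p_def [symmetric] m_def [symmetric] by (simp add: mult_less_0_iff)
  next
    case 3
    have "(\<lambda>i. if i = 0 then - line_embed r i else line_embed r i) = line_embed (- r)" for r
      by (auto simp: line_embed_def)
    with 3 have "Brouwer_degree2 0 f = Brouwer_degree2 0 (\<lambda>x i. if i = 0 then - x i else x i)"
      using fp fm by (intro Brouwer_degree2_eq) (auto dest!: sphere)
    with 3 show ?thesis
      unfolding deg p_def [symmetric] m_def [symmetric] by (simp add: Brouwer_degree2_reflection mult_less_0_iff)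
  next
    case 4
    then have "Brouwer_degree2 0 f = Brouwer_degree2 0 (\<lambda>x. line_embed (-1))"
      using fp fm by (intro Brouwer_degree2_eq) (auto dest!: sphere)
    with 4 show ?thesis
      unfolding deg p_def [symmetric] m_def [symmetric] by (simp add: Brouwer_degree2_const mult_less_0_iff)
  qed
qed

section \<open>Covering relations via homotopies\<close>

definition model_topology :: "'v hset \<Rightarrow> ((nat \<Rightarrow> real) \<times> (nat \<Rightarrow> real)) topology" where
  "model_topology H = subtopology (split_space (hs_u H) (hs_s H)) (hs_model H)"

abbreviation hs_point :: "'v hset \<Rightarrow> (nat \<Rightarrow> real) \<times> (nat \<Rightarrow> real) \<Rightarrow> 'v" where
  "hs_point H \<equiv> inv_into (hs_set H) (hs_coord H)"

lemma topspace_model [simp]: "topspace (model_topology H) = hs_model H"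
  using unit_cball_subset by (fastforce simp: model_topology_def hs_model_def)

text \<open>The avoidance conditions of a covering for a single time slice, the form in which
  \<open>homotopic_with\<close> takes a property of maps.\<close>

definition keeps_off :: "'v hset \<Rightarrow> 'v hset \<Rightarrow> ((nat \<Rightarrow> real) \<times> (nat \<Rightarrow> real) \<Rightarrow> (nat \<Rightarrow> real) \<times> (nat \<Rightarrow> real)) \<Rightarrow> bool" where
  "keeps_off N M f \<longleftrightarrow> (\<forall>w\<in>hs_model_minus N. f w \<notin> hs_model M) \<and> (\<forall>w\<in>hs_model N. f w \<notin> hs_model_plus M)"

lemma hs_model_minus_subset: "hs_model_minus N \<subseteq> hs_model N"
  using unit_sphere_subset by (fastforce simp: hs_model_def hs_model_minus_def)

text \<open>Phrased with \<open>homotopic_with\<close>, covering homotopies can be concatenated and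
  composed, and the coverings below are built in stages.\<close>

lemma covers_iff_homotopic:
  "covers F N M \<longleftrightarrow> hs_u N = hs_u M \<and> continuous_on (hs_set N) F \<and> F ` hs_set N \<subseteq> hs_space M \<and>
     (\<exists>A. homotopic_with (keeps_off N M) (model_topology N) (split_space (hs_u M) (hs_s M))
             (\<lambda>w. hs_coord M (F (hs_point N w))) (\<lambda>w. (A (fst w), \<lambda>_. 0)) \<and>
          continuous_map (Euclidean_space (hs_u M)) (Euclidean_space (hs_u M)) A \<and>
          A ` unit_sphere (hs_u M) \<subseteq> topspace (Euclidean_space (hs_u M)) - unit_cball (hs_u M) \<and>
          ball_degree (hs_u M) A \<noteq> 0)"
proof -
  \<comment> \<open>A property used in \<open>homotopic_with\<close> has to depend only on the
    values on the space itself.\<close>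
  have ko: "keeps_off N M h \<longleftrightarrow> keeps_off N M k"
    if "\<And>x. x \<in> topspace (model_topology N) \<Longrightarrow> h x = k x" for h k
    using that hs_model_minus_subset unfolding keeps_off_def topspace_model by (metis subsetD)
  have disjoint: "h ` ({0..1} \<times> S) \<inter> T = {} \<longleftrightarrow> (\<forall>t\<in>{0..1}. \<forall>w\<in>S. h (t, w) \<notin> T)"
    for h :: "real \<times> (nat \<Rightarrow> real) \<times> (nat \<Rightarrow> real) \<Rightarrow> (nat \<Rightarrow> real) \<times> (nat \<Rightarrow> real)" and S T
    by blast
  have *: "homotopic_with (keeps_off N M) (model_topology N) (split_space (hs_u M) (hs_s M)) f g \<longleftrightarrow>
     (\<exists>h. continuous_map (prod_topology (top_of_set {0..1::real}) (model_topology N)) (split_space (hs_u M) (hs_s M)) h \<and>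
        (\<forall>w\<in>hs_model N. h (0, w) = f w) \<and> (\<forall>w\<in>hs_model N. h (1, w) = g w) \<and>
        h ` ({0..1} \<times> hs_model_minus N) \<inter> hs_model M = {} \<and>
        h ` ({0..1} \<times> hs_model N) \<inter> hs_model_plus M = {})" for f g
    by (subst homotopic_with [OF ko]) (assumption, unfold topspace_model disjoint, intro ex_cong1, auto simp: keeps_off_def)
  show ?thesis
    unfolding covers_def * model_topology_def [symmetric]
    by (auto simp: case_prod_beta')
qed

lemma hs_point:
  assumes "is_hset H" "w \<in> hs_model H"
  shows "hs_point H w \<in> hs_set H" "hs_coord H (hs_point H w) = w"
  using assms unfolding is_hset_def by (metis inv_into_into, metis f_inv_into_f)

lemma continuous_map_hs_point:
  assumes H: "is_hset H"
  shows "continuous_map (model_topology H) (top_of_set (hs_set H)) (hs_point H)"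
proof -
  have hom: "homeomorphic_map (top_of_set (hs_space H)) (split_space (hs_u H) (hs_s H)) (hs_coord H)"
    and sub: "hs_set H \<subseteq> hs_space H" and im: "hs_coord H ` hs_set H = hs_model H"
    using H by (auto simp: is_hset_def)
  have "homeomorphic_map (subtopology (top_of_set (hs_space H)) (hs_set H)) (model_topology H) (hs_coord H)"
    unfolding model_topology_def
    by (rule homeomorphic_map_subtopologies [OF hom])
      (use sub im topspace_model [of H] in \<open>auto simp: inf_absorb2 model_topology_def\<close>)
  then have "homeomorphic_map (top_of_set (hs_set H)) (model_topology H) (hs_coord H)"
    using sub by (simp add: subtopology_subtopology inf_absorb2)
  then obtain g where g: "homeomorphic_maps (top_of_set (hs_set H)) (model_topology H) (hs_coord H) g"
    by (auto simp: homeomorphic_map_maps)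
  show ?thesis
  proof (rule continuous_map_eq)
    show "continuous_map (model_topology H) (top_of_set (hs_set H)) g"
      using g by (simp add: homeomorphic_maps_def)
    fix w assume w: "w \<in> topspace (model_topology H)"
    then have w': "w \<in> hs_model H" by simp
    have "\<forall>x\<in>hs_set H. g (hs_coord H x) = x" using g by (simp add: homeomorphic_maps_def)
    from bspec [OF this hs_point(1) [OF H w']] show "g w = hs_point H w"
      by (simp only: hs_point(2) [OF H w'])
  qed
qed

lemma continuous_map_hs_coord:
  "is_hset H \<Longrightarrow> continuous_map (top_of_set (hs_space H)) (split_space (hs_u H) (hs_s H)) (hs_coord H)"
  by (simp add: is_hset_def homeomorphic_imp_continuous_map)

lemma compact_space_model:
  assumes N: "is_hset N" shows "compact_space (model_topology N)"
proof -
  have "compact (hs_set N)" using N by (simp add: is_hset_def)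
  have "continuous_map (top_of_set (hs_space N)) (split_space (hs_u N) (hs_s N)) (hs_coord N)"
    by (rule continuous_map_hs_coord [OF N])
  then have "continuous_map (top_of_set (hs_set N)) (split_space (hs_u N) (hs_s N)) (hs_coord N)"
    using N by (meson continuous_map_from_subtopology_mono is_hset_def)
  then have "compactin (split_space (hs_u N) (hs_s N)) (hs_coord N ` hs_set N)"
    using \<open>compact (hs_set N)\<close> by (intro image_compactin [of "top_of_set (hs_set N)"]) (auto simp: compactin_subtopology)
  then have "compactin (split_space (hs_u N) (hs_s N)) (hs_model N)" using N by (simp add: is_hset_def)
  then show ?thesis unfolding model_topology_def by (rule compact_space_subtopology)
qed

text \<open>The straight line to (2 sg p, 0) works: the stable part shrinks inside the open ball,
  and at the two ends of \<open>H\<close> the unstable part moves between values beyond 1 on the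
  same side. The sign \<open>sg\<close> allows for a coordinate of \<open>E\<close> that reverses
  orientation.\<close>

lemma covers_by_linear_homotopy:
  assumes H: "is_hset H" "hs_u H = 1" and E: "is_hset E" "hs_u E = 1"
    and F: "continuous_on (hs_set H) F" "F ` hs_set H \<subseteq> hs_space E"
    and stable: "\<And>z. z \<in> hs_set H \<Longrightarrow> snd (hs_coord E (F z)) \<in> unit_cball (hs_s E) - unit_sphere (hs_s E)"
    and sg: "sg \<in> {1, -1}"
    and right: "\<And>z. z \<in> hs_set H \<Longrightarrow> fst (hs_coord H z) 0 = 1 \<Longrightarrow> 1 < sg * fst (hs_coord E (F z)) 0"
    and left: "\<And>z. z \<in> hs_set H \<Longrightarrow> fst (hs_coord H z) 0 = -1 \<Longrightarrow> sg * fst (hs_coord E (F z)) 0 < -1"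
  shows "covers F H E"
  unfolding covers_iff_homotopic
proof (intro conjI exI)
  define A where "A x = line_embed (2 * sg * x 0)" for x :: "nat \<Rightarrow> real"
  define Fc where "Fc w = hs_coord E (F (hs_point H w))" for w
  define h where "h = (\<lambda>(t, w). (\<lambda>i. (1 - t) * fst (Fc w) i + t * A (fst w) i, \<lambda>i. (1 - t) * snd (Fc w) i))"
  have contF: "continuous_map (top_of_set (hs_set H)) (top_of_set (hs_space E)) F"
    using F by (simp add: continuous_map_in_subtopology image_subset_iff_funcset)
  have "continuous_map (model_topology H) (split_space (hs_u E) (hs_s E)) (hs_coord E \<circ> F \<circ> hs_point H)"
    by (intro continuous_map_compose [OF continuous_map_hs_point [OF H(1)]]
        continuous_map_compose [OF contF] continuous_map_hs_coord E)
  then have Fc: "continuous_map (model_topology H) (split_space 1 (hs_s E)) Fc"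
    by (simp add: Fc_def [abs_def] o_def E)
  have A: "continuous_map X (Euclidean_space 1) (\<lambda>x. A (f x))" if "continuous_map X (Euclidean_space 1) f" for X f
    unfolding A_def
    by (intro continuous_map_line_embed continuous_map_real_mult
        continuous_map_Euclidean_space_coordinate [OF that]) auto
  show "homotopic_with (keeps_off H E) (model_topology H) (split_space (hs_u E) (hs_s E))
     (\<lambda>w. hs_coord E (F (hs_point H w))) (\<lambda>w. (A (fst w), \<lambda>_. 0))"
    unfolding Fc_def [symmetric] homotopic_with_def
  proof (intro exI conjI allI ballI)
    let ?X = "prod_topology (top_of_set {0..1::real}) (model_topology H)"
    have Fc': "continuous_map ?X (split_space 1 (hs_s E)) (\<lambda>p. Fc (snd p))"
      using continuous_map_compose [OF continuous_map_snd Fc] by (simp add: o_def)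
    then have c1: "continuous_map ?X (Euclidean_space 1) (\<lambda>p. fst (Fc (snd p)))"
      and c2: "continuous_map ?X (Euclidean_space (hs_s E)) (\<lambda>p. snd (Fc (snd p)))"
      by (simp_all add: continuous_map_pairwise o_def)
    have ct: "continuous_map ?X euclideanreal fst"
      using continuous_map_fst continuous_map_into_fulltopology by blast
    have "continuous_map ?X (model_topology H) snd" by (rule continuous_map_snd)
    then have "continuous_map ?X (split_space (hs_u H) (hs_s H)) snd"
      unfolding model_topology_def by (rule continuous_map_into_fulltopology)
    then have cw: "continuous_map ?X (Euclidean_space 1) (\<lambda>p. fst (snd p))"
      by (simp add: continuous_map_pairwise o_def H)
    show "continuous_map ?X (split_space (hs_u E) (hs_s E)) h"
      unfolding continuous_map_pairwise h_def o_def case_prod_beta fst_conv snd_conv E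
      by (intro conjI continuous_map_Euclidean_space_add continuous_map_Euclidean_space_scale c1 c2 A cw ct
          continuous_map_diff) auto
    show "h (0, w) = Fc w" "h (1, w) = (A (fst w), \<lambda>_. 0)" for w
      by (simp_all add: h_def)
    fix t :: real assume t: "t \<in> {0..1}"
    show "keeps_off H E (\<lambda>w. h (t, w))"
      unfolding keeps_off_def
    proof (intro conjI ballI)
      fix w assume w: "w \<in> hs_model_minus H"
      then have w': "w \<in> hs_model H" using hs_model_minus_subset by blast
      have "fst w 0 = 1 \<or> fst w 0 = -1"
        using w unit_sphere_1 [of "fst w"] by (auto simp: hs_model_minus_def H)
      moreover have "1 < \<bar>(1 - t) * x + t * (2 * sg * y)\<bar>"
        if "y = 1 \<and> 1 < sg * x \<or> y = -1 \<and> sg * x < -1" for x y :: real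
      proof -
        \<comment> \<open>Multiplying by \<open>y * sg\<close>, which is 1 or -1, reduces all sign
          cases to the single inequality \<open>1 < u\<close>.\<close>
        define u where "u = y * sg * x"
        have u: "1 < u" using that by (auto simp: u_def)
        have "(1 - t) * 1 + t * 1 < (1 - t) * u + t * 2"
        proof (cases "t = 1")
          case False
          then have "(1 - t) * 1 < (1 - t) * u" using u t by (intro mult_strict_left_mono) auto
          with t show ?thesis by (intro add_less_le_mono) auto
        qed simp
        moreover have "\<bar>(1 - t) * x + t * (2 * sg * y)\<bar> = \<bar>(1 - t) * u + t * 2\<bar>"
          using sg that unfolding u_def by (auto simp: abs_if)
        ultimately show ?thesis by simp
      qed
      moreover have "fst w 0 = 1 \<Longrightarrow> 1 < sg * fst (Fc w) 0" "fst w 0 = -1 \<Longrightarrow> sg * fst (Fc w) 0 < -1"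
        using right [of "hs_point H w"] left [of "hs_point H w"] hs_point [OF H(1) w'] by (auto simp: Fc_def)
      ultimately have "1 < \<bar>(1 - t) * fst (Fc w) 0 + t * (2 * sg * fst w 0)\<bar>" by blast
      then show "h (t, w) \<notin> hs_model E"
        using unit_cball_1 [of "fst (h (t, w))"] by (auto simp: h_def hs_model_def E A_def)
    next
      fix w assume w: "w \<in> hs_model H"
      have "snd (Fc w) \<in> unit_cball (hs_s E) - unit_sphere (hs_s E)"
        using stable [of "hs_point H w"] hs_point [OF H(1) w] by (simp add: Fc_def)
      then have "(\<lambda>i. (1 - t) * snd (Fc w) i) \<notin> unit_sphere (hs_s E)"
        using scale_in_open_ball [of _ _ "1 - t"] t by auto
      then show "h (t, w) \<notin> hs_model_plus E"
        by (auto simp: h_def hs_model_plus_def)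
    qed
  qed
  show cA: "continuous_map (Euclidean_space (hs_u E)) (Euclidean_space (hs_u E)) A"
    using A [of "Euclidean_space 1" "\<lambda>x. x"] by (simp add: E)
  show "A ` unit_sphere (hs_u E) \<subseteq> topspace (Euclidean_space (hs_u E)) - unit_cball (hs_u E)"
    using sg unfolding E by (auto simp: unit_ball_Suc_0 A_def)
  show "ball_degree (hs_u E) A \<noteq> 0"
    using cA sg unfolding E by (subst ball_degree_1) (auto simp: A_def)
qed (use assms in auto)

section \<open>Charts of a block\<close>

text \<open>
  Coordinates of a block with one unstable direction: \<open>\<alpha>\<close> is the unstable coordinate, oriented towards the
  chosen exit face \<open>\<alpha> = 1\<close>, \<open>\<nu>\<close> is the slow coordinate, oriented along the flow, and \<open>G\<close> is the inverse chart.
\<close>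

locale block_chart =
  fixes \<alpha> \<nu> :: "'v::euclidean_space \<Rightarrow> real" and bb :: "'v \<Rightarrow> nat \<Rightarrow> real"
    and G :: "real \<Rightarrow> (nat \<Rightarrow> real) \<Rightarrow> real \<Rightarrow> 'v" and s :: nat
    and \<theta> :: "(nat \<Rightarrow> real) \<times> real \<Rightarrow> nat \<Rightarrow> real" and \<theta>i :: "(nat \<Rightarrow> real) \<Rightarrow> (nat \<Rightarrow> real) \<times> real"
  assumes cont_\<alpha>: "continuous_on UNIV \<alpha>" and cont_\<nu>: "continuous_on UNIV \<nu>"
    and cont_bb: "continuous_map euclidean (Euclidean_space s) bb"
    and cont_G: "continuous_map (prod_topology euclideanreal (prod_topology (Euclidean_space s) euclideanreal)) euclidean
        (\<lambda>(a, b, y). G a b y)"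
    and G_inverse: "\<And>z. G (\<alpha> z) (bb z) (\<nu> z) = z"
    and \<alpha>_G: "\<And>a b y. b \<in> topspace (Euclidean_space s) \<Longrightarrow> \<alpha> (G a b y) = a"
    and bb_G: "\<And>a b y. b \<in> topspace (Euclidean_space s) \<Longrightarrow> bb (G a b y) = b"
    and \<nu>_G: "\<And>a b y. b \<in> topspace (Euclidean_space s) \<Longrightarrow> \<nu> (G a b y) = y"
    and \<theta>: "homeomorphic_maps (prod_topology (Euclidean_space s) euclideanreal) (Euclidean_space (Suc s)) \<theta> \<theta>i"
    and \<theta>_ball: "\<theta> ` (unit_cball s \<times> {0..1}) = unit_cball (Suc s)"
    and dim: "DIM('v) = s + 2"
begin

definition blk where "blk = {z. \<bar>\<alpha> z\<bar> \<le> 1 \<and> bb z \<in> unit_cball s \<and> 0 \<le> \<nu> z \<and> \<nu> z \<le> 1}"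

lemma bb_space: "bb z \<in> topspace (Euclidean_space s)"
  using cont_bb by (auto simp: continuous_map_def)

lemma \<theta>i_\<theta>: "b \<in> topspace (Euclidean_space s) \<Longrightarrow> \<theta>i (\<theta> (b, y)) = (b, y)"
  and \<theta>_\<theta>i: "w \<in> topspace (Euclidean_space (Suc s)) \<Longrightarrow> \<theta> (\<theta>i w) = w"
  and \<theta>i_space: "w \<in> topspace (Euclidean_space (Suc s)) \<Longrightarrow> fst (\<theta>i w) \<in> topspace (Euclidean_space s)"
  using \<theta> unfolding homeomorphic_maps_def continuous_map_def by (auto simp: Pi_iff mem_Times_iff)

lemma \<theta>_mem_ball:
  assumes "b \<in> topspace (Euclidean_space s)"
  shows "\<theta> (b, y) \<in> unit_cball (Suc s) \<longleftrightarrow> b \<in> unit_cball s \<and> 0 \<le> y \<and> y \<le> 1"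
proof
  assume "\<theta> (b, y) \<in> unit_cball (Suc s)"
  then obtain b' y' where b': "b' \<in> unit_cball s" "y' \<in> {0..1}" "\<theta> (b, y) = \<theta> (b', y')"
    using \<theta>_ball by blast
  then have "(b, y) = (b', y')"
    using \<theta>i_\<theta> [of b y] \<theta>i_\<theta> [of b' y'] assms unit_cball_subset by auto
  with b' show "b \<in> unit_cball s \<and> 0 \<le> y \<and> y \<le> 1" by simp
qed (use \<theta>_ball in auto)

text \<open>As a homeomorphism of whole spaces, \<theta> maps the interior of the cylinder onto the
  interior of the ball; so the lateral face and both ends of the cylinder make up the
  sphere.\<close>

lemma \<theta>_mem_open_ball:
  assumes b: "b \<in> topspace (Euclidean_space s)"
  shows "\<theta> (b, y) \<in> unit_cball (Suc s) - unit_sphere (Suc s) \<longleftrightarrow> b \<in> unit_cball s - unit_sphere s \<and> 0 < y \<and> y < 1"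
proof -
  let ?Y = "prod_topology (Euclidean_space s) euclideanreal"
  have hom: "homeomorphic_map ?Y (Euclidean_space (Suc s)) \<theta>"
    using \<theta> by (auto simp: homeomorphic_map_maps)
  have "Euclidean_space (Suc s) interior_of unit_cball (Suc s) = \<theta> ` (?Y interior_of (unit_cball s \<times> {0..1}))"
    using homeomorphic_map_interior_of [OF hom, of "unit_cball s \<times> {0..1}"] unit_cball_subset by (auto simp: \<theta>_ball)
  then have im: "unit_cball (Suc s) - unit_sphere (Suc s) = \<theta> ` ((unit_cball s - unit_sphere s) \<times> {0<..<1})"
    by (simp add: open_ball_interior interior_of_Times)
  show ?thesis
  proof
    assume "\<theta> (b, y) \<in> unit_cball (Suc s) - unit_sphere (Suc s)"
    then obtain b' y' where b': "b' \<in> unit_cball s - unit_sphere s" "y' \<in> {0<..<1}" "\<theta> (b, y) = \<theta> (b', y')"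
      unfolding im by blast
    then have "(b, y) = (b', y')"
      using \<theta>i_\<theta> [of b y] \<theta>i_\<theta> [of b' y'] assms unit_cball_subset by auto
    with b' show "b \<in> unit_cball s - unit_sphere s \<and> 0 < y \<and> y < 1" by simp
  qed (unfold im, auto)
qed

lemma continuous_map_into_chart:
  assumes "continuous_map X euclideanreal a" "continuous_map X (Euclidean_space s) b" "continuous_map X euclideanreal y"
  shows "continuous_map X euclidean (\<lambda>x. G (a x) (b x) (y x))"
proof -
  have "continuous_map X (prod_topology euclideanreal (prod_topology (Euclidean_space s) euclideanreal)) (\<lambda>x. (a x, b x, y x))"
    using assms by (simp add: continuous_map_pairwise o_def)
  from continuous_map_compose [OF this cont_G] show ?thesis by (simp add: o_def)
qed

lemma continuous_map_coords:
  assumes "continuous_map X euclidean f"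
  shows "continuous_map X euclideanreal (\<lambda>x. \<alpha> (f x))" "continuous_map X (Euclidean_space s) (\<lambda>x. bb (f x))"
    "continuous_map X euclideanreal (\<lambda>x. \<nu> (f x))"
  using continuous_map_compose [OF assms, of euclideanreal \<alpha>] continuous_map_compose [OF assms, of euclideanreal \<nu>]
    continuous_map_compose [OF assms cont_bb] cont_\<alpha> cont_\<nu> by (simp_all add: o_def)

lemma continuous_map_\<theta>:
  assumes "continuous_map X (Euclidean_space s) b" "continuous_map X euclideanreal y"
  shows "continuous_map X (Euclidean_space (Suc s)) (\<lambda>x. \<theta> (b x, y x))"
proof -
  have "continuous_map X (prod_topology (Euclidean_space s) euclideanreal) (\<lambda>x. (b x, y x))"
    using assms by (simp add: continuous_map_pairwise o_def)
  from continuous_map_compose [OF this, of "Euclidean_space (Suc s)" \<theta>] show ?thesis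
    using \<theta> by (simp add: o_def homeomorphic_maps_def)
qed

lemma continuous_map_\<theta>i:
  assumes "continuous_map X (Euclidean_space (Suc s)) w"
  shows "continuous_map X (Euclidean_space s) (\<lambda>x. fst (\<theta>i (w x)))" "continuous_map X euclideanreal (\<lambda>x. snd (\<theta>i (w x)))"
proof -
  have "continuous_map X (prod_topology (Euclidean_space s) euclideanreal) (\<theta>i \<circ> w)"
    using continuous_map_compose [OF assms] \<theta> by (auto simp: homeomorphic_maps_def)
  then show "continuous_map X (Euclidean_space s) (\<lambda>x. fst (\<theta>i (w x)))" "continuous_map X euclideanreal (\<lambda>x. snd (\<theta>i (w x)))"
    by (simp_all add: continuous_map_pairwise o_def)
qed

subsection \<open>Squeezing the slow direction\<close>

text \<open>Counterpart of \<open>keeps_off\<close> before coordinates are applied. Recording a set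
  \<open>K\<close> that catches all values in the block, rather than faces that are missed, allows
  \<Theta> to be chosen for a whole homotopy at once.\<close>

definition avoids where
  "avoids N K f \<longleftrightarrow> (\<forall>w\<in>hs_model_minus N. f w \<notin> blk) \<and> (\<forall>w\<in>hs_model N. f w \<in> blk \<longrightarrow> f w \<in> K)"

text \<open>
  The covering homotopy need not keep \<open>\<nu>\<close> below the bound \<open>yb\<close> that holds for \<open>F\<close>, but it stays off the face
  \<open>\<nu> = 1\<close>; composing it with an isotopy of the block that pushes \<open>\<nu> \<le> c\<close> below \<open>yb\<close>, \<open>c\<close> close to \<open>1\<close>, repairs this.
\<close>

lemma squeezed_homotopy:
  assumes cov: "covers F N Mh" and N: "is_hset N" "hs_u N = 1"
    and Mh: "is_hset Mh" "hs_set Mh = blk" "hs_u Mh = 1" "hs_s Mh = Suc s" "hs_space Mh = UNIV"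
    and coord: "\<And>z. hs_coord Mh z = (line_embed (sg * \<alpha> z), \<theta> (bb z, \<nu> z))" and sg: "sg \<in> {1, -1}"
    and yb: "0 < yb" "yb < 1" and below: "\<And>z. z \<in> F ` hs_set N \<inter> blk \<Longrightarrow> \<nu> z < yb"
  obtains A b0 y1 where "b0 \<in> unit_cball s" "0 < y1" "y1 < yb"
    "homotopic_with (avoids N {z \<in> blk. bb z \<notin> unit_sphere s \<and> 0 < \<nu> z \<and> \<nu> z < yb}) (model_topology N) euclidean
        (\<lambda>w. F (hs_point N w)) (\<lambda>w. G (sg * A (fst w) 0) b0 y1)"
    "continuous_map (Euclidean_space 1) (Euclidean_space 1) A"
    "\<And>x. x \<in> unit_sphere 1 \<Longrightarrow> 1 < \<bar>A x 0\<bar>" "A (line_embed 1) 0 * A (line_embed (-1)) 0 < 0"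
proof -
  let ?S = "split_space 1 (Suc s)"
  obtain A where hom: "homotopic_with (keeps_off N Mh) (model_topology N) ?S
        (\<lambda>w. hs_coord Mh (F (hs_point N w))) (\<lambda>w. (A (fst w), \<lambda>_. 0))"
      and A: "continuous_map (Euclidean_space 1) (Euclidean_space 1) A"
      and A_out: "A ` unit_sphere 1 \<subseteq> topspace (Euclidean_space 1) - unit_cball 1"
      and A_deg: "ball_degree 1 A \<noteq> 0"
    using cov unfolding covers_iff_homotopic Mh by blast
  have A_gt: "1 < \<bar>A x 0\<bar>" if "x \<in> unit_sphere 1" for x
  proof -
    have "A x \<in> topspace (Euclidean_space 1)" "A x \<notin> unit_cball 1" using A_out that by auto
    then show ?thesis using unit_cball_1 [of "A x"] by simp
  qed
  have "line_embed 1 \<in> unit_sphere 1" "line_embed (-1) \<in> unit_sphere 1"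
    unfolding unit_sphere_1 by (simp_all only: line_embed_in_space line_embed_0) auto
  then have A_neg: "A (line_embed 1) 0 * A (line_embed (-1)) 0 < 0"
    using A_deg ball_degree_1 [OF A] A_gt by fastforce
  \<comment> \<open>Inverse of the coordinates of \<open>Mh\<close>, the sign \<open>sg\<close>
    being its own inverse. It pulls the homotopy back to the ambient space, where the squeezing
    acts.\<close>
  define J where "J = (\<lambda>p :: (nat \<Rightarrow> real) \<times> (nat \<Rightarrow> real). G (sg * fst p 0) (fst (\<theta>i (snd p))) (snd (\<theta>i (snd p))))"
  have cont_J: "continuous_map ?S euclidean J"
  proof -
    have 1: "continuous_map ?S (Euclidean_space 1) fst" and 2: "continuous_map ?S (Euclidean_space (Suc s)) snd"
      by (auto intro: continuous_map_fst continuous_map_snd)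
    have "continuous_map ?S euclideanreal (\<lambda>p. sg * fst p 0)"
      by (intro continuous_map_real_mult continuous_map_Euclidean_space_coordinate [OF 1]) auto
    then show ?thesis
      unfolding J_def by (intro continuous_map_into_chart continuous_map_\<theta>i 2)
  qed
  have J_coord: "J (hs_coord Mh z) = z" for z
    using sg G_inverse by (auto simp: J_def coord \<theta>i_\<theta> bb_space)
  have coord_J: "hs_coord Mh (J p) = p" if "p \<in> topspace ?S" for p
  proof -
    have p: "fst p \<in> topspace (Euclidean_space 1)" "snd p \<in> topspace (Euclidean_space (Suc s))"
      using that by auto
    show ?thesis
      using sg line_embed_coordinate [OF p(1)] \<theta>_\<theta>i [OF p(2)] \<theta>i_space [OF p(2)]
      by (auto simp: J_def coord \<alpha>_G bb_G \<nu>_G)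
  qed
  have in_model: "hs_coord Mh z \<in> hs_model Mh \<longleftrightarrow> z \<in> blk" for z
    using Mh(1,2,5) J_coord unfolding is_hset_def by (metis imageE imageI)
  have in_plus: "hs_coord Mh z \<in> hs_model_plus Mh" if "z \<in> blk" "bb z \<in> unit_sphere s \<or> \<nu> z \<le> 0 \<or> 1 \<le> \<nu> z" for z
  proof -
    have "hs_coord Mh z \<in> hs_model Mh" using that in_model by simp
    then have "line_embed (sg * \<alpha> z) \<in> unit_cball 1" "\<theta> (bb z, \<nu> z) \<in> unit_cball (Suc s)"
      by (auto simp: hs_model_def Mh coord)
    with that show ?thesis
      using \<theta>_mem_open_ball [OF bb_space, of z "\<nu> z"] by (auto simp: hs_model_plus_def Mh coord)
  qed
  obtain h where h: "continuous_map (prod_topology (top_of_set {0..1::real}) (model_topology N)) ?S h"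
      and h01: "\<And>w. h (0, w) = hs_coord Mh (F (hs_point N w))" "\<And>w. h (1, w) = (A (fst w), \<lambda>_. 0)"
      and h_off: "\<And>t. t \<in> {0..1} \<Longrightarrow> keeps_off N Mh (\<lambda>w. h (t, w))"
    using hom unfolding homotopic_with_def by auto
  let ?X = "prod_topology (top_of_set {0..1::real}) (model_topology N)"
  define H where "H = J \<circ> h"
  have H: "continuous_map ?X euclidean H"
    unfolding H_def using h cont_J by (rule continuous_map_compose)
  have coord_H: "hs_coord Mh (H (t, w)) = h (t, w)" if "t \<in> {0..1}" "w \<in> hs_model N" for t w
    using coord_J [of "h (t, w)"] continuous_map_image_subset_topspace [OF h] that
    by (auto simp: H_def simp del: topspace_prod_topology) (force simp: topspace_prod_topology)
  have H_minus: "H (t, w) \<notin> blk" if "t \<in> {0..1}" "w \<in> hs_model_minus N" for t w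
  proof
    assume "H (t, w) \<in> blk"
    moreover have "w \<in> hs_model N" using that(2) hs_model_minus_subset by blast
    ultimately have "h (t, w) \<in> hs_model Mh" using in_model [of "H (t, w)"] coord_H [OF that(1)] by simp
    then show False using h_off [OF that(1)] that(2) by (simp add: keeps_off_def)
  qed
  have H_core: "bb (H (t, w)) \<notin> unit_sphere s \<and> 0 < \<nu> (H (t, w)) \<and> \<nu> (H (t, w)) < 1"
    if "t \<in> {0..1}" "w \<in> hs_model N" "H (t, w) \<in> blk" for t w
  proof (rule ccontr)
    assume "\<not> ?thesis"
    then have "h (t, w) \<in> hs_model_plus Mh"
      using in_plus [OF that(3)] coord_H [OF that(1,2)] by (simp add: not_less)
    then show False using h_off [OF that(1)] that(2) by (simp add: keeps_off_def)
  qed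
  have "compact_space (model_topology N)" by (rule compact_space_model [OF N(1)])
  then have "compact_space ?X" by (simp add: compact_space_prod_topology compact_space_subtopology)
  then have comp: "compactin euclidean (H ` topspace ?X)"
    using H by (meson compact_space_def image_compactin)
  have closed_blk: "closed blk"
    using Mh(1,2) by (metis compact_imp_closed is_hset_def)
  \<comment> \<open>Stable coordinates of the block point that sits at the centre of the model ball;
    the covering homotopy ends over it.\<close>
  define b0 y0 where "b0 = fst (\<theta>i (\<lambda>_. 0))" and "y0 = snd (\<theta>i (\<lambda>_. 0))"
  have zero: "(\<lambda>_. 0) \<in> topspace (Euclidean_space (Suc s))" by (simp add: topspace_Euclidean_space)
  have b0: "b0 \<in> topspace (Euclidean_space s)" unfolding b0_def by (rule \<theta>i_space [OF zero])
  have "(\<lambda>_. 0) \<in> unit_cball (Suc s) - unit_sphere (Suc s)"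
    by (simp add: unit_cball_def unit_sphere_def topspace_Euclidean_space)
  then have y0: "b0 \<in> unit_cball s" "0 < y0" "y0 < 1"
    using \<theta>_mem_open_ball [OF b0, of y0] \<theta>_\<theta>i [OF zero] by (auto simp: b0_def y0_def)
  \<comment> \<open>Inside the block the compact image of the homotopy misses \<nu> = 1, so \<nu> is
    bounded away from 1 there. \<open>y0 < c\<close> makes the squeeze bring the end of the homotopy
    below \<open>yb\<close> as well.\<close>
  have "\<exists>c. yb < c \<and> y0 < c \<and> c < 1 \<and> (\<forall>z \<in> H ` topspace ?X \<inter> blk. \<nu> z < c)"
  proof (cases "H ` topspace ?X \<inter> blk = {}")
    case True
    then show ?thesis using dense [of "max yb y0" 1] yb y0 by auto
  next
    case False
    have "compact (H ` topspace ?X \<inter> blk)"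
      using comp closed_blk by (simp add: compact_Int_closed)
    then obtain z0 where z0: "z0 \<in> H ` topspace ?X \<inter> blk" "\<And>z. z \<in> H ` topspace ?X \<inter> blk \<Longrightarrow> \<nu> z \<le> \<nu> z0"
      using continuous_attains_sup [OF _ False continuous_on_subset [OF cont_\<nu>]] by blast
    then have "\<nu> z0 < 1" using H_core by auto
    then obtain c where "max (max yb y0) (\<nu> z0) < c" "c < 1"
      using yb y0 dense [of "max (max yb y0) (\<nu> z0)" 1] by auto
    with z0 show ?thesis by (intro exI [of _ c]) force
  qed
  then obtain c where c: "yb < c" "c < 1" and yc: "y0 < c" and c_max: "\<And>z. z \<in> H ` topspace ?X \<Longrightarrow> z \<in> blk \<Longrightarrow> \<nu> z < c" by blast
  \<comment> \<open>The larger of the lines through (0, 0), (c, yb) and through (c, yb), (1, 1): a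
    convex function that fixes 0 and 1, sends \<open>c\<close> to \<open>yb\<close> and keeps the
    outside of [0, 1] outside.\<close>
  define k where "k y = max (y * (yb / c)) (1 - (1 - y) * ((1 - yb) / (1 - c)))" for y
  have slopes: "0 < yb / c" "yb / c < 1" "1 < (1 - yb) / (1 - c)" using yb c by (auto simp: field_simps)
  have k_neg: "k y < 0" if "y < 0" for y
  proof -
    have "y * (yb / c) < 0" using that slopes(1) by (rule mult_neg_pos)
    moreover have "(1 - y) * ((1 - yb) / (1 - c)) > 1 * 1"
      using slopes that by (intro mult_strict_mono) auto
    ultimately show ?thesis by (simp add: k_def)
  qed
  have k_gt: "1 < k y" if "1 < y" for y
  proof -
    have "(1 - y) * ((1 - yb) / (1 - c)) < 0" using slopes that by (intro mult_neg_pos) auto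
    then show ?thesis by (simp add: k_def)
  qed
  have k_pos: "0 < k y" if "0 < y" for y
    unfolding k_def less_max_iff_disj using mult_pos_pos [OF that slopes(1)] by blast
  have k_le: "k y \<le> y" if "0 \<le> y" "y \<le> 1" for y
  proof -
    have "y * (yb / c) \<le> y * 1" using slopes that by (intro mult_left_mono) auto
    moreover have "(1 - y) * ((1 - yb) / (1 - c)) \<ge> (1 - y) * 1"
      using slopes that by (intro mult_left_mono) auto
    ultimately show ?thesis by (simp add: k_def)
  qed
  have k_small: "k y < yb" if "y < c" for y
  proof -
    have "y * (yb / c) < c * (yb / c)" using slopes that by (intro mult_strict_right_mono)
    moreover have "(1 - c) * ((1 - yb) / (1 - c)) < (1 - y) * ((1 - yb) / (1 - c))"
      using slopes that by (intro mult_strict_right_mono) auto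
    ultimately show ?thesis using c yb by (simp add: k_def)
  qed
  define ks where "ks t y = (1 - t) * y + t * k y" for t y
  have ks_neg: "ks t y < 0" if "y < 0" "t \<in> {0..1}" for t y
    unfolding ks_def using k_neg [OF that(1)] that convex_bound_lt [of y 0 "k y" "1 - t" t] by auto
  have ks_gt: "1 < ks t y" if "1 < y" "t \<in> {0..1}" for t y
    unfolding ks_def using k_gt [OF that(1)] that convex_bound_lt [of "-y" "-1" "- k y" "1 - t" t] by auto
  have ks_pos: "0 < ks t y" if "0 < y" "t \<in> {0..1}" for t y
    unfolding ks_def using k_pos [OF that(1)] that convex_bound_lt [of "-y" 0 "- k y" "1 - t" t] by auto
  have ks_le: "ks t y \<le> y" if "0 \<le> y" "y \<le> 1" "t \<in> {0..1}" for t y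
    unfolding ks_def using k_le [OF that(1,2)] that convex_bound_le [of y y "k y" "1 - t" t] by auto
  \<comment> \<open>The isotopy acts on \<nu> alone and brings no outside point into the block, so
    the avoidance conditions survive.\<close>
  define Q where "Q t z = G (\<alpha> z) (bb z) (ks t (\<nu> z))" for t z
  have Q_coords: "\<alpha> (Q t z) = \<alpha> z" "bb (Q t z) = bb z" "\<nu> (Q t z) = ks t (\<nu> z)" for t z
    by (simp_all add: Q_def \<alpha>_G bb_G \<nu>_G bb_space)
  have Q_blk: "z \<in> blk" if "Q t z \<in> blk" "t \<in> {0..1}" for t z
    using that ks_neg [of "\<nu> z" t] ks_gt [of "\<nu> z" t] unfolding blk_def Q_coords mem_Collect_eq Q_coords
    by force
  have cont_ks: "continuous_map X euclideanreal (\<lambda>x. ks (t x) (y x))"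
    if "continuous_map X euclideanreal t" "continuous_map X euclideanreal y" for X t y
    unfolding ks_def k_def using that
    by (intro continuous_map_add continuous_map_real_mult continuous_map_diff continuous_map_real_max) auto
  have cont_Q: "continuous_map X euclidean (\<lambda>x. Q (t x) (z x))"
    if "continuous_map X euclideanreal t" "continuous_map X euclidean z" for X t z
    unfolding Q_def by (intro continuous_map_into_chart continuous_map_coords cont_ks that)
  let ?K = "{z \<in> blk. bb z \<notin> unit_sphere s \<and> 0 < \<nu> z \<and> \<nu> z < yb}"
  have ct: "continuous_map ?X euclideanreal fst"
    using continuous_map_fst continuous_map_into_fulltopology by blast
  have H0: "continuous_map ?X euclidean (\<lambda>p. H (0, snd p))"
  proof -
    have "continuous_map ?X ?X (\<lambda>p. (0, snd p))"
      by (simp add: continuous_map_pairwise o_def continuous_map_snd continuous_map_in_subtopology)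
    from continuous_map_compose [OF this H] show ?thesis by (simp add: o_def)
  qed
  \<comment> \<open>Two stages: first the given map is squeezed, where \<nu> is below
    \<open>yb\<close> already and does not increase; then the homotopy runs under the full squeeze,
    which turns \<nu> < c into \<nu> < yb.\<close>
  have "homotopic_with (avoids N ?K) (model_topology N) euclidean (\<lambda>w. H (0, w)) (\<lambda>w. Q 1 (H (0, w)))"
    unfolding homotopic_with_def
  proof (intro exI conjI allI ballI)
    show "continuous_map ?X euclidean (\<lambda>p. Q (fst p) (H (0, snd p)))" by (intro cont_Q ct H0)
    show "Q (fst (0, w)) (H (0, snd (0, w))) = H (0, w)" for w :: "(nat \<Rightarrow> real) \<times> (nat \<Rightarrow> real)"
      by (simp add: Q_def ks_def G_inverse)
    show "Q (fst (1, w)) (H (0, snd (1, w))) = Q 1 (H (0, w))" for w :: "(nat \<Rightarrow> real) \<times> (nat \<Rightarrow> real)" by simp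
    fix t :: real assume t: "t \<in> {0..1}"
    have "Q t (H (0, w)) \<notin> blk" if "w \<in> hs_model_minus N" for w
      using Q_blk [OF _ t] H_minus [of 0 w] that by auto
    moreover have "Q t (H (0, w)) \<in> ?K" if w: "w \<in> hs_model N" and Q: "Q t (H (0, w)) \<in> blk" for w
    proof -
      have b: "H (0, w) \<in> blk" using Q_blk [OF Q t] .
      have core: "bb (H (0, w)) \<notin> unit_sphere s" "0 < \<nu> (H (0, w))" "\<nu> (H (0, w)) < 1"
        using H_core [of 0 w] w b by auto
      have "H (0, w) = F (hs_point N w)" by (simp add: H_def h01 J_coord)
      then have "\<nu> (H (0, w)) < yb" using below [of "H (0, w)"] b hs_point(1) [OF N(1) w] by auto
      then show ?thesis
        using Q core ks_pos [OF core(2) t] ks_le [OF _ _ t, of "\<nu> (H (0, w))"] by (auto simp: Q_coords)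
    qed
    ultimately show "avoids N ?K (\<lambda>x. Q (fst (t, x)) (H (0, snd (t, x))))"
      by (simp add: avoids_def)
  qed
  moreover have "homotopic_with (avoids N ?K) (model_topology N) euclidean (\<lambda>w. Q 1 (H (0, w))) (\<lambda>w. Q 1 (H (1, w)))"
    unfolding homotopic_with_def
  proof (intro exI conjI allI ballI)
    show "continuous_map ?X euclidean (\<lambda>p. Q 1 (H p))" by (intro cont_Q H) auto
    fix t :: real assume t: "t \<in> {0..1}"
    have "Q 1 (H (t, w)) \<notin> blk" if "w \<in> hs_model_minus N" for w
      using Q_blk [of 1] H_minus [of t w] that t by auto
    moreover have "Q 1 (H (t, w)) \<in> ?K" if w: "w \<in> hs_model N" and Q: "Q 1 (H (t, w)) \<in> blk" for w
    proof -
      have b: "H (t, w) \<in> blk" using Q_blk [OF Q] by simp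
      have core: "bb (H (t, w)) \<notin> unit_sphere s" "0 < \<nu> (H (t, w))" using H_core [of t w] w b t by auto
      have "\<nu> (H (t, w)) < c" using c_max [of "H (t, w)"] b w t by auto
      then show ?thesis using Q core k_pos k_small by (auto simp: Q_coords ks_def)
    qed
    ultimately show "avoids N ?K (\<lambda>x. Q 1 (H (t, x)))" by (simp add: avoids_def)
  qed auto
  ultimately have hom': "homotopic_with (avoids N ?K) (model_topology N) euclidean (\<lambda>w. H (0, w)) (\<lambda>w. Q 1 (H (1, w)))"
    by (rule homotopic_with_trans)
  have H1: "H (1, w) = G (sg * A (fst w) 0) b0 y0" for w
    by (simp add: H_def h01 J_def b0_def y0_def)
  have Q1: "Q 1 (H (1, w)) = G (sg * A (fst w) 0) b0 (k y0)" for w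
    unfolding Q_def H1 by (simp add: \<alpha>_G bb_G \<nu>_G b0 ks_def)
  show ?thesis
  proof (rule that)
    show "homotopic_with (avoids N ?K) (model_topology N) euclidean
        (\<lambda>w. F (hs_point N w)) (\<lambda>w. G (sg * A (fst w) 0) b0 (k y0))"
      using hom' unfolding Q1 by (simp add: H_def h01 J_coord)
    show "0 < k y0" using k_pos y0 by simp
    show "k y0 < yb" using k_small yc .
  qed (use A A_gt A_neg y0 in auto)
qed

end

context block_chart begin

subsection \<open>The intermediate h-set\<close>

text \<open>
  Next to the exit face \<open>\<alpha> = 1\<close> the slow direction becomes the unstable one. The tilt of \<open>\<nu>\<close> by \<open>max 0 (al - \<alpha>)\<close>
  leaves the box \<open>al \<le> \<alpha>\<close> alone and lifts everything on the far side above it.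
\<close>

definition tilt where "tilt al r z = \<nu> z + r * max 0 (al - \<alpha> z)"

definition exit_box where
  "exit_box al au h1 h2 = {z. al \<le> \<alpha> z \<and> \<alpha> z \<le> au \<and> bb z \<in> unit_cball s \<and> h1 \<le> \<nu> z \<and> \<nu> z \<le> h2}"

text \<open>The roles are exchanged: the tilted slow coordinate is unstable, and \<alpha>, rescaled
  to [0, 1], takes the place of the slow variable in \<theta>.\<close>

definition exit_coord where
  "exit_coord al au h1 h2 r z =
     (line_embed ((2 * tilt al r z - h1 - h2) / (h2 - h1)), \<theta> (bb z, (\<alpha> z - al) / (au - al)))"

definition exit_hset :: "real \<Rightarrow> real \<Rightarrow> real \<Rightarrow> real \<Rightarrow> real \<Rightarrow> ('v \<Rightarrow> 'v) \<Rightarrow> ('v \<Rightarrow> 'v) \<Rightarrow> 'v hset" where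
  "exit_hset al au h1 h2 r \<Theta> \<Theta>' =
     \<lparr>hs_set = \<Theta>' ` exit_box al au h1 h2, hs_u = 1, hs_s = Suc s, hs_space = UNIV,
      hs_coord = \<lambda>z. exit_coord al au h1 h2 r (\<Theta> z)\<rparr>"

context
  fixes al au h1 h2 r :: real
  assumes al_au: "-1 < al" "al < au" "au < 1" and h1_h2: "0 < h1" "h1 < h2" "h2 < 1"
begin

section \<open>Tilted coordinates around the exit box\<close>

lemma exit_box_subset: "exit_box al au h1 h2 \<subseteq> blk"
  using al_au h1_h2 by (auto simp: exit_box_def blk_def)

lemma normalised_le_1_iff:
  assumes "h1 < h2" shows "\<bar>(2 * x - h1 - h2) / (h2 - h1)\<bar> \<le> 1 \<longleftrightarrow> h1 \<le> x \<and> x \<le> (h2 :: real)"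
  using assms by (auto simp: abs_le_iff field_simps)

lemma exit_coord_model:
  "exit_coord al au h1 h2 r z \<in> unit_cball 1 \<times> unit_cball (Suc s) \<longleftrightarrow> z \<in> exit_box al au h1 h2"
proof -
  have "0 \<le> (\<alpha> z - al) / (au - al) \<longleftrightarrow> al \<le> \<alpha> z" "(\<alpha> z - al) / (au - al) \<le> 1 \<longleftrightarrow> \<alpha> z \<le> au"
    using al_au by (auto simp: field_simps)
  moreover have "tilt al r z = \<nu> z" if "al \<le> \<alpha> z" using that by (simp add: tilt_def)
  ultimately show ?thesis
    unfolding exit_coord_def exit_box_def mem_Times_iff fst_conv snd_conv unit_cball_1 line_embed_0
      normalised_le_1_iff [OF h1_h2(2)] \<theta>_mem_ball [OF bb_space] by auto
qed

lemma exit_coord_open_ball: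
  "snd (exit_coord al au h1 h2 r z) \<in> unit_cball (Suc s) - unit_sphere (Suc s) \<longleftrightarrow>
     bb z \<in> unit_cball s - unit_sphere s \<and> al < \<alpha> z \<and> \<alpha> z < au"
proof -
  have "0 < (\<alpha> z - al) / (au - al) \<longleftrightarrow> al < \<alpha> z" "(\<alpha> z - al) / (au - al) < 1 \<longleftrightarrow> \<alpha> z < au"
    using al_au by (auto simp: field_simps)
  then show ?thesis
    unfolding exit_coord_def snd_conv \<theta>_mem_open_ball [OF bb_space] by simp
qed

lemma continuous_map_exit_coord: "continuous_map euclidean (split_space 1 (Suc s)) (exit_coord al au h1 h2 r)"
proof -
  have d: "continuous_map euclidean euclideanreal (\<lambda>z. (2 * tilt al r z - h1 - h2) / (h2 - h1))"
      "continuous_map euclidean euclideanreal (\<lambda>z. (\<alpha> z - al) / (au - al))"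
    using cont_\<alpha> cont_\<nu> h1_h2 al_au unfolding tilt_def continuous_map_iff_continuous2
    by (auto intro!: continuous_intros)
  show ?thesis
    unfolding exit_coord_def continuous_map_pairwise o_def fst_conv snd_conv
    by (intro conjI continuous_map_line_embed continuous_map_\<theta> cont_bb d)
qed

definition exit_point where
  "exit_point p = (let a = al + (au - al) * snd (\<theta>i (snd p))
     in G a (fst (\<theta>i (snd p))) ((fst p 0 * (h2 - h1) + h1 + h2) / 2 - r * max 0 (al - a)))"

text \<open>The tilt adds to \<nu> a continuous function of \<alpha>; such a shear is undone by
  subtraction, so the tilted coordinates are global.\<close>

lemma exit_coord_maps:
  "homeomorphic_maps euclidean (split_space 1 (Suc s)) (exit_coord al au h1 h2 r) exit_point"
  unfolding homeomorphic_maps_def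
proof (intro conjI ballI)
  let ?S = "split_space 1 (Suc s)"
  have 1: "continuous_map ?S (Euclidean_space 1) fst" and 2: "continuous_map ?S (Euclidean_space (Suc s)) snd"
    by (auto intro: continuous_map_fst continuous_map_snd)
  have a: "continuous_map ?S euclideanreal (\<lambda>p. al + (au - al) * snd (\<theta>i (snd p)))"
    by (intro continuous_map_add continuous_map_real_mult continuous_map_\<theta>i 2) auto
  have y: "continuous_map ?S euclideanreal (\<lambda>p. (fst p 0 * (h2 - h1) + h1 + h2) / 2
      - r * max 0 (al - (al + (au - al) * snd (\<theta>i (snd p)))))"
    by (intro continuous_map_add continuous_map_real_mult continuous_map_diff continuous_map_real_divide
        continuous_map_real_max continuous_map_Euclidean_space_coordinate [OF 1] a) auto
  show "continuous_map ?S euclidean exit_point"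
    unfolding exit_point_def Let_def by (intro continuous_map_into_chart a y continuous_map_\<theta>i 2)
  show "continuous_map euclidean ?S (exit_coord al au h1 h2 r)" by (rule continuous_map_exit_coord)
  show "exit_point (exit_coord al au h1 h2 r z) = z" if "z \<in> topspace euclidean" for z
  proof -
    have eq: "al + (au - al) * ((\<alpha> z - al) / (au - al)) = \<alpha> z"
      "((2 * tilt al r z - h1 - h2) / (h2 - h1) * (h2 - h1) + h1 + h2) / 2 = tilt al r z"
      using al_au h1_h2 by (auto simp: field_simps)
    show ?thesis
      unfolding exit_point_def exit_coord_def Let_def fst_conv snd_conv line_embed_0 \<theta>i_\<theta> [OF bb_space] eq
      by (simp add: tilt_def G_inverse)
  qed
  show "exit_coord al au h1 h2 r (exit_point p) = p" if "p \<in> topspace ?S" for p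
  proof -
    have p: "fst p \<in> topspace (Euclidean_space 1)" "snd p \<in> topspace (Euclidean_space (Suc s))"
      using that by auto
    have eq: "(al + (au - al) * x - al) / (au - al) = x"
      "(2 * ((y * (h2 - h1) + h1 + h2) / 2) - h1 - h2) / (h2 - h1) = y" for x y
      using al_au h1_h2 by (auto simp: field_simps)
    have "exit_coord al au h1 h2 r (exit_point p) = (line_embed (fst p 0), \<theta> (\<theta>i (snd p)))"
      unfolding exit_coord_def exit_point_def Let_def tilt_def \<alpha>_G [OF \<theta>i_space [OF p(2)]] \<nu>_G [OF \<theta>i_space [OF p(2)]]
        bb_G [OF \<theta>i_space [OF p(2)]] diff_add_cancel eq by simp
    then show ?thesis using line_embed_coordinate [OF p(1)] \<theta>_\<theta>i [OF p(2)] by simp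
  qed
qed

context
  fixes \<Theta> \<Theta>' :: "'v \<Rightarrow> 'v"
  assumes hom: "homeomorphism UNIV UNIV \<Theta> \<Theta>'"
    and fixed: "\<And>z. z \<notin> blk \<Longrightarrow> \<Theta> z = z"
    and \<Theta>_blk: "\<And>z. z \<in> blk \<Longrightarrow> \<Theta> z \<in> blk"
    and compact_blk: "compact blk"
begin

abbreviation (input) Me where "Me \<equiv> exit_hset al au h1 h2 r \<Theta> \<Theta>'"

section \<open>The pulled-back h-set and its covering by \<open>N\<close>\<close>

lemma inverse_\<Theta>: "\<Theta>' (\<Theta> z) = z" "\<Theta> (\<Theta>' z) = z"
  using hom by (auto simp: homeomorphism_def)

lemma exit_hset_mem: "z \<in> hs_set Me \<longleftrightarrow> \<Theta> z \<in> exit_box al au h1 h2"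
proof
  assume "\<Theta> z \<in> exit_box al au h1 h2"
  then have "\<Theta>' (\<Theta> z) \<in> hs_set Me" by (simp add: exit_hset_def)
  then show "z \<in> hs_set Me" by (simp add: inverse_\<Theta>)
qed (auto simp: exit_hset_def inverse_\<Theta>)

lemma exit_hset_subset: "hs_set Me \<subseteq> blk"
  using exit_hset_mem exit_box_subset fixed by (metis subsetD subsetI)

lemma exit_hset_model: "hs_coord Me z \<in> hs_model Me \<longleftrightarrow> z \<in> hs_set Me"
  using exit_coord_model [of "\<Theta> z"] unfolding exit_hset_mem by (simp add: hs_model_def exit_hset_def)

lemma exit_hset_maps:
  "homeomorphic_maps euclidean (split_space 1 (Suc s)) (hs_coord Me) (\<Theta>' \<circ> exit_point)"
proof -
  have "homeomorphic_maps euclidean euclidean \<Theta> \<Theta>'"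
    using hom by (auto simp: homeomorphic_maps_def homeomorphism_def)
  from homeomorphic_maps_compose [OF conjI [OF this exit_coord_maps]] show ?thesis
    by (simp add: exit_hset_def o_def)
qed

lemma exit_hset_is_hset: "is_hset Me"
  unfolding is_hset_def
proof (intro conjI)
  have "closed (exit_box al au h1 h2)"
  proof -
    have "closedin (Euclidean_space s) (unit_cball s)"
    proof -
      have "continuous_map (Euclidean_space s) euclideanreal (\<lambda>x. \<Sum>i<s. (x i)\<^sup>2)"
        by (intro continuous_map_sum continuous_map_real_pow continuous_map_Euclidean_space_coordinate [where n = s]) auto
      from closedin_continuous_map_preimage [OF this, of "{..1}"] show ?thesis
        by (simp add: unit_cball_def)
    qed
    from closedin_continuous_map_preimage [OF cont_bb this] have "closed {z. bb z \<in> unit_cball s}" by simp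
    moreover have "closed {z. al \<le> \<alpha> z}" "closed {z. \<alpha> z \<le> au}" "closed {z. h1 \<le> \<nu> z}" "closed {z. \<nu> z \<le> h2}"
      using cont_\<alpha> cont_\<nu> by (auto intro!: closed_Collect_le)
    ultimately show ?thesis
      unfolding exit_box_def by (auto intro!: closed_Collect_conj)
  qed
  then have "compact (exit_box al au h1 h2)"
    using compact_Int_closed [OF compact_blk, of "exit_box al au h1 h2"] exit_box_subset by (simp add: Int_absorb1)
  moreover have "continuous_on (exit_box al au h1 h2) \<Theta>'"
    using hom continuous_on_subset by (auto simp: homeomorphism_def)
  ultimately show "compact (hs_set Me)"
    unfolding exit_hset_def by (auto intro: compact_continuous_image)
  show "homeomorphic_map (top_of_set (hs_space Me)) (split_space (hs_u Me) (hs_s Me)) (hs_coord Me)"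
    using exit_hset_maps by (auto simp: homeomorphic_map_maps exit_hset_def)
  show "hs_coord Me ` hs_set Me = hs_model Me"
  proof (intro equalityI subsetI)
    fix w assume w: "w \<in> hs_model Me"
    then have "w \<in> topspace (split_space 1 (Suc s))"
      using unit_cball_subset by (fastforce simp: hs_model_def exit_hset_def)
    then have "hs_coord Me ((\<Theta>' \<circ> exit_point) w) = w"
      using exit_hset_maps unfolding homeomorphic_maps_def by blast
    with w exit_hset_model show "w \<in> hs_coord Me ` hs_set Me" by (metis imageI)
  qed (use exit_hset_model in auto)
qed (auto simp: exit_hset_def dim)

text \<open>Turns crossing in the fast direction into crossing in the slow one. In the block,
  \<open>core\<close> lets the homotopy meet the slow window only between \<open>al\<close> and
  \<open>au\<close> and off the stable boundary. Outside the block \<Theta> is the identity, and for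
  the end map the tilt puts the side \<alpha> > 1 below the window and \<alpha> < -1 above it, so
  the signs at the two ends stay opposite.\<close>

lemma covers_exit_hset:
  assumes N: "is_hset N" "hs_u N = 1" and F: "continuous_on (hs_set N) F"
    and hF: "homotopic_with (avoids N K) (model_topology N) euclidean
        (\<lambda>w. F (hs_point N w)) (\<lambda>w. G (sg * A (fst w) 0) b0 y1)"
    and core: "\<And>z. z \<in> K \<Longrightarrow> bb (\<Theta> z) \<notin> unit_sphere s"
      "\<And>z. z \<in> K \<Longrightarrow> h1 \<le> tilt al r (\<Theta> z) \<Longrightarrow> tilt al r (\<Theta> z) \<le> h2 \<Longrightarrow> al < \<alpha> (\<Theta> z) \<and> \<alpha> (\<Theta> z) < au"
    and b0: "b0 \<in> unit_cball s" and y1: "0 < y1" "y1 < h1" and r: "h2 < r * (al + 1)" and sg: "sg \<in> {1, -1}"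
    and A: "continuous_map (Euclidean_space 1) (Euclidean_space 1) A"
    and A_out: "\<And>x. x \<in> unit_sphere 1 \<Longrightarrow> 1 < \<bar>A x 0\<bar>"
    and A_sign: "A (line_embed 1) 0 * A (line_embed (-1)) 0 < 0"
  shows "covers F N Me"
proof -
  have Me_simps: "hs_u Me = 1" "hs_s Me = Suc s" "hs_space Me = UNIV" by (simp_all add: exit_hset_def)
  let ?S = "split_space 1 (Suc s)"
  let ?c = "exit_coord al au h1 h2 r"
  define v where "v x = G (sg * A x 0) b0 y1" for x
  define At where "At x = fst (?c (\<Theta> (v x)))" for x
  have b0': "b0 \<in> topspace (Euclidean_space s)" using b0 unit_cball_subset by blast
  have v_coords: "\<alpha> (v x) = sg * A x 0" "bb (v x) = b0" "\<nu> (v x) = y1" for x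
    by (simp_all add: v_def \<alpha>_G bb_G \<nu>_G b0')
  have At_0: "At x 0 = (2 * tilt al r (\<Theta> (v x)) - h1 - h2) / (h2 - h1)" for x
    by (simp add: At_def exit_coord_def)
  have model: "hs_model Me = unit_cball 1 \<times> unit_cball (Suc s)" by (simp add: hs_model_def Me_simps)
  have plus: "hs_model_plus Me = unit_cball 1 \<times> unit_sphere (Suc s)" by (simp add: hs_model_plus_def Me_simps)
  have cont\<Theta>: "continuous_on UNIV \<Theta>" using hom by (simp add: homeomorphism_def)
  have c\<Theta>: "continuous_map euclidean ?S (?c \<circ> \<Theta>)"
    using cont\<Theta> by (intro continuous_map_compose [OF _ continuous_map_exit_coord]) simp
  have in_box: "z \<in> blk" if "\<Theta> z \<in> exit_box al au h1 h2" for z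
    using that exit_box_subset fixed by (metis subsetD)
  \<comment> \<open>Composition keeps the avoidance conditions: \<Theta> moves no outside point into
    the box, and a point of \<open>K\<close> that reaches the box lies over the open stable
    ball.\<close>
  have piece1: "homotopic_with (keeps_off N Me) (model_topology N) ?S
      ((?c \<circ> \<Theta>) \<circ> (\<lambda>w. F (hs_point N w))) ((?c \<circ> \<Theta>) \<circ> (\<lambda>w. G (sg * A (fst w) 0) b0 y1))"
  proof (rule homotopic_with_compose_continuous_map_left [OF hF c\<Theta>])
    fix j assume j: "avoids N K j"
    have "?c (\<Theta> (j w)) \<notin> unit_cball 1 \<times> unit_cball (Suc s)" if "w \<in> hs_model_minus N" for w
      unfolding exit_coord_model using j that in_box [of "j w"] by (auto simp: avoids_def)
    moreover have "?c (\<Theta> (j w)) \<notin> unit_cball 1 \<times> unit_sphere (Suc s)" if "w \<in> hs_model N" for w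
    proof
      assume c: "?c (\<Theta> (j w)) \<in> unit_cball 1 \<times> unit_sphere (Suc s)"
      then have box: "\<Theta> (j w) \<in> exit_box al au h1 h2"
        using unit_sphere_subset exit_coord_model [of "\<Theta> (j w)"] by (auto simp: mem_Times_iff)
      then have "j w \<in> K" using in_box j that by (auto simp: avoids_def)
      moreover have "tilt al r (\<Theta> (j w)) = \<nu> (\<Theta> (j w))" using box by (simp add: tilt_def exit_box_def)
      ultimately have "snd (?c (\<Theta> (j w))) \<in> unit_cball (Suc s) - unit_sphere (Suc s)"
        unfolding exit_coord_open_ball using core [of "j w"] box by (auto simp: exit_box_def)
      with c show False by auto
    qed
    ultimately show "keeps_off N Me ((?c \<circ> \<Theta>) \<circ> j)"
      unfolding keeps_off_def model plus by simp
  qed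
  have end_avoids: "avoids N K (\<lambda>w. v (fst w))"
    using homotopic_with_imp_property [OF hF] unfolding v_def by blast
  have out: "\<Theta> (v x) = v x" if "1 < \<bar>A x 0\<bar>" for x
    using that sg by (intro fixed) (auto simp: blk_def v_coords abs_mult)
  \<comment> \<open>No tilt acts where \<alpha> > 1, so \<open>y1 < h1\<close> decides; where
    \<alpha> < -1 the lift is at least \<open>r * (al + 1)\<close>, which exceeds
    \<open>h2\<close>.\<close>
  have far: "sg * A x 0 > 1 \<and> tilt al r (\<Theta> (v x)) < h1 \<or> sg * A x 0 < -1 \<and> h2 < tilt al r (\<Theta> (v x))"
    if "1 < \<bar>A x 0\<bar>" for x
  proof (cases "sg * A x 0 > 1")
    case True
    then have "tilt al r (v x) = y1" using al_au by (simp add: tilt_def v_coords)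
    with True y1 out [OF that] show ?thesis by simp
  next
    case False
    then have neg: "sg * A x 0 < -1" using that sg by auto
    have "0 < r" using r al_au h1_h2 by (metis add.commute add_0 diff_gt_0_iff_gt diff_minus_eq_add less_trans zero_less_mult_pos2)
    then have "r * (al + 1) \<le> r * max 0 (al - sg * A x 0)"
      using neg by (intro mult_left_mono) auto
    with r y1 have "h2 < tilt al r (v x)" by (simp add: tilt_def v_coords)
    with neg out [OF that] show ?thesis by simp
  qed
  \<comment> \<open>A tilt inside the window contradicts both cases of \<open>far\<close>, so the
    point lies in the block; \<open>avoids\<close> then puts it into \<open>K\<close>, where
    \<open>core\<close> applies.\<close>
  have open_ball: "snd (?c (\<Theta> (v (fst w)))) \<in> unit_cball (Suc s) - unit_sphere (Suc s)"
    if w: "w \<in> hs_model N" and t: "h1 \<le> tilt al r (\<Theta> (v (fst w)))" "tilt al r (\<Theta> (v (fst w))) \<le> h2" for w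
  proof -
    have "\<not> 1 < \<bar>A (fst w) 0\<bar>" using far [of "fst w"] t by auto
    then have "v (fst w) \<in> blk"
      using b0 y1 h1_h2 sg by (auto simp: blk_def v_coords abs_mult)
    then have K: "v (fst w) \<in> K" and "\<Theta> (v (fst w)) \<in> blk"
      using end_avoids w \<Theta>_blk by (auto simp: avoids_def)
    then show ?thesis
      unfolding exit_coord_open_ball using core [OF K] t by (auto simp: blk_def)
  qed
  have At_in: "At x \<in> unit_cball 1 \<longleftrightarrow> h1 \<le> tilt al r (\<Theta> (v x)) \<and> tilt al r (\<Theta> (v x)) \<le> h2" for x
    using normalised_le_1_iff [OF h1_h2(2), of "tilt al r (\<Theta> (v x))"]
    unfolding unit_cball_1 At_0 by (simp add: At_def exit_coord_def)
  let ?X = "prod_topology (top_of_set {0..1::real}) (model_topology N)"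
  have vcont: "continuous_map X euclidean (\<lambda>x. v (f x))" if "continuous_map X (Euclidean_space 1) f" for X f
  proof -
    have Af: "continuous_map X (Euclidean_space 1) (\<lambda>x. A (f x))"
      using continuous_map_compose [OF that A] by (simp add: o_def)
    have "continuous_map X euclideanreal (\<lambda>x. sg * A (f x) 0)"
      by (intro continuous_map_real_mult continuous_map_Euclidean_space_coordinate [OF Af]) auto
    then show ?thesis
      unfolding v_def using b0' by (intro continuous_map_into_chart) auto
  qed
  have ccont: "continuous_map X ?S (\<lambda>x. ?c (\<Theta> (v (f x))))" if "continuous_map X (Euclidean_space 1) f" for X f
    using continuous_map_compose [OF vcont [OF that] c\<Theta>] by (simp add: o_def)
  \<comment> \<open>The end of \<open>piece1\<close> depends on the unstable variable only, so
    shrinking its stable component to 0 yields the normal form of a covering.\<close>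
  have piece2: "homotopic_with (keeps_off N Me) (model_topology N) ?S
      (\<lambda>w. ?c (\<Theta> (v (fst w)))) (\<lambda>w. (At (fst w), \<lambda>_. 0))"
    unfolding homotopic_with_def
  proof (intro exI conjI allI ballI)
    define h where "h = (\<lambda>p :: real \<times> (nat \<Rightarrow> real) \<times> (nat \<Rightarrow> real). (fst (?c (\<Theta> (v (fst (snd p))))), \<lambda>i. (1 - fst p) * snd (?c (\<Theta> (v (fst (snd p))))) i))"
    have "continuous_map ?X (model_topology N) snd" by (rule continuous_map_snd)
    then have "continuous_map ?X (split_space (hs_u N) (hs_s N)) snd"
      unfolding model_topology_def by (rule continuous_map_into_fulltopology)
    then have cw: "continuous_map ?X (Euclidean_space 1) (\<lambda>p. fst (snd p))"
      by (simp add: continuous_map_pairwise o_def N)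
    have ct: "continuous_map ?X euclideanreal fst"
      using continuous_map_fst continuous_map_into_fulltopology by blast
    have c1: "continuous_map ?X (Euclidean_space 1) (\<lambda>p. fst (?c (\<Theta> (v (fst (snd p))))))"
      and c2: "continuous_map ?X (Euclidean_space (Suc s)) (\<lambda>p. snd (?c (\<Theta> (v (fst (snd p))))))"
      using ccont [OF cw] by (simp_all add: continuous_map_pairwise o_def)
    show "continuous_map ?X ?S h"
      unfolding continuous_map_pairwise h_def o_def fst_conv snd_conv
      by (intro conjI c1 continuous_map_Euclidean_space_scale c2 continuous_map_diff ct) auto
    show "h (0, w) = ?c (\<Theta> (v (fst w)))" "h (1, w) = (At (fst w), \<lambda>_. 0)" for w
      by (simp_all add: h_def At_def)
    fix t :: real assume t: "t \<in> {0..1}"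
    have "h (t, w) \<notin> unit_cball 1 \<times> unit_cball (Suc s)" if w: "w \<in> hs_model_minus N" for w
    proof -
      have "v (fst w) \<notin> blk" using end_avoids w by (simp add: avoids_def)
      then have "1 < \<bar>A (fst w) 0\<bar>" using b0 y1 h1_h2 sg by (auto simp: blk_def v_coords abs_mult)
      then have "At (fst w) \<notin> unit_cball 1" unfolding At_in using far [of "fst w"] by auto
      then show ?thesis by (simp add: h_def At_def [symmetric])
    qed
    moreover have "h (t, w) \<notin> unit_cball 1 \<times> unit_sphere (Suc s)" if w: "w \<in> hs_model N" for w
    proof
      assume h: "h (t, w) \<in> unit_cball 1 \<times> unit_sphere (Suc s)"
      then have "At (fst w) \<in> unit_cball 1" by (simp add: h_def At_def [symmetric])
      then have "snd (?c (\<Theta> (v (fst w)))) \<in> unit_cball (Suc s) - unit_sphere (Suc s)"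
        unfolding At_in using open_ball [OF w] by blast
      from scale_in_open_ball [OF this, of "1 - t"] t h show False by (simp add: h_def)
    qed
    ultimately show "keeps_off N Me (\<lambda>w. h (t, w))"
      unfolding keeps_off_def model plus by simp
  qed
  have At: "continuous_map (Euclidean_space 1) (Euclidean_space 1) At"
    using ccont [of "Euclidean_space 1" "\<lambda>x. x"] by (simp add: continuous_map_pairwise o_def At_def [abs_def])
  have sphere_pts: "line_embed 1 \<in> unit_sphere 1" "line_embed (-1) \<in> unit_sphere 1"
    unfolding unit_sphere_1 by (simp_all only: line_embed_in_space line_embed_0) auto
  have At_sign: "sg * A x 0 > 1 \<and> At x 0 < 0 \<or> sg * A x 0 < -1 \<and> 0 < At x 0" if "x \<in> unit_sphere 1" for x
    using far [OF A_out [OF that]] h1_h2 by (auto simp: At_0 zero_less_divide_iff divide_less_0_iff)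
  have At_deg: "At (line_embed 1) 0 * At (line_embed (-1)) 0 < 0"
    using At_sign [OF sphere_pts(1)] At_sign [OF sphere_pts(2)] A_sign sg
    by (auto simp: mult_less_0_iff)
  show ?thesis
    unfolding covers_iff_homotopic Me_simps
  proof (intro conjI exI)
    show "homotopic_with (keeps_off N Me) (model_topology N) ?S (\<lambda>w. hs_coord Me (F (hs_point N w))) (\<lambda>w. (At (fst w), \<lambda>_. 0))"
      using homotopic_with_trans [OF piece1, of "\<lambda>w. (At (fst w), \<lambda>_. 0)"] piece2
      by (simp add: o_def v_def exit_hset_def)
    show "At ` unit_sphere 1 \<subseteq> topspace (Euclidean_space 1) - unit_cball 1"
    proof
      fix y assume "y \<in> At ` unit_sphere 1"
      then obtain x where x: "x \<in> unit_sphere 1" "y = At x" by blast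
      then have "y \<notin> unit_cball 1" unfolding x(2) At_in using far [OF A_out [OF x(1)]] by auto
      then show "y \<in> topspace (Euclidean_space 1) - unit_cball 1"
        using x by (simp add: At_def exit_coord_def)
    qed
    show "ball_degree 1 At \<noteq> 0"
      using ball_degree_1 [OF At] At_deg by (force simp: mult_less_0_iff)
  qed (use N F At in auto)
qed

end

end

end

section \<open>From the dynamics to the covering relations\<close>

text \<open>All that the construction takes from the dynamics, in chart coordinates and without the
  field: exit faces are |\<alpha>| = 1 or \<nu> = 1, entrance faces are \<open>bb\<close> on the
  sphere or \<nu> = 0.\<close>

locale exchange = block_chart \<alpha> \<nu> bb G s \<theta> \<theta>i
  for \<alpha> \<nu> :: "'v::euclidean_space \<Rightarrow> real" and bb :: "'v \<Rightarrow> nat \<Rightarrow> real" and G s \<theta> \<theta>i +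
  fixes P :: "'v \<Rightarrow> 'v"
  assumes compact_blk: "compact blk"
    and cont_P: "continuous_on blk P"
    and P_blk: "\<And>z. z \<in> blk \<Longrightarrow> P z \<in> blk \<and> (\<bar>\<alpha> (P z)\<bar> = 1 \<or> \<nu> (P z) = 1)"
    and P_fixed: "\<And>z. z \<in> blk \<Longrightarrow> \<bar>\<alpha> z\<bar> = 1 \<or> \<nu> z = 1 \<Longrightarrow> P z = z"
    and P_stable: "\<And>z. z \<in> blk \<Longrightarrow> \<bar>\<alpha> z\<bar> \<noteq> 1 \<Longrightarrow> \<nu> z \<noteq> 1 \<Longrightarrow> bb (P z) \<notin> unit_sphere s"
    and \<nu>_mono: "\<And>z. z \<in> blk \<Longrightarrow> \<nu> z \<le> \<nu> (P z)"
    and \<nu>_P: "\<And>z. z \<in> blk \<Longrightarrow> \<nu> z = \<nu> (P z) \<Longrightarrow> P z = z"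
    and push: "\<And>K \<eta>. compact K \<Longrightarrow> K \<subseteq> blk \<Longrightarrow> (\<And>z. z \<in> K \<Longrightarrow> bb z \<notin> unit_sphere s \<and> \<nu> z \<noteq> 0) \<Longrightarrow> 0 < \<eta> \<Longrightarrow>
        \<exists>\<Theta> \<Theta>'. homeomorphism UNIV UNIV \<Theta> \<Theta>' \<and>
          (\<forall>z. z \<notin> blk \<or> z \<in> blk \<and> (\<bar>\<alpha> z\<bar> = 1 \<or> \<nu> z = 1) \<longrightarrow> \<Theta> z = z) \<and>
          (\<forall>z\<in>blk. \<Theta> z \<in> blk \<and> P (\<Theta> z) = P z) \<and>
          (\<forall>z\<in>blk. bb z \<notin> unit_sphere s \<and> \<nu> z \<noteq> 0 \<longrightarrow> bb (\<Theta> z) \<notin> unit_sphere s) \<and>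
          (\<forall>z\<in>K. \<nu> (P z) - \<nu> (\<Theta> z) < \<eta>)"
begin

text \<open>On the compact set where \<open>q\<close> is at least \<mu> the function
  \<open>p\<close> is positive, hence has a positive minimum. It is applied to functions
  \<open>p\<close> for which \<open>p z \<le> 0\<close> forces \<open>P z = z\<close>.\<close>

lemma uniform_smallness:
  assumes "continuous_on blk p" "continuous_on blk q" "0 < \<mu>"
    and "\<And>z. z \<in> blk \<Longrightarrow> (p z :: real) \<le> 0 \<Longrightarrow> q z < (\<mu> :: real)"
  shows "\<exists>\<eta>>0. \<forall>z\<in>blk. p z < \<eta> \<longrightarrow> q z < \<mu>"
proof -
  define S where "S = blk \<inter> (blk \<inter> q -` {\<mu>..})"
  have "compact S"
    unfolding S_def using compact_blk compact_imp_closed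
    by (intro compact_Int_closed continuous_closed_preimage assms) auto
  show ?thesis
  proof (cases "S = {}")
    case True
    then have "q z < \<mu>" if "z \<in> blk" for z using that by (force simp: S_def)
    then show ?thesis by (intro exI [of _ 1]) simp
  next
    case False
    have "continuous_on S p" using assms(1) by (rule continuous_on_subset) (auto simp: S_def)
    then obtain z0 where z0: "z0 \<in> S" "\<And>z. z \<in> S \<Longrightarrow> p z0 \<le> p z"
      using continuous_attains_inf [OF \<open>compact S\<close> False] by blast
    have "0 < p z0" using assms(4) [of z0] z0(1) by (force simp: S_def)
    moreover have "q z < \<mu>" if "z \<in> blk" "p z < p z0" for z
      using z0(2) [of z] that by (force simp: S_def)
    ultimately show ?thesis by blast
  qed
qed

lemma cont_blk: "continuous_on blk \<alpha>" "continuous_on blk \<nu>"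
    "continuous_on blk (\<lambda>z. \<alpha> (P z))" "continuous_on blk (\<lambda>z. \<nu> (P z))"
  using cont_P continuous_on_subset [OF cont_\<alpha>] continuous_on_subset [OF cont_\<nu>]
  by (auto intro: continuous_on_compose2 [OF cont_\<alpha>] continuous_on_compose2 [OF cont_\<nu>])

text \<open>The order of the constants matters: the window [h1, h2] fixes the accuracy \<mu>, this
  fixes \<open>al\<close>, \<open>al\<close> fixes the tolerance \<eta> demanded of \<Theta>, and
  only \<Theta> determines \<open>au\<close>.\<close>

theorem exchange_coverings:
  assumes cov: "covers F N Mh" and N: "is_hset N" "hs_u N = 1"
    and Mh: "is_hset Mh" "hs_set Mh = blk" "hs_u Mh = 1" "hs_s Mh = Suc s" "hs_space Mh = UNIV"
    and coord: "\<And>z. hs_coord Mh z = (line_embed (sg * \<alpha> z), \<theta> (bb z, \<nu> z))" and sg: "sg \<in> {1, -1}"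
    and E: "is_hset E" "hs_u E = 1" "hs_space E = {z. \<alpha> z = 1}"
    and e: "0 < e1" "e1 < e2" "e2 < 1"
    and E_stable: "\<And>z. \<alpha> z = 1 \<Longrightarrow> bb z \<in> unit_cball s - unit_sphere s \<Longrightarrow>
        snd (hs_coord E z) \<in> unit_cball (hs_s E) - unit_sphere (hs_s E)"
    and E_left: "\<And>z. \<alpha> z = 1 \<Longrightarrow> \<nu> z < e1 \<Longrightarrow> se * fst (hs_coord E z) 0 < -1"
    and E_right: "\<And>z. \<alpha> z = 1 \<Longrightarrow> e2 < \<nu> z \<Longrightarrow> 1 < se * fst (hs_coord E z) 0" and se: "se \<in> {1, -1}"
    and yb: "0 < yb" "yb < e1" and below: "\<And>z. z \<in> F ` hs_set N \<inter> blk \<Longrightarrow> \<nu> z < yb"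
  shows "\<exists>M'. is_hset M' \<and> hs_set M' \<subseteq> blk \<and> covers F N M' \<and> covers P M' E"
proof -
  let ?K = "{z \<in> blk. bb z \<notin> unit_sphere s \<and> 0 < \<nu> z \<and> \<nu> z < yb}"
  have yb1: "yb < 1" using yb e by linarith
  show ?thesis
  proof (rule squeezed_homotopy [OF cov N Mh coord sg yb(1) yb1 below])
    fix A b0 y1
    assume b0: "b0 \<in> unit_cball s" and y1: "0 < y1" "y1 < yb"
      and hF: "homotopic_with (avoids N ?K) (model_topology N) euclidean
        (\<lambda>w. F (hs_point N w)) (\<lambda>w. G (sg * A (fst w) 0) b0 y1)"
      and A: "continuous_map (Euclidean_space 1) (Euclidean_space 1) A"
        "\<And>x. x \<in> unit_sphere 1 \<Longrightarrow> 1 < \<bar>A x 0\<bar>" "A (line_embed 1) 0 * A (line_embed (-1)) 0 < 0"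
    \<comment> \<open>\<open>push\<close> needs a compact set, but \<open>?K\<close> is cut out by
      strict inequalities; the part of the image of the homotopy in the block serves
      instead.\<close>
    obtain K where K: "compact K" "K \<subseteq> ?K"
      and hK: "homotopic_with (avoids N K) (model_topology N) euclidean
          (\<lambda>w. F (hs_point N w)) (\<lambda>w. G (sg * A (fst w) 0) b0 y1)"
    proof -
      obtain h where h: "continuous_map (prod_topology (top_of_set {0..1::real}) (model_topology N)) euclidean h"
          "\<And>w. h (0, w) = F (hs_point N w)" "\<And>w. h (1, w) = G (sg * A (fst w) 0) b0 y1"
          "\<And>t. t \<in> {0..1} \<Longrightarrow> avoids N ?K (\<lambda>w. h (t, w))"
        using hF unfolding homotopic_with_def by auto
      define K where "K = h ` ({0..1} \<times> hs_model N) \<inter> blk"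
      show ?thesis
      proof (rule that)
        have "compact_space (prod_topology (top_of_set {0..1::real}) (model_topology N))"
          using compact_space_model [OF N(1)] by (simp add: compact_space_prod_topology compact_space_subtopology)
        then have "compactin euclidean (h ` topspace (prod_topology (top_of_set {0..1::real}) (model_topology N)))"
          using h(1) unfolding compact_space_def by (intro image_compactin)
        then show "compact K"
          unfolding K_def using compact_blk by (simp add: compact_Int)
        show "K \<subseteq> ?K" using h(4) by (auto simp: K_def avoids_def)
        have "avoids N K (\<lambda>w. h (t, w))" if "t \<in> {0..1}" for t
          using h(4) [OF that] that by (auto simp: K_def avoids_def)
        then show "homotopic_with (avoids N K) (model_topology N) euclidean
            (\<lambda>w. F (hs_point N w)) (\<lambda>w. G (sg * A (fst w) 0) b0 y1)"
          unfolding homotopic_with_def using h by blast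
      qed
    qed
    \<comment> \<open>The window [h1, h2] overhangs [e1, e2] at both ends, and it starts above
      \<open>yb\<close>, the bound for \<nu> on \<open>K\<close>.\<close>
    obtain h1 where h1: "yb < h1" "h1 < e1" using dense [OF yb(2)] by blast
    obtain h2 where h2: "e2 < h2" "h2 < 1" using dense [OF e(3)] by blast
    \<comment> \<open>The three bounds make the lower edge of the box exit below \<open>e1\<close>,
      and exclude exits from the box through \<nu> = 1 and through \<alpha> = -1.\<close>
    define \<mu> where "\<mu> = min (min (e1 - h1) (1 - h2)) 1"
    have \<mu>: "0 < \<mu>" "\<mu> \<le> e1 - h1" "\<mu> \<le> 1 - h2" "\<mu> \<le> 1" using h1 h2 by (auto simp: \<mu>_def)
    \<comment> \<open>\<open>P\<close> is the identity on \<alpha> = 1, so from points near this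
      face it still ends within \<mu> of it and changes \<nu> by less than \<mu>.\<close>
    have "\<exists>d>0. \<forall>z\<in>blk. 1 - \<alpha> z < d \<longrightarrow> max (1 - \<alpha> (P z)) (\<nu> (P z) - \<nu> z) < \<mu> \<and> \<nu> z - \<nu> (P z) < \<mu>"
    proof -
      have fixed: "P z = z" if "z \<in> blk" "1 - \<alpha> z \<le> 0" for z
        using that by (intro P_fixed) (auto simp: blk_def)
      have "\<exists>d>0. \<forall>z\<in>blk. 1 - \<alpha> z < d \<longrightarrow> max (1 - \<alpha> (P z)) (\<nu> (P z) - \<nu> z) < \<mu>"
        using \<mu>(1) fixed by (intro uniform_smallness continuous_intros cont_blk) auto
      then obtain d1 where d1: "d1 > 0" "\<forall>z\<in>blk. 1 - \<alpha> z < d1 \<longrightarrow> max (1 - \<alpha> (P z)) (\<nu> (P z) - \<nu> z) < \<mu>"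
        by blast
      have "\<exists>d>0. \<forall>z\<in>blk. 1 - \<alpha> z < d \<longrightarrow> \<nu> z - \<nu> (P z) < \<mu>"
        using \<mu>(1) fixed by (intro uniform_smallness continuous_intros cont_blk) auto
      then obtain d2 where d2: "d2 > 0" "\<forall>z\<in>blk. 1 - \<alpha> z < d2 \<longrightarrow> \<nu> z - \<nu> (P z) < \<mu>" by blast
      show ?thesis using d1 d2 by (intro exI [of _ "min d1 d2"]) auto
    qed
    then obtain d where d: "0 < d" "\<And>z. z \<in> blk \<Longrightarrow> 1 - \<alpha> z < d \<Longrightarrow>
        1 - \<alpha> (P z) < \<mu> \<and> \<nu> (P z) - \<nu> z < \<mu> \<and> \<nu> z - \<nu> (P z) < \<mu>"
      by auto
    \<comment> \<open>At least 1/2, so that with tilt slope 1 every point within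
      \<open>1 - al\<close> of the face \<alpha> = -1 is lifted by at least 1, beyond
      \<open>h2\<close>.\<close>
    define al where "al = 1 - min (d/2) (1/2)"
    have al: "1/2 \<le> al" "al < 1" "1 - al < d" using d(1) by (auto simp: al_def)
    \<comment> \<open>Tolerance for the push: zero slow distance to the exit means a fixed point, so
      a distance below \<eta> confines the displacement to less than \<open>1 - al\<close> in
      \<alpha> and \<open>1 - h2\<close> in \<nu>.\<close>
    have "\<exists>\<eta>>0. \<forall>z\<in>blk. \<nu> (P z) - \<nu> z < \<eta> \<longrightarrow>
        max \<bar>\<alpha> (P z) - \<alpha> z\<bar> \<bar>\<nu> (P z) - \<nu> z\<bar> < min (1 - al) (1 - h2)"
    proof (intro uniform_smallness continuous_intros cont_blk)
      show "0 < min (1 - al) (1 - h2)" using al h2 by simp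
      fix z assume z: "z \<in> blk" "\<nu> (P z) - \<nu> z \<le> 0"
      then have "P z = z" using \<nu>_P [of z] \<nu>_mono [of z] by simp
      then show "max \<bar>\<alpha> (P z) - \<alpha> z\<bar> \<bar>\<nu> (P z) - \<nu> z\<bar> < min (1 - al) (1 - h2)" using al h2 by simp
    qed
    then obtain \<eta> where \<eta>: "0 < \<eta>" "\<And>z. z \<in> blk \<Longrightarrow> \<nu> (P z) - \<nu> z < \<eta> \<Longrightarrow>
        \<bar>\<alpha> (P z) - \<alpha> z\<bar> < 1 - al \<and> \<bar>\<nu> (P z) - \<nu> z\<bar> < 1 - h2"
      by auto
    obtain \<Theta> \<Theta>' where hom: "homeomorphism UNIV UNIV \<Theta> \<Theta>'"
      and \<Theta>_fixed: "\<And>z. z \<notin> blk \<Longrightarrow> \<Theta> z = z" "\<And>z. z \<in> blk \<Longrightarrow> \<bar>\<alpha> z\<bar> = 1 \<or> \<nu> z = 1 \<Longrightarrow> \<Theta> z = z"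
      and \<Theta>_blk: "\<And>z. z \<in> blk \<Longrightarrow> \<Theta> z \<in> blk" "\<And>z. z \<in> blk \<Longrightarrow> P (\<Theta> z) = P z"
      and \<Theta>_stable: "\<And>z. z \<in> blk \<Longrightarrow> bb z \<notin> unit_sphere s \<Longrightarrow> \<nu> z \<noteq> 0 \<Longrightarrow> bb (\<Theta> z) \<notin> unit_sphere s"
      and \<Theta>_near: "\<And>z. z \<in> K \<Longrightarrow> \<nu> (P z) - \<nu> (\<Theta> z) < \<eta>"
    proof -
      have "K \<subseteq> blk" "\<And>z. z \<in> K \<Longrightarrow> bb z \<notin> unit_sphere s \<and> \<nu> z \<noteq> 0" using K(2) by auto
      from push [OF K(1) this \<eta>(1)] that show ?thesis by auto
    qed
    have K_blk: "K \<subseteq> blk" using K(2) by auto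
    have inj: "\<Theta> z = \<Theta> z' \<Longrightarrow> z = z'" for z z' using hom by (metis UNIV_I homeomorphism_apply1)
    \<comment> \<open>Points of \<open>\<Theta> K\<close> on the face \<open>\<alpha> = 1\<close> are fixed, hence lie below \<open>yb\<close>.\<close>
    have "\<exists>au. al < au \<and> au < 1 \<and> (\<forall>z\<in>K. h1 \<le> \<nu> (\<Theta> z) \<longrightarrow> \<alpha> (\<Theta> z) < au)"
    proof -
      define S where "S = \<Theta> ` K \<inter> {z. h1 \<le> \<nu> z}"
      have "continuous_on K \<Theta>" using hom continuous_on_subset by (auto simp: homeomorphism_def)
      then have "compact S"
        unfolding S_def using K(1) cont_\<nu> by (intro compact_Int_closed compact_continuous_image closed_Collect_le) auto
      have lt: "\<alpha> w < 1" if "w \<in> S" for w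
      proof -
        obtain z where z: "z \<in> K" "w = \<Theta> z" "h1 \<le> \<nu> w" using \<open>w \<in> S\<close> by (auto simp: S_def)
        then have w: "w \<in> blk" using \<Theta>_blk K_blk by auto
        have "\<alpha> w \<noteq> 1"
        proof
          assume "\<alpha> w = 1"
          then have "\<Theta> w = w" using \<Theta>_fixed(2) w by auto
          then have "w = z" using inj z by auto
          then show False using z K(2) h1 by auto
        qed
        with w show ?thesis by (auto simp: blk_def abs_le_iff)
      qed
      show ?thesis
      proof (cases "S = {}")
        case True
        then show ?thesis using dense [OF al(2)] by (force simp: S_def)
      next
        case False
        then obtain w0 where w0: "w0 \<in> S" "\<And>w. w \<in> S \<Longrightarrow> \<alpha> w \<le> \<alpha> w0"
          using continuous_attains_sup [OF \<open>compact S\<close> False continuous_on_subset [OF cont_\<alpha>]] by blast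
        obtain au where "max al (\<alpha> w0) < au" "au < 1" using dense [of "max al (\<alpha> w0)" 1] lt [OF w0(1)] al by auto
        with w0(2) show ?thesis by (intro exI [of _ au]) (force simp: S_def)
      qed
    qed
    then obtain au where au: "al < au" "au < 1" "\<And>z. z \<in> K \<Longrightarrow> h1 \<le> \<nu> (\<Theta> z) \<Longrightarrow> \<alpha> (\<Theta> z) < au" by blast
    have params: "-1 < al" "al < au" "au < 1" "0 < h1" "h1 < h2" "h2 < 1" using al au h1 h2 yb e by auto
    let ?M = "exit_hset al au h1 h2 1 \<Theta> \<Theta>'"
    note M_facts = params hom \<Theta>_fixed(1) \<Theta>_blk(1) compact_blk
    have "is_hset ?M" by (rule exit_hset_is_hset [OF M_facts])
    moreover have "hs_set ?M \<subseteq> blk" by (rule exit_hset_subset [OF M_facts])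
    moreover have "covers F N ?M"
    proof (rule covers_exit_hset [where F = F and A = A and sg = sg and ?b0.0 = b0 and ?y1.0 = y1, OF M_facts N _ hK])
      show "continuous_on (hs_set N) F" using cov by (simp add: covers_def)
      show "bb (\<Theta> z) \<notin> unit_sphere s" if "z \<in> K" for z
        using that K(2) by (intro \<Theta>_stable) auto
      show "al < \<alpha> (\<Theta> z) \<and> \<alpha> (\<Theta> z) < au"
        if z: "z \<in> K" and t: "h1 \<le> tilt al 1 (\<Theta> z)" "tilt al 1 (\<Theta> z) \<le> h2" for z
      proof -
        have w: "\<Theta> z \<in> blk" "P (\<Theta> z) = P z" using z K_blk \<Theta>_blk by auto
        have near: "\<bar>\<alpha> (P z) - \<alpha> (\<Theta> z)\<bar> < 1 - al" "\<bar>\<nu> (P z) - \<nu> (\<Theta> z)\<bar> < 1 - h2"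
          using \<eta>(2) [OF w(1)] \<Theta>_near [OF z] by (auto simp: w(2))
        \<comment> \<open>The slow tolerance excludes an exit through \<nu> = 1. An exit through
          \<alpha> = -1 would put \<alpha> (\<Theta> z) below \<open>- al\<close>, where the tilt is
          at least \<open>2 * al\<close>, hence at least 1. Only \<alpha> = 1 remains.\<close>
        have "\<nu> (\<Theta> z) \<le> h2" using t(2) by (simp add: tilt_def)
        then have "\<nu> (P z) \<noteq> 1" using near(2) by auto
        then have "\<bar>\<alpha> (P z)\<bar> = 1" using P_blk [of z] z K_blk by auto
        moreover have "\<alpha> (P z) \<noteq> -1"
        proof
          assume "\<alpha> (P z) = -1"
          then have "1 \<le> max 0 (al - \<alpha> (\<Theta> z))" using near(1) al(1) by auto
          moreover have "0 \<le> \<nu> (\<Theta> z)" using w(1) by (simp add: blk_def)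
          ultimately show False using t(2) h2 by (simp add: tilt_def)
        qed
        ultimately have "al < \<alpha> (\<Theta> z)" using near(1) by linarith
        moreover from this have "h1 \<le> \<nu> (\<Theta> z)" using t(1) by (simp add: tilt_def)
        ultimately show ?thesis using au(3) [OF z] by blast
      qed
      show "y1 < h1" using y1 h1 by linarith
      show "h2 < 1 * (al + 1)" using h2 al by simp
    qed (use b0 y1 sg A in auto)
    moreover have "covers P ?M E"
    proof (rule covers_by_linear_homotopy [OF _ _ E(1,2) _ _ _ se])
      show "is_hset ?M" by fact
      show "hs_u ?M = 1" by (simp add: exit_hset_def)
      have sub: "hs_set ?M \<subseteq> blk" by fact
      show "continuous_on (hs_set ?M) P" using cont_P sub by (rule continuous_on_subset)
      \<comment> \<open>\<open>P z\<close> equals \<open>P (\<Theta> z)\<close> and \<Theta> z is in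
        the box, so the estimates near \<alpha> = 1 apply although \<open>z\<close> itself may be
        far from that face.\<close>
      have key: "z \<in> blk" "\<alpha> (P z) = 1" "bb (P z) \<in> unit_cball s - unit_sphere s" "\<bar>\<nu> (P z) - \<nu> (\<Theta> z)\<bar> < \<mu>"
        if "z \<in> hs_set ?M" for z
      proof -
        show z: "z \<in> blk" using that sub by blast
        have box: "\<Theta> z \<in> exit_box al au h1 h2" using that exit_hset_mem [OF M_facts] by blast
        have w: "\<Theta> z \<in> blk" "P (\<Theta> z) = P z" using \<Theta>_blk z by auto
        have near: "1 - \<alpha> (P z) < \<mu>" "\<nu> (P z) - \<nu> (\<Theta> z) < \<mu>" "\<nu> (\<Theta> z) - \<nu> (P z) < \<mu>"
          using d(2) [OF w(1)] box al by (auto simp: exit_box_def w(2))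
        then show "\<bar>\<nu> (P z) - \<nu> (\<Theta> z)\<bar> < \<mu>" by linarith
        have "\<nu> (P z) < 1" using near(2) box \<mu> by (auto simp: exit_box_def)
        moreover have "-1 < \<alpha> (P z)" using near(1) \<mu> by linarith
        ultimately show "\<alpha> (P z) = 1" using P_blk [OF z] by auto
        have "\<bar>\<alpha> (\<Theta> z)\<bar> \<noteq> 1" "\<nu> (\<Theta> z) \<noteq> 1" using box params al by (auto simp: exit_box_def)
        then have "bb (P z) \<notin> unit_sphere s" using P_stable [OF w(1)] w(2) by simp
        then show "bb (P z) \<in> unit_cball s - unit_sphere s" using P_blk [OF z] by (simp add: blk_def)
      qed
      show "P ` hs_set ?M \<subseteq> hs_space E" using key by (auto simp: E)
      have coord0: "fst (hs_coord ?M z) 0 = (2 * \<nu> (\<Theta> z) - h1 - h2) / (h2 - h1)" if "z \<in> hs_set ?M" for z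
      proof -
        have "\<Theta> z \<in> exit_box al au h1 h2" using that exit_hset_mem [OF M_facts] by blast
        then show ?thesis by (simp add: exit_hset_def exit_coord_def exit_box_def tilt_def)
      qed
      fix z assume z: "z \<in> hs_set ?M"
      show "snd (hs_coord E (P z)) \<in> unit_cball (hs_s E) - unit_sphere (hs_s E)"
        using key [OF z] by (intro E_stable)
      \<comment> \<open>On the upper edge monotonicity of \<nu> suffices; on the lower edge orbits
        rise towards \<open>e1\<close>, and \<open>h1 + \<mu> \<le> e1\<close> stops them short of
        it.\<close>
      show "1 < se * fst (hs_coord E (P z)) 0" if "fst (hs_coord ?M z) 0 = 1"
      proof (rule E_right)
        have "\<nu> (\<Theta> z) = h2" using that coord0 [OF z] params by (simp add: field_simps)
        moreover have "\<nu> (\<Theta> z) \<le> \<nu> (P z)" using \<nu>_mono [OF \<Theta>_blk(1) [OF key(1) [OF z]]] \<Theta>_blk(2) [OF key(1) [OF z]] by simp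
        ultimately show "e2 < \<nu> (P z)" using h2 by linarith
      qed (use key [OF z] in simp)
      show "se * fst (hs_coord E (P z)) 0 < -1" if "fst (hs_coord ?M z) 0 = -1"
      proof (rule E_left)
        have "2 * \<nu> (\<Theta> z) - h1 - h2 = - (h2 - h1)"
          using that coord0 [OF z] params by (simp add: field_simps)
        then have "\<nu> (\<Theta> z) = h1" by simp
        then show "\<nu> (P z) < e1" using key(4) [OF z] \<mu>(2) by linarith
      qed (use key [OF z] in simp)
    qed
    ultimately show ?thesis by blast
  qed
qed

end

section \<open>Fast-slow fields are locally Lipschitz\<close>

lemma Cr_on_continuous: "Cr_on r F S \<Longrightarrow> continuous_on S F"
  by (cases r) (auto simp: continuous_on_eq_continuous_within intro: has_derivative_continuous)

text \<open>Derivatives are taken within the slab, one-sided at its ends, so \<open>F\<close> is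
  first restricted to the slice at \<epsilon> by the chain rule within sets; the slice carries the
  mean value bound on the ball.\<close>

lemma Cr_on_locally_lipschitz:
  fixes F :: "'a::euclidean_space \<times> real \<times> real \<Rightarrow> 'b::real_normed_vector"
  assumes Cr: "Cr_on r F (UNIV \<times> UNIV \<times> {0..e0})" and "1 \<le> r" and \<epsilon>: "\<epsilon> \<in> {0..e0}"
  shows "\<exists>L. L-lipschitz_on (cball 0 R) (\<lambda>z. F (fst z, snd z, \<epsilon>))"
proof -
  let ?S = "UNIV \<times> UNIV \<times> {0..e0}"
  define j where "j z = (fst z, snd z, \<epsilon>)" for z :: "'a \<times> real"
  define j' where "j' h = (fst h, snd h, 0 :: real)" for h :: "'a \<times> real"
  obtain r' where "r = Suc r'" using \<open>1 \<le> r\<close> by (cases r) auto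
  then have "\<exists>D. (\<forall>p\<in>?S. (F has_derivative D p) (at p within ?S)) \<and> (\<forall>v\<in>Basis. Cr_on r' (\<lambda>p. D p v) ?S)"
    using Cr by (simp only: Cr_on.simps)
  then obtain D where D: "\<forall>p\<in>?S. (F has_derivative D p) (at p within ?S)"
    and CrD: "\<forall>v\<in>Basis. Cr_on r' (\<lambda>p. D p v) ?S"
    by (elim exE conjE)
  have contD: "continuous_on ?S (\<lambda>p. D p v)" if "v \<in> Basis" for v
    by (rule Cr_on_continuous [OF bspec [OF CrD that]])
  have jS: "j z \<in> ?S" for z using \<epsilon> by (simp add: j_def)
  have jR: "compact (j ` cball 0 R)" unfolding j_def by (intro compact_continuous_image continuous_intros) auto
  have "j ` cball 0 R \<subseteq> ?S" using jS by blast
  then have "compact ((\<lambda>p. D p v) ` j ` cball 0 R)" if "v \<in> Basis" for v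
    using jR by (rule compact_continuous_image [OF continuous_on_subset [OF contD [OF that]]])
  then have "\<exists>B. \<forall>z \<in> cball 0 R. norm (D (j z) v) \<le> B" if "v \<in> Basis" for v
    using that by (fastforce simp: bounded_iff dest!: compact_imp_bounded)
  then obtain B where B: "\<And>v z. v \<in> Basis \<Longrightarrow> z \<in> cball 0 R \<Longrightarrow> norm (D (j z) v) \<le> B v" by metis
  \<comment> \<open>Continuity is known only for the derivatives along basis vectors; the sum of
    their bounds dominates the operator norm.\<close>
  define C where "C = (\<Sum>v\<in>Basis. \<bar>B v\<bar>)"
  have "C-lipschitz_on (cball 0 R) (F \<circ> j)"
  proof (rule bounded_derivative_imp_lipschitz)
    fix z :: "'a \<times> real" assume z: "z \<in> cball 0 R"
    have "(j has_derivative j') (at z within cball 0 R)"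
      unfolding j_def j'_def by (auto intro!: derivative_eq_intros)
    moreover have "(F has_derivative D (j z)) (at (j z) within j ` cball 0 R)"
      by (rule has_derivative_subset [OF bspec [OF D jS]]) (use jS in blast)
    ultimately show "((F \<circ> j) has_derivative (D (j z) \<circ> j')) (at z within cball 0 R)"
      by (rule diff_chain_within)
    have lin: "linear (D (j z))" using bspec [OF D jS] by (rule has_derivative_linear)
    show "onorm (D (j z) \<circ> j') \<le> C"
    proof (rule onorm_bound)
      fix h :: "'a \<times> real"
      have "norm (j' h) = norm h" by (simp add: j'_def norm_prod_def)
      have "D (j z) (j' h) = D (j z) (\<Sum>v\<in>Basis. (j' h \<bullet> v) *\<^sub>R v)"
        by (simp only: euclidean_representation)
      also have "\<dots> = (\<Sum>v\<in>Basis. (j' h \<bullet> v) *\<^sub>R D (j z) v)"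
        by (simp add: linear_sum [OF lin] linear_scale [OF lin])
      also have "norm \<dots> \<le> (\<Sum>v\<in>Basis. norm h * \<bar>B v\<bar>)"
      proof (rule sum_norm_le)
        fix v :: "'a \<times> real \<times> real" assume v: "v \<in> Basis"
        have "\<bar>j' h \<bullet> v\<bar> \<le> norm h"
          using Basis_le_norm [OF v, of "j' h"] \<open>norm (j' h) = norm h\<close> by simp
        then show "norm ((j' h \<bullet> v) *\<^sub>R D (j z) v) \<le> norm h * \<bar>B v\<bar>"
          using B [OF v z] by (auto intro!: mult_mono)
      qed
      finally show "norm ((D (j z) \<circ> j') h) \<le> C * norm h"
        by (simp add: C_def sum_distrib_left mult.commute)
    qed (simp add: C_def sum_nonneg)
  qed (simp_all add: C_def sum_nonneg)
  then show ?thesis by (auto simp: o_def j_def)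
qed

lemma fast_slow_field_locally_lipschitz:
  fixes f :: "'a::euclidean_space \<times> real \<times> real \<Rightarrow> 'a"
  assumes "Cr_on r f (UNIV \<times> UNIV \<times> {0..e0})" "Cr_on r g (UNIV \<times> UNIV \<times> {0..e0})" "1 \<le> r" "\<epsilon> \<in> {0..e0}"
  shows "\<exists>L. L-lipschitz_on (cball 0 R) (fast_slow_field f g \<epsilon>)"
proof -
  obtain L1 where L1: "L1-lipschitz_on (cball 0 R) (\<lambda>z. f (fst z, snd z, \<epsilon>))"
    using Cr_on_locally_lipschitz [OF assms(1,3,4)] by blast
  obtain L2 where L2: "L2-lipschitz_on (cball 0 R) (\<lambda>z. g (fst z, snd z, \<epsilon>))"
    using Cr_on_locally_lipschitz [OF assms(2,3,4)] by blast
  from L1 L2 have "(sqrt (L1\<^sup>2 + (\<bar>\<epsilon>\<bar> * L2)\<^sup>2))-lipschitz_on (cball 0 R) (\<lambda>z. (f (fst z, snd z, \<epsilon>), \<epsilon> * g (fst z, snd z, \<epsilon>)))"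
    by (intro lipschitz_on_Pair lipschitz_on_cmult_real)
  then show ?thesis by (auto simp: fast_slow_field_def case_prod_beta')
qed

section \<open>Fast-saddle-type blocks\<close>

lemma to_local_from_local:
  assumes "invertible (fb_lin D)" shows "to_local D (from_local D c) = c" "from_local D (to_local D x) = x"
proof -
  have "fb_lin D ** matrix_inv (fb_lin D) = mat 1 \<and> matrix_inv (fb_lin D) ** fb_lin D = mat 1"
    using assms unfolding invertible_def matrix_inv_def by (rule someI_ex)
  then show "to_local D (from_local D c) = c" "from_local D (to_local D x) = x"
    by (simp_all add: to_local_def from_local_def matrix_vector_mul_assoc)
qed

locale fast_slow_block =
  fixes f :: "(real^('n::finite)) \<times> real \<times> real \<Rightarrow> real^'n" and g :: "(real^'n) \<times> real \<times> real \<Rightarrow> real"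
    and e0 \<epsilon> :: real and D :: "'n fs_block" and i :: 'n and \<beta> \<theta> M and q a :: real and s :: nat
  assumes s: "s = CARD('n) - 1" and \<epsilon>: "0 < \<epsilon>" "\<epsilon> \<le> e0"
    and saddle: "fast_saddle_block f e0 D" and M: "block_hset D i \<beta> \<theta> M"
    and q: "q \<in> {-1, 1}" and slow: "\<forall>(x, y)\<in>hs_set M. q * g (x, y, \<epsilon>) > 0" and a: "a \<in> {-1, 1}"
    and lip: "\<And>R. \<exists>L. L-lipschitz_on (cball 0 R) (fast_slow_field f g \<epsilon>)"
begin

abbreviation (input) X where "X \<equiv> fast_slow_field f g \<epsilon>"
abbreviation (input) lo where "lo \<equiv> fb_lo D"
abbreviation (input) hi where "hi \<equiv> fb_hi D"

definition loc :: "(real^'n) \<times> real \<Rightarrow> real^'n" where "loc z = to_local D (fst z)"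

lemma M_facts:
  "fb_unst D = {i}" "homeomorphic_map (top_of_set {b. b $ i = 0}) (Euclidean_space s) \<beta>"
  "\<beta> ` {b. b $ i = 0 \<and> (\<forall>j. j \<noteq> i \<longrightarrow> lo $ j \<le> b $ j \<and> b $ j \<le> hi $ j)} = unit_cball s"
  "homeomorphic_map (prod_topology (Euclidean_space s) euclideanreal) (Euclidean_space (Suc s)) \<theta>"
  "\<theta> ` (unit_cball s \<times> {0..1}) = unit_cball (Suc s)"
  "is_hset M" "hs_set M = block_set D" "hs_u M = 1" "hs_s M = Suc s"
  "\<And>z. hs_coord M z = (line_embed (norm_a D i z), \<theta> (norm_b D i \<beta> z, norm_y D z))"
  using M unfolding block_hset_def Let_def s by blast+

lemma inv_lin: "invertible (fb_lin D)" and ylo_yhi: "fb_ylo D < fb_yhi D"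
  using saddle by (simp_all add: fast_saddle_block_def)

lemmas loc_inv = to_local_from_local [OF inv_lin]

lemma block_set_iff:
  "z \<in> block_set D \<longleftrightarrow> (\<forall>j. lo $ j \<le> loc z $ j \<and> loc z $ j \<le> hi $ j) \<and> fb_ylo D \<le> snd z \<and> snd z \<le> fb_yhi D"
proof
  assume "z \<in> block_set D"
  then show "(\<forall>j. lo $ j \<le> loc z $ j \<and> loc z $ j \<le> hi $ j) \<and> fb_ylo D \<le> snd z \<and> snd z \<le> fb_yhi D"
    by (auto simp: block_set_def block_local_def loc_def loc_inv)
next
  assume "(\<forall>j. lo $ j \<le> loc z $ j \<and> loc z $ j \<le> hi $ j) \<and> fb_ylo D \<le> snd z \<and> snd z \<le> fb_yhi D"
  then have "(loc z, snd z) \<in> block_local D" by (simp add: block_local_def)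
  moreover have "z = (\<lambda>(c, y). (from_local D c, y)) (loc z, snd z)" by (simp add: loc_def loc_inv)
  ultimately show "z \<in> block_set D" unfolding block_set_def by blast
qed

lemma block_nonempty: "block_set D \<noteq> {}"
proof -
  have "(\<lambda>_. 0) \<in> unit_cball k" for k by (simp add: unit_cball_def topspace_Euclidean_space)
  then have "hs_model M \<noteq> {}" by (auto simp: hs_model_def)
  moreover have "hs_coord M ` hs_set M = hs_model M" using M_facts(6) by (simp add: is_hset_def)
  ultimately show ?thesis unfolding M_facts(7) by blast
qed

definition vel where "vel z j = (matrix_inv (fb_lin D) $ j) \<bullet> fst (X z)"

text \<open>The local velocity is eigenvalue times coordinate plus remainder. The ends of the block
  come from strict bounds on the remainder, so on each face the sum has a definite sign; the same
  strictness leaves a gap between \<open>lo\<close> and \<open>hi\<close>.\<close>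

lemma velocity_signs:
  assumes z: "z \<in> block_set D"
  shows "loc z $ i = hi $ i \<Longrightarrow> vel z i > 0" "loc z $ i = lo $ i \<Longrightarrow> vel z i < 0"
    "j \<noteq> i \<Longrightarrow> loc z $ j = hi $ j \<Longrightarrow> vel z j < 0" "j \<noteq> i \<Longrightarrow> loc z $ j = lo $ j \<Longrightarrow> vel z j > 0"
    and lo_less_hi: "lo $ j < hi $ j"
proof -
  obtain W and \<delta>m \<delta>p :: "real^'n" where
    F: "\<forall>x\<in>W. \<forall>y\<in>{fb_ylo D..fb_yhi D}. \<forall>\<epsilon>\<in>{0..e0}. \<forall>i.
           \<delta>m $ i < local_F D f (to_local D x, y, \<epsilon>) $ i \<and> local_F D f (to_local D x, y, \<epsilon>) $ i < \<delta>p $ i"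
    and un: "\<forall>i\<in>fb_unst D. lo $ i \<le> - \<delta>p $ i / fb_eig D $ i \<and> - \<delta>m $ i / fb_eig D $ i \<le> hi $ i"
    and st: "\<forall>i\<in>- fb_unst D. lo $ i \<le> - \<delta>m $ i / fb_eig D $ i \<and> - \<delta>p $ i / fb_eig D $ i \<le> hi $ i"
    and W: "block_set D \<subseteq> W \<times> {fb_ylo D..fb_yhi D}"
    and eig: "\<forall>i\<in>fb_unst D. 0 < fb_eig D $ i" "\<forall>i\<in>- fb_unst D. fb_eig D $ i < 0"
    using saddle unfolding fast_saddle_block_def by blast
  obtain x y where xy: "z = (x, y)" by fastforce
  have "x \<in> W" "y \<in> {fb_ylo D..fb_yhi D}" "\<epsilon> \<in> {0..e0}" using z W xy \<epsilon> by auto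
  with F have bounds: "\<delta>m $ j < local_F D f (to_local D x, y, \<epsilon>) $ j" "local_F D f (to_local D x, y, \<epsilon>) $ j < \<delta>p $ j" for j
    by blast+
  have v: "vel z j = fb_eig D $ j * loc z $ j + local_F D f (to_local D x, y, \<epsilon>) $ j" for j
    by (simp add: vel_def fast_slow_field_def xy local_F_def loc_inv loc_def matrix_vector_mul_component)
  have ei: "0 < fb_eig D $ i" using eig M_facts(1) by simp
  have ui: "fb_eig D $ i * lo $ i \<le> - \<delta>p $ i" "- \<delta>m $ i \<le> fb_eig D $ i * hi $ i"
    using un ei M_facts(1) by (simp_all add: field_simps)
  show "vel z i > 0" if "loc z $ i = hi $ i" unfolding v that using ui(2) bounds(1) [of i] by simp
  show "vel z i < 0" if "loc z $ i = lo $ i" unfolding v that using ui(1) bounds(2) [of i] by simp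
  have sj: "fb_eig D $ j < 0" "- \<delta>m $ j \<le> fb_eig D $ j * lo $ j" "fb_eig D $ j * hi $ j \<le> - \<delta>p $ j" if "j \<noteq> i" for j
  proof -
    show e: "fb_eig D $ j < 0" using eig M_facts(1) that by simp
    have "lo $ j \<le> - \<delta>m $ j / fb_eig D $ j" "- \<delta>p $ j / fb_eig D $ j \<le> hi $ j" using st M_facts(1) that by auto
    then show "- \<delta>m $ j \<le> fb_eig D $ j * lo $ j" "fb_eig D $ j * hi $ j \<le> - \<delta>p $ j"
      using e by (simp_all add: field_simps)
  qed
  show "vel z j < 0" if "j \<noteq> i" "loc z $ j = hi $ j"
    unfolding v that(2) using sj(3) [OF that(1)] bounds(2) [of j] by simp
  show "vel z j > 0" if "j \<noteq> i" "loc z $ j = lo $ j"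
    unfolding v that(2) using sj(2) [OF that(1)] bounds(1) [of j] by simp
  show "lo $ j < hi $ j"
  proof (cases "j = i")
    case True
    have "fb_eig D $ i * lo $ i < fb_eig D $ i * hi $ i" using ui bounds [of i] by linarith
    then show ?thesis using ei True by simp
  next
    case False
    have "fb_eig D $ j * hi $ j < fb_eig D $ j * lo $ j" using sj(2,3) [OF False] bounds [of j] by linarith
    then show ?thesis using sj(1) [OF False] by (simp add: mult_less_cancel_left)
  qed
qed

lemma lo_hi: "lo $ j < hi $ j"
  using block_nonempty lo_less_hi by blast

lemma continuous_loc: "continuous_on S loc"
  unfolding loc_def to_local_def
  by (intro continuous_intros continuous_on_compose2 [OF matrix_vector_mult_linear_continuous_on [of UNIV]]) auto

lemma loc_inner: "loc z $ j = (matrix_inv (fb_lin D) $ j, 0) \<bullet> z - matrix_inv (fb_lin D) $ j \<bullet> fb_base D"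
  by (simp add: loc_def to_local_def matrix_vector_mul_component inner_diff_right inner_prod_def)

subsection \<open>The block as an isolating polytope\<close>

text \<open>Rows of the inverse matrix with 0 in the slow slot are the normals of the fast faces;
  \<open>off\<close> accounts for the base point of the affine change.\<close>

definition nrm where "nrm j = (matrix_inv (fb_lin D) $ j, 0 :: real)"
definition off where "off j = matrix_inv (fb_lin D) $ j \<bullet> fb_base D"

definition out_faces where
  "out_faces = {(nrm i, hi $ i + off i), (- nrm i, - lo $ i - off i),
     if q = 1 then ((0, 1), fb_yhi D) else ((0, -1), - fb_ylo D)}"

definition in_faces where
  "in_faces = (\<lambda>j. (nrm j, hi $ j + off j)) ` (- {i}) \<union> (\<lambda>j. (- nrm j, - lo $ j - off j)) ` (- {i})
     \<union> {if q = 1 then ((0, -1), - fb_ylo D) else ((0, 1), fb_yhi D)}"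

text \<open>Scaled so that the inner product with it is \<nu> up to an additive constant.\<close>

definition along where "along = ((0, q / (fb_yhi D - fb_ylo D)) :: (real^'n) \<times> real)"

definition \<alpha> where "\<alpha> z = a * norm_a D i z"
definition \<nu> where "\<nu> z = (if q = 1 then norm_y D z else 1 - norm_y D z)"
definition bb where "bb = norm_b D i \<beta>"

lemma nrm_inner: "nrm j \<bullet> z = loc z $ j + off j"
  by (simp add: nrm_def off_def loc_inner)

lemma vel_inner: "vel z j = nrm j \<bullet> X z"
  by (simp add: vel_def nrm_def inner_prod_def)

lemma slow_velocity: "z \<in> block_set D \<Longrightarrow> 0 < q * snd (X z)"
proof -
  assume "z \<in> block_set D"
  then have "0 < q * g (fst z, snd z, \<epsilon>)" using slow unfolding M_facts(7) by (cases z) auto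
  with \<epsilon>(1) have "0 < \<epsilon> * (q * g (fst z, snd z, \<epsilon>))" by (rule mult_pos_pos)
  also have "\<dots> = q * snd (X z)" by (simp add: fast_slow_field_def case_prod_beta)
  finally show ?thesis .
qed

lemma slow_inner: "((0 :: real^'n), y) \<bullet> z = y * snd z"
  by (simp add: inner_prod_def)

lemma block_eq: "block_set D = {z. \<forall>(u, r) \<in> in_faces \<union> out_faces. u \<bullet> z \<le> r}"
proof (rule equalityI; rule subsetI)
  fix z assume z: "z \<in> block_set D"
  then show "z \<in> {z. \<forall>(u, r) \<in> in_faces \<union> out_faces. u \<bullet> z \<le> r}"
    by (auto simp: block_set_iff in_faces_def out_faces_def nrm_inner slow_inner)
next
  fix z assume "z \<in> {z. \<forall>(u, r) \<in> in_faces \<union> out_faces. u \<bullet> z \<le> r}"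
  then have z: "u \<bullet> z \<le> r" if "(u, r) \<in> in_faces \<union> out_faces" for u r using that by blast
  have slow_faces: "((0, 1), fb_yhi D) \<in> in_faces \<union> out_faces" "((0, -1), - fb_ylo D) \<in> in_faces \<union> out_faces"
    by (auto simp: in_faces_def out_faces_def)
  have "lo $ j \<le> loc z $ j \<and> loc z $ j \<le> hi $ j" for j
    using z [of "nrm j" "hi $ j + off j"] z [of "- nrm j" "- lo $ j - off j"]
    by (cases "j = i") (auto simp: in_faces_def out_faces_def nrm_inner)
  moreover have "fb_ylo D \<le> snd z \<and> snd z \<le> fb_yhi D"
    using z [OF slow_faces(1)] z [OF slow_faces(2)] by (simp add: slow_inner)
  ultimately show "z \<in> block_set D" by (simp add: block_set_iff)
qed

sublocale polytope: isolating_polytope X in_faces out_faces along "block_set D"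
proof
  show "finite in_faces" "finite out_faces" by (simp_all add: in_faces_def out_faces_def)
  show "block_set D = {z. \<forall>(u, r) \<in> in_faces \<union> out_faces. u \<bullet> z \<le> r}" by (rule block_eq)
  show "compact (block_set D)" using M_facts(6,7) by (simp add: is_hset_def)
  show "block_set D \<noteq> {}" by (rule block_nonempty)
  show "\<exists>L. L-lipschitz_on (cball 0 R) X" for R by (rule lip)
  fix z assume z: "z \<in> block_set D"
  have sv: "0 < q * snd (X z)" by (rule slow_velocity [OF z])
  have vi: "nrm i \<bullet> z = hi $ i + off i \<Longrightarrow> 0 < nrm i \<bullet> X z" "nrm i \<bullet> z = lo $ i + off i \<Longrightarrow> nrm i \<bullet> X z < 0"
    and vj: "j \<noteq> i \<Longrightarrow> nrm j \<bullet> z = hi $ j + off j \<Longrightarrow> nrm j \<bullet> X z < 0"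
      "j \<noteq> i \<Longrightarrow> nrm j \<bullet> z = lo $ j + off j \<Longrightarrow> 0 < nrm j \<bullet> X z" for j
    using velocity_signs [OF z] unfolding vel_inner nrm_inner by simp_all
  show "u \<bullet> X z < 0" if u: "(u, r) \<in> in_faces" "u \<bullet> z = r" for u r
  proof -
    consider j where "j \<noteq> i" "u = nrm j" "r = hi $ j + off j" | j where "j \<noteq> i" "u = - nrm j" "r = - lo $ j - off j"
      | "q = 1" "u = (0, -1)" | "q \<noteq> 1" "u = (0, 1)"
      using u(1) by (auto simp: in_faces_def split: if_splits)
    then show ?thesis
    proof cases
      case (1 j)
      then show ?thesis using vj(1) [of j] u(2) by simp
    next
      case (2 j)
      then show ?thesis using vj(2) [of j] u(2) by simp
    qed (use sv q in \<open>auto simp: slow_inner\<close>)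
  qed
  show "0 < u \<bullet> X z" if u: "(u, r) \<in> out_faces" "u \<bullet> z = r" for u r
  proof -
    consider "u = nrm i" "r = hi $ i + off i" | "u = - nrm i" "r = - lo $ i - off i"
      | "q = 1" "u = (0, 1)" | "q \<noteq> 1" "u = (0, -1)"
      using u(1) by (auto simp: out_faces_def split: if_splits)
    then show ?thesis
    proof cases
      case 1
      then show ?thesis using vi(1) u(2) by simp
    next
      case 2
      then show ?thesis using vi(2) u(2) by simp
    qed (use sv q in \<open>auto simp: slow_inner\<close>)
  qed
  show "0 < along \<bullet> X z" using sv ylo_yhi by (simp add: along_def slow_inner)
qed

end

context fast_slow_block begin

subsection \<open>The block as a chart\<close>

text \<open>An involution, so it serves both for passing from \<open>norm_y\<close> to \<nu> and
  back.\<close>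

definition flip :: "real \<Rightarrow> real" where "flip y = (if q = 1 then y else 1 - y)"

lemma flip_flip [simp]: "flip (flip y) = y"
  by (simp add: flip_def)

lemma \<nu>_flip: "\<nu> z = flip (norm_y D z)"
  by (simp add: \<nu>_def flip_def)

lemma flip_unit: "0 \<le> flip y \<and> flip y \<le> 1 \<longleftrightarrow> 0 \<le> y \<and> y \<le> 1"
  by (auto simp: flip_def)

lemma a_cases: "a = 1 \<or> a = -1" and a_sq [simp]: "a * (a * x) = x"
  using a by auto

lemma norm_a_eq: "norm_a D i z = (2 * loc z $ i - lo $ i - hi $ i) / (hi $ i - lo $ i)"
  by (simp add: norm_a_def loc_def)

lemma \<alpha>_faces: "\<bar>\<alpha> z\<bar> = 1 \<longleftrightarrow> loc z $ i = hi $ i \<or> loc z $ i = lo $ i"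
    "\<bar>\<alpha> z\<bar> \<le> 1 \<longleftrightarrow> lo $ i \<le> loc z $ i \<and> loc z $ i \<le> hi $ i"
proof -
  have "\<bar>\<alpha> z\<bar> = \<bar>norm_a D i z\<bar>" using a_cases by (auto simp: \<alpha>_def)
  then show "\<bar>\<alpha> z\<bar> = 1 \<longleftrightarrow> loc z $ i = hi $ i \<or> loc z $ i = lo $ i"
    "\<bar>\<alpha> z\<bar> \<le> 1 \<longleftrightarrow> lo $ i \<le> loc z $ i \<and> loc z $ i \<le> hi $ i"
    using lo_hi [of i] by (auto simp: norm_a_eq abs_if field_simps)
qed

lemma norm_y_faces: "norm_y D z = 0 \<longleftrightarrow> snd z = fb_ylo D" "norm_y D z = 1 \<longleftrightarrow> snd z = fb_yhi D"
    "0 \<le> norm_y D z \<longleftrightarrow> fb_ylo D \<le> snd z" "norm_y D z \<le> 1 \<longleftrightarrow> snd z \<le> fb_yhi D"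
  using ylo_yhi by (auto simp: norm_y_def field_simps)

lemma along_\<nu>: "along \<bullet> z - along \<bullet> z' = \<nu> z - \<nu> z'"
proof -
  have "along \<bullet> z - along \<bullet> z' = q * (norm_y D z - norm_y D z')"
    using ylo_yhi by (simp add: along_def slow_inner norm_y_def diff_divide_distrib [symmetric] right_diff_distrib [symmetric])
  then show ?thesis using q by (auto simp: \<nu>_def)
qed

lemma exits_iff: "z \<in> polytope.exits \<longleftrightarrow> z \<in> block_set D \<and> (\<bar>\<alpha> z\<bar> = 1 \<or> \<nu> z = 1)"
  unfolding polytope.exits_def unfolding out_faces_def
  using q by (auto simp: nrm_inner slow_inner \<alpha>_faces \<nu>_def norm_y_faces)

lemma entrance_iff:
  "z \<in> polytope.ents \<longleftrightarrow> z \<in> block_set D \<and> ((\<exists>j. j \<noteq> i \<and> (loc z $ j = hi $ j \<or> loc z $ j = lo $ j)) \<or> \<nu> z = 0)"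
  unfolding polytope.ents_def unfolding in_faces_def
  using q by (auto simp: nrm_inner slow_inner \<nu>_def norm_y_faces bex_Un)

section \<open>The box of stable coordinates and its faces\<close>

definition hplane :: "(real^'n) set" where "hplane = {b. b $ i = 0}"
definition bbox where "bbox = {b. b $ i = 0 \<and> (\<forall>j. j \<noteq> i \<longrightarrow> lo $ j \<le> b $ j \<and> b $ j \<le> hi $ j)}"
definition obox where "obox = {b. b $ i = 0 \<and> (\<forall>j. j \<noteq> i \<longrightarrow> lo $ j < b $ j \<and> b $ j < hi $ j)}"

text \<open>\<beta> is only known to carry the box onto the closed ball; through relative interiors
  the faces of the box are then identified with the sphere.\<close>

lemma interior_bbox: "top_of_set hplane interior_of bbox = obox"
proof (rule equalityI; rule subsetI)
  fix b assume "b \<in> top_of_set hplane interior_of bbox"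
  then obtain T where T: "openin (top_of_set hplane) T" "b \<in> T" "T \<subseteq> bbox" by (auto simp: interior_of_def)
  then obtain e where e: "0 < e" "ball b e \<inter> hplane \<subseteq> T" unfolding openin_contains_ball by blast
  have b: "b \<in> bbox" using T by blast
  have near: "b + t *\<^sub>R axis j 1 \<in> bbox" if "j \<noteq> i" "\<bar>t\<bar> < e" for t j
  proof -
    have "dist b (b + t *\<^sub>R axis j 1) = \<bar>t\<bar>" by (simp add: dist_norm)
    then have "b + t *\<^sub>R axis j 1 \<in> ball b e" using that by simp
    moreover have "b + t *\<^sub>R axis j 1 \<in> hplane" using b that by (simp add: hplane_def bbox_def axis_def)
    ultimately show ?thesis using e T by blast
  qed
  have "lo $ j < b $ j \<and> b $ j < hi $ j" if "j \<noteq> i" for j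
    using near [OF that, of "e/2"] near [OF that, of "- e/2"] e that by (auto simp: bbox_def axis_def dest!: spec [of _ j])
  then show "b \<in> obox" using b by (simp add: bbox_def obox_def)
next
  fix b assume b: "b \<in> obox"
  have "open {b. lo $ j < b $ j \<and> b $ j < hi $ j}" for j
    by (intro open_Collect_conj open_Collect_less continuous_intros)
  then have "open (\<Inter>j\<in>- {i}. {b. lo $ j < b $ j \<and> b $ j < hi $ j})" by (intro open_INT) auto
  then have "openin (top_of_set hplane) (hplane \<inter> (\<Inter>j\<in>- {i}. {b. lo $ j < b $ j \<and> b $ j < hi $ j}))"
    by (rule openin_open_Int)
  moreover have "hplane \<inter> (\<Inter>j\<in>- {i}. {b. lo $ j < b $ j \<and> b $ j < hi $ j}) = obox"
    by (auto simp: hplane_def obox_def)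
  ultimately have "openin (top_of_set hplane) obox" by simp
  moreover have "obox \<subseteq> bbox" by (force simp: obox_def bbox_def)
  ultimately show "b \<in> top_of_set hplane interior_of bbox" using b by (auto simp: interior_of_def)
qed

lemma \<beta>_facts:
  "homeomorphic_map (top_of_set hplane) (Euclidean_space s) \<beta>" "\<beta> ` bbox = unit_cball s"
  "inj_on \<beta> hplane" "\<beta> ` obox = unit_cball s - unit_sphere s"
proof -
  show h: "homeomorphic_map (top_of_set hplane) (Euclidean_space s) \<beta>" "\<beta> ` bbox = unit_cball s"
    using M_facts(2,3) by (simp_all add: hplane_def bbox_def)
  show "inj_on \<beta> hplane" using homeomorphic_imp_injective_map [OF h(1)] by simp
  have "bbox \<subseteq> topspace (top_of_set hplane)" by (auto simp: bbox_def hplane_def)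
  from homeomorphic_map_interior_of [OF h(1) this]
  show "\<beta> ` obox = unit_cball s - unit_sphere s" by (simp add: h(2) interior_bbox open_ball_interior)
qed

lemma \<beta>_mem:
  assumes "b \<in> hplane"
  shows "\<beta> b \<in> unit_cball s \<longleftrightarrow> b \<in> bbox" "\<beta> b \<in> unit_cball s - unit_sphere s \<longleftrightarrow> b \<in> obox"
proof -
  have sub: "bbox \<subseteq> hplane" "obox \<subseteq> hplane" by (auto simp: hplane_def bbox_def obox_def)
  show "\<beta> b \<in> unit_cball s \<longleftrightarrow> b \<in> bbox"
    unfolding \<beta>_facts(2) [symmetric] by (rule inj_on_image_mem_iff [OF \<beta>_facts(3) assms sub(1)])
  show "\<beta> b \<in> unit_cball s - unit_sphere s \<longleftrightarrow> b \<in> obox"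
    unfolding \<beta>_facts(4) [symmetric] by (rule inj_on_image_mem_iff [OF \<beta>_facts(3) assms sub(2)])
qed

definition proj where "proj z = coord_proj (- {i}) (loc z)"

lemma proj_nth [simp]: "proj z $ j = (if j = i then 0 else loc z $ j)"
  by (simp add: proj_def coord_proj_def)

lemma proj_hplane: "proj z \<in> hplane"
  by (simp add: hplane_def)

lemma bb_proj: "bb z = \<beta> (proj z)"
  by (simp add: bb_def norm_b_def proj_def loc_def)

lemma bb_mem: "bb z \<in> unit_cball s \<longleftrightarrow> (\<forall>j. j \<noteq> i \<longrightarrow> lo $ j \<le> loc z $ j \<and> loc z $ j \<le> hi $ j)"
    "bb z \<in> unit_cball s - unit_sphere s \<longleftrightarrow> (\<forall>j. j \<noteq> i \<longrightarrow> lo $ j < loc z $ j \<and> loc z $ j < hi $ j)"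
  unfolding bb_proj \<beta>_mem [OF proj_hplane] by (auto simp: bbox_def obox_def)

lemma bb_sphere: "z \<in> block_set D \<Longrightarrow> bb z \<in> unit_sphere s \<longleftrightarrow> (\<exists>j. j \<noteq> i \<and> (loc z $ j = hi $ j \<or> loc z $ j = lo $ j))"
  using bb_mem [of z] block_set_iff [of z] by (auto simp: order_less_le)

lemma entrance_bb: "z \<in> polytope.ents \<longleftrightarrow> z \<in> block_set D \<and> (bb z \<in> unit_sphere s \<or> \<nu> z = 0)"
  using bb_sphere entrance_iff by blast

lemma block_set_coords: "block_set D = {z. \<bar>\<alpha> z\<bar> \<le> 1 \<and> bb z \<in> unit_cball s \<and> 0 \<le> \<nu> z \<and> \<nu> z \<le> 1}"
  unfolding \<nu>_flip flip_unit \<alpha>_faces bb_mem norm_y_faces using block_set_iff by (auto, metis+)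

lemma continuous_proj: "continuous_on S proj"
proof -
  have "continuous_on S (\<lambda>z. loc z - (loc z $ i) *\<^sub>R axis i 1)"
    by (intro continuous_intros continuous_loc)
  also have "(\<lambda>z. loc z - (loc z $ i) *\<^sub>R axis i 1) = proj"
    by (auto simp: fun_eq_iff vec_eq_iff axis_def)
  finally show ?thesis .
qed

definition chart_inv where
  "chart_inv \<beta>i x b y =
     (from_local D (\<beta>i b + ((a * x * (hi $ i - lo $ i) + lo $ i + hi $ i) / 2) *\<^sub>R axis i 1),
      fb_ylo D + flip y * (fb_yhi D - fb_ylo D))"

text \<open>Reversing \<nu> is undone by composing \<theta> with \<open>flip\<close>, so the
  coordinates of \<open>M\<close> keep their form for either sign of \<open>q\<close>; likewise the
  square of \<open>a\<close> being 1 undoes the orientation of \<alpha>.\<close>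

lemma is_block_chart:
  assumes \<beta>i: "homeomorphic_maps (top_of_set hplane) (Euclidean_space s) \<beta> \<beta>i"
    and \<theta>i: "homeomorphic_maps (prod_topology (Euclidean_space s) euclideanreal) (Euclidean_space (Suc s)) \<theta> \<theta>i"
  shows "block_chart \<alpha> \<nu> bb (chart_inv \<beta>i) s (\<lambda>p. \<theta> (fst p, flip (snd p))) (\<lambda>w. (fst (\<theta>i w), flip (snd (\<theta>i w))))"
proof
  have c\<beta>: "continuous_map (top_of_set hplane) (Euclidean_space s) \<beta>"
    and c\<beta>i: "continuous_map (Euclidean_space s) (top_of_set hplane) \<beta>i"
    and \<beta>i_\<beta>: "\<And>b. b \<in> hplane \<Longrightarrow> \<beta>i (\<beta> b) = b" and \<beta>_\<beta>i: "\<And>x. x \<in> topspace (Euclidean_space s) \<Longrightarrow> \<beta> (\<beta>i x) = x"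
    using \<beta>i by (auto simp: homeomorphic_maps_def)
  have \<beta>i_hplane: "\<beta>i x \<in> hplane" if "x \<in> topspace (Euclidean_space s)" for x
    using c\<beta>i that by (auto simp: continuous_map_def)
  have cont_norms: "continuous_on UNIV (norm_a D i)" "continuous_on UNIV (norm_y D)"
    unfolding norm_a_eq [abs_def] norm_y_def [abs_def]
    using lo_hi [of i] ylo_yhi by (auto intro!: continuous_intros continuous_loc)
  then show "continuous_on UNIV \<alpha>" "continuous_on UNIV \<nu>"
    unfolding \<alpha>_def \<nu>_flip flip_def by (cases "q = 1"; auto intro!: continuous_intros)+
  have "continuous_map euclidean (top_of_set hplane) proj"
    using continuous_proj [of UNIV] by (simp add: continuous_map_in_subtopology proj_hplane image_subset_iff Pi_iff)
  from continuous_map_compose [OF this c\<beta>] show "continuous_map euclidean (Euclidean_space s) bb"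
    by (simp add: o_def bb_proj [abs_def])
  show "chart_inv \<beta>i (\<alpha> z) (bb z) (\<nu> z) = z" for z
  proof -
    have "(a * \<alpha> z * (hi $ i - lo $ i) + lo $ i + hi $ i) / 2 = loc z $ i"
      using lo_hi [of i] by (simp add: \<alpha>_def norm_a_eq mult.assoc field_simps)
    moreover have "proj z + (loc z $ i) *\<^sub>R axis i 1 = loc z" by (simp add: vec_eq_iff axis_def)
    moreover have "fb_ylo D + norm_y D z * (fb_yhi D - fb_ylo D) = snd z"
      using ylo_yhi by (simp add: norm_y_def)
    ultimately show ?thesis
      by (simp add: chart_inv_def \<nu>_flip bb_proj \<beta>i_\<beta> proj_hplane loc_inv loc_def)
  qed
  fix b assume b: "b \<in> topspace (Euclidean_space s)"
  have b0: "\<beta>i b $ i = 0" using \<beta>i_hplane [OF b] by (simp add: hplane_def)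
  show "\<alpha> (chart_inv \<beta>i x b y) = x" for x y
  proof -
    have half: "2 * c - l - h = p" if "c = (p + l + h) / 2" for c p l h :: real using that by simp
    have "loc (chart_inv \<beta>i x b y) $ i = (a * x * (hi $ i - lo $ i) + lo $ i + hi $ i) / 2"
      using b0 by (simp add: loc_def chart_inv_def loc_inv)
    from half [OF this]
    have "norm_a D i (chart_inv \<beta>i x b y) = a * x * (hi $ i - lo $ i) / (hi $ i - lo $ i)"
      by (simp only: norm_a_eq)
    also have "\<dots> = a * x" using lo_hi [of i] by (intro nonzero_mult_div_cancel_right) simp
    finally show ?thesis by (simp add: \<alpha>_def)
  qed
  show "\<nu> (chart_inv \<beta>i x b y) = y" for x y
    using ylo_yhi by (simp add: \<nu>_flip norm_y_def chart_inv_def)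
  have "proj (chart_inv \<beta>i x b y) = \<beta>i b" for x y
    using b0 by (simp add: vec_eq_iff loc_def chart_inv_def loc_inv axis_def)
  then show "bb (chart_inv \<beta>i x b y) = b" for x y by (simp add: bb_proj \<beta>_\<beta>i b)
next
  let ?T = "prod_topology euclideanreal (prod_topology (Euclidean_space s) euclideanreal)"
  have c1: "continuous_map ?T euclideanreal (\<lambda>p. fst p)" by (rule continuous_map_fst)
  have "continuous_map ?T (prod_topology (Euclidean_space s) euclideanreal) snd" by (rule continuous_map_snd)
  then have c2: "continuous_map ?T (Euclidean_space s) (\<lambda>p. fst (snd p))" and c3: "continuous_map ?T euclideanreal (\<lambda>p. snd (snd p))"
    by (simp_all add: continuous_map_pairwise o_def)
  have "continuous_map (Euclidean_space s) euclidean \<beta>i"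
    using \<beta>i continuous_map_into_fulltopology by (auto simp: homeomorphic_maps_def)
  from continuous_map_compose [OF c2 this] have c\<beta>i: "continuous_map ?T euclidean (\<lambda>p. \<beta>i (fst (snd p)))"
    by (simp add: o_def)
  have into: "continuous_map ?T euclidean (\<lambda>p. h (f p))" if "continuous_on UNIV h" "continuous_map ?T euclidean f"
    for h :: "'b::topological_space \<Rightarrow> 'c::topological_space" and f
    using continuous_map_compose [OF that(2), of euclidean h] that(1) by (simp add: o_def)
  define l1 where "l1 c = (from_local D c, 0 :: real)" for c
  define l2 where "l2 x = ((a * x * (hi $ i - lo $ i) + lo $ i + hi $ i) / 2) *\<^sub>R (axis i 1 :: real^'n)" for x
  define l3 where "l3 y = (0 :: real^'n, fb_ylo D + flip y * (fb_yhi D - fb_ylo D))" for y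
  have l1: "continuous_on UNIV l1"
    unfolding l1_def from_local_def
    by (intro continuous_intros matrix_vector_mult_linear_continuous_on)
  have l2: "continuous_on UNIV l2" unfolding l2_def by (intro continuous_intros) auto
  have l3: "continuous_on UNIV l3"
    unfolding l3_def flip_def by (cases "q = 1") (auto intro!: continuous_intros)
  have "continuous_map ?T euclidean (\<lambda>p. l1 (\<beta>i (fst (snd p)) + l2 (fst p)) + l3 (snd (snd p)))"
    by (rule continuous_map_add [OF into [OF l1 continuous_map_add [OF c\<beta>i into [OF l2 c1]]] into [OF l3 c3]])
  then show "continuous_map ?T euclidean (\<lambda>(x, b, y). chart_inv \<beta>i x b y)"
    by (simp add: chart_inv_def l1_def l2_def l3_def case_prod_beta')
next
  let ?Y = "prod_topology (Euclidean_space s) euclideanreal"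
  have c: "continuous_map ?Y (Euclidean_space s) fst" "continuous_map ?Y euclideanreal snd"
    by (auto intro: continuous_map_fst continuous_map_snd)
  have cflip: "continuous_map ?Y ?Y (\<lambda>p. (fst p, flip (snd p)))"
    unfolding continuous_map_pairwise o_def fst_conv snd_conv flip_def
    using c by (cases "q = 1") (auto intro!: continuous_map_diff)
  then have "homeomorphic_maps ?Y ?Y (\<lambda>p. (fst p, flip (snd p))) (\<lambda>p. (fst p, flip (snd p)))"
    by (simp add: homeomorphic_maps_def)
  from homeomorphic_maps_compose [OF conjI [OF this \<theta>i]]
  show "homeomorphic_maps ?Y (Euclidean_space (Suc s)) (\<lambda>p. \<theta> (fst p, flip (snd p))) (\<lambda>w. (fst (\<theta>i w), flip (snd (\<theta>i w))))"
    by (simp add: o_def)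
  have "(\<lambda>p. (fst p, flip (snd p))) ` (unit_cball s \<times> {0..1}) = unit_cball s \<times> {0..1}"
  proof (rule equalityI; rule subsetI)
    fix p :: "(nat \<Rightarrow> real) \<times> real" assume "p \<in> unit_cball s \<times> {0..1}"
    then have "(fst p, flip (snd p)) \<in> unit_cball s \<times> {0..1}" using flip_unit by (cases p) auto
    moreover have "p = (fst (fst p, flip (snd p)), flip (snd (fst p, flip (snd p))))" by simp
    ultimately show "p \<in> (\<lambda>p. (fst p, flip (snd p))) ` (unit_cball s \<times> {0..1})" by blast
  qed (use flip_unit in auto)
  then have "\<theta> ` (\<lambda>p. (fst p, flip (snd p))) ` (unit_cball s \<times> {0..1}) = unit_cball (Suc s)"
    using M_facts(5) by simp
  then show "(\<lambda>p. \<theta> (fst p, flip (snd p))) ` (unit_cball s \<times> {0..1}) = unit_cball (Suc s)"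
    by (simp add: image_image)
  have "0 < CARD('n)" by (rule zero_less_card_finite)
  then show "DIM((real^'n) \<times> real) = s + 2" by (simp add: s)
qed

text \<open>The polytope results in coordinates: \<open>along\<close> differs from \<nu> by a
  constant, \<open>ents\<close> is where \<open>bb\<close> is on the sphere or \<nu> = 0, and the
  polytope's \<open>P\<close> is the exit map on the block.\<close>

lemma is_exchange:
  assumes "block_chart \<alpha> \<nu> bb G s \<theta>' \<theta>i'"
  shows "exchange \<alpha> \<nu> bb G s \<theta>' \<theta>i' (exit_map X (block_set D))"
proof -
  interpret block_chart \<alpha> \<nu> bb G s \<theta>' \<theta>i' by fact
  have blk: "blk = block_set D" by (simp add: blk_def block_set_coords)
  note P = polytope.exit_map_eq
  have exits: "\<bar>\<alpha> z\<bar> = 1 \<or> \<nu> z = 1 \<longleftrightarrow> z \<in> polytope.exits" if "z \<in> block_set D" for z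
    using that by (simp add: exits_iff)
  have P_in: "polytope.P z \<in> block_set D" if "z \<in> block_set D" for z by (rule polytope.P_in_M [OF that])
  show ?thesis
  proof (unfold_locales; unfold blk)
    show "compact (block_set D)" by (rule polytope.compact_M)
    show "continuous_on (block_set D) (exit_map X (block_set D))"
      using polytope.continuous_P by (simp add: P cong: continuous_on_cong)
    fix z assume z: "z \<in> block_set D"
    show "exit_map X (block_set D) z \<in> block_set D \<and>
        (\<bar>\<alpha> (exit_map X (block_set D) z)\<bar> = 1 \<or> \<nu> (exit_map X (block_set D) z) = 1)"
      using polytope.dwell(3) [OF z] by (simp add: P z exits_iff)
    show "exit_map X (block_set D) z = z" if "\<bar>\<alpha> z\<bar> = 1 \<or> \<nu> z = 1"
      using that polytope.P_exit [of z] by (simp add: P z exits)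
    show "bb (exit_map X (block_set D) z) \<notin> unit_sphere s" if "\<bar>\<alpha> z\<bar> \<noteq> 1" "\<nu> z \<noteq> 1"
      using polytope.P_not_entrance [OF z] that P_in [OF z] by (simp add: P z exits_iff entrance_bb)
    show "\<nu> z \<le> \<nu> (exit_map X (block_set D) z)"
      using polytope.transit_P(1) [OF z] along_\<nu> [of z "polytope.P z"] by (simp add: P z)
    show "exit_map X (block_set D) z = z" if "\<nu> z = \<nu> (exit_map X (block_set D) z)"
      using polytope.transit_P(2) [OF z] along_\<nu> [of z "polytope.P z"] that by (simp add: P z)
  next
    fix K and \<eta> :: real
    assume K: "compact K" "K \<subseteq> block_set D" "\<And>z. z \<in> K \<Longrightarrow> bb z \<notin> unit_sphere s \<and> \<nu> z \<noteq> 0" and "0 < \<eta>"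
    then have sub: "K \<subseteq> block_set D - polytope.ents" by (auto simp: entrance_bb)
    show "\<exists>\<Theta> \<Theta>'. homeomorphism UNIV UNIV \<Theta> \<Theta>' \<and>
          (\<forall>z. z \<notin> block_set D \<or> z \<in> block_set D \<and> (\<bar>\<alpha> z\<bar> = 1 \<or> \<nu> z = 1) \<longrightarrow> \<Theta> z = z) \<and>
          (\<forall>z\<in>block_set D. \<Theta> z \<in> block_set D \<and> exit_map X (block_set D) (\<Theta> z) = exit_map X (block_set D) z) \<and>
          (\<forall>z\<in>block_set D. bb z \<notin> unit_sphere s \<and> \<nu> z \<noteq> 0 \<longrightarrow> bb (\<Theta> z) \<notin> unit_sphere s) \<and>
          (\<forall>z\<in>K. \<nu> (exit_map X (block_set D) z) - \<nu> (\<Theta> z) < \<eta>)"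
    proof (rule polytope.push_towards_exit [OF K(1) sub \<open>0 < \<eta>\<close>])
      fix \<Theta> \<Theta>'
      assume \<Theta>: "homeomorphism UNIV UNIV \<Theta> \<Theta>'"
        "\<And>z. z \<notin> block_set D \<or> z \<in> polytope.exits \<Longrightarrow> \<Theta> z = z"
        "\<And>z. z \<in> block_set D \<Longrightarrow> \<Theta> z \<in> block_set D \<and> polytope.P (\<Theta> z) = polytope.P z"
        "\<And>z. z \<in> block_set D - polytope.ents \<Longrightarrow> \<Theta> z \<notin> polytope.ents"
        "\<And>z. z \<in> K \<Longrightarrow> along \<bullet> polytope.P z - along \<bullet> \<Theta> z < \<eta>"
      show ?thesis
      proof (intro exI conjI allI ballI impI)
        show "homeomorphism UNIV UNIV \<Theta> \<Theta>'" by (rule \<Theta>(1))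
        show "\<Theta> z = z" if "z \<notin> block_set D \<or> z \<in> block_set D \<and> (\<bar>\<alpha> z\<bar> = 1 \<or> \<nu> z = 1)" for z
          using that by (intro \<Theta>(2)) (auto simp: exits_iff)
        show "\<nu> (exit_map X (block_set D) z) - \<nu> (\<Theta> z) < \<eta>" if "z \<in> K" for z
          using \<Theta>(5) [OF that] along_\<nu> [of "polytope.P z" "\<Theta> z"] K(2) that by (auto simp: P)
        fix z assume z: "z \<in> block_set D"
        show "\<Theta> z \<in> block_set D" using \<Theta>(3) [OF z] by blast
        then show "exit_map X (block_set D) (\<Theta> z) = exit_map X (block_set D) z" using \<Theta>(3) [OF z] by (simp add: P z)
        show "bb (\<Theta> z) \<notin> unit_sphere s" if "bb z \<notin> unit_sphere s \<and> \<nu> z \<noteq> 0"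
          using \<Theta>(4) [of z] \<open>\<Theta> z \<in> block_set D\<close> z that by (simp add: entrance_bb)
      qed
    qed
  qed
qed

end

section \<open>Fast-exit faces\<close>

text \<open>A fast-exit face has as unstable coordinate an unspecified function of the slow
  variable. Injectivity and continuity make it monotone; \<tau> records its direction.\<close>

lemma injective_crossing:
  fixes l :: "real \<Rightarrow> real"
  assumes cont: "continuous_on UNIV l" and inj: "inj l" and "c < d"
    and window: "\<And>y. \<bar>l y\<bar> \<le> 1 \<longleftrightarrow> c \<le> y \<and> y \<le> d"
  shows "\<exists>\<tau>\<in>{1, -1}. (\<forall>y<c. \<tau> * l y < -1) \<and> (\<forall>y>d. 1 < \<tau> * l y)"
proof -
  have mono: "l x < l y \<and> l y < l z \<or> l z < l y \<and> l y < l x" if "x < y" "y < z" for x y z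
    using continuous_inj_imp_mono [OF that continuous_on_subset [OF cont]] inj_on_subset [OF inj] that by auto
  have c: "\<bar>l c\<bar> \<le> 1" using window \<open>c < d\<close> by auto
  have out: "\<not> \<bar>l y\<bar> \<le> 1" if "y < c \<or> d < y" for y using window that by auto
  have "(\<forall>y<c. l y < -1) \<and> (\<forall>y>d. 1 < l y) \<or> (\<forall>y<c. 1 < l y) \<and> (\<forall>y>d. l y < -1)"
  \<comment> \<open>The value at one point beyond the window decides the direction; monotonicity
    then settles first the left side, from it the right side.\<close>
  proof (cases "1 < l (d + 1)")
    case True
    have left: "l y < -1" if "y < c" for y
      using mono [of y c "d + 1"] that \<open>c < d\<close> c True out [of y] by (auto simp: abs_le_iff)
    have "1 < l y" if "d < y" for y
      using mono [of "c - 1" c y] that \<open>c < d\<close> c left [of "c - 1"] out [of y] by (auto simp: abs_le_iff)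
    with left show ?thesis by blast
  next
    case False
    then have d1: "l (d + 1) < -1" using out [of "d + 1"] by (auto simp: abs_le_iff)
    have left: "1 < l y" if "y < c" for y
      using mono [of y c "d + 1"] that \<open>c < d\<close> c d1 out [of y] by (auto simp: abs_le_iff)
    have "l y < -1" if "d < y" for y
      using mono [of "c - 1" c y] that \<open>c < d\<close> c left [of "c - 1"] out [of y] by (auto simp: abs_le_iff)
    with left show ?thesis by blast
  qed
  then show ?thesis by (auto intro: bexI [of _ 1] bexI [of _ "-1"])
qed

context fast_slow_block begin

theorem block_exchange_coverings:
  assumes N: "is_hset N" "hs_u N = 1" and cov: "covers F N M" and face: "fast_exit_face D i \<beta> a ym yp E"
    and above: "q = 1 \<longrightarrow> (SUP z\<in>F ` hs_set N \<inter> hs_set M. norm_y D z) < ym"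
    and below: "q = -1 \<longrightarrow> (INF z\<in>F ` hs_set N \<inter> hs_set M. norm_y D z) > yp"
  shows "\<exists>M'. is_hset M' \<and> hs_set M' \<subseteq> hs_set M \<and> covers F N M' \<and> covers (exit_map X (hs_set M)) M' E"
proof -
  obtain \<beta>i where \<beta>i: "homeomorphic_maps (top_of_set hplane) (Euclidean_space s) \<beta> \<beta>i"
    using \<beta>_facts(1) by (auto simp: homeomorphic_map_maps)
  obtain \<theta>i where \<theta>i: "homeomorphic_maps (prod_topology (Euclidean_space s) euclideanreal) (Euclidean_space (Suc s)) \<theta> \<theta>i"
    using M_facts(4) by (auto simp: homeomorphic_map_maps)
  define G where "G = chart_inv \<beta>i"
  note chart = is_block_chart [OF \<beta>i \<theta>i, folded G_def]
  interpret exchange \<alpha> \<nu> bb G s "\<lambda>p. \<theta> (fst p, flip (snd p))" "\<lambda>w. (fst (\<theta>i w), flip (snd (\<theta>i w)))"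
    "exit_map X (block_set D)"
    by (rule is_exchange [OF chart])
  have blk: "blk = block_set D" by (simp add: blk_def block_set_coords)
  have E: "is_hset E" "hs_u E = 1" "hs_s E = s" and y: "0 < ym" "ym < yp" "yp < 1"
    and E_coords: "block_coord D i \<beta> ` hs_set E = {a} \<times> unit_cball s \<times> {ym..yp}"
    using face unfolding fast_exit_face_def s by blast+
  obtain l \<rho> where l\<rho>: "\<And>z. z \<in> hs_space E \<Longrightarrow> hs_coord E z = (line_embed (l (norm_y D z)), \<rho> (bb z))"
    using face unfolding fast_exit_face_def bb_def by blast
  have E_hset: "affine (hs_space E)" "aff_dim (hs_space E) = int (Suc s)" "hs_set E \<subseteq> hs_space E"
    "homeomorphic_map (top_of_set (hs_space E)) (split_space 1 s) (hs_coord E)"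
    "hs_coord E ` hs_set E = unit_cball 1 \<times> unit_cball s"
    using E unfolding is_hset_def hs_model_def by auto
  have inj_E: "inj_on (hs_coord E) (hs_space E)"
    using homeomorphic_imp_injective_map [OF E_hset(4)] by simp
  have y_flip: "norm_y D z = flip (\<nu> z)" for z by (simp add: \<nu>_flip)
  have \<alpha>_1: "\<alpha> z = 1 \<longleftrightarrow> norm_a D i z = a" for z using a_cases by (auto simp: \<alpha>_def)
  have coords_inj: "z = z'" if "norm_a D i z = norm_a D i z'" "bb z = bb z'" "norm_y D z = norm_y D z'" for z z'
    using G_inverse [of z] G_inverse [of z'] that by (simp add: \<alpha>_def \<nu>_flip)
  have E_iff: "z \<in> hs_set E \<longleftrightarrow> \<alpha> z = 1 \<and> bb z \<in> unit_cball s \<and> ym \<le> norm_y D z \<and> norm_y D z \<le> yp" for z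
  proof
    assume "z \<in> hs_set E"
    then have "block_coord D i \<beta> z \<in> {a} \<times> unit_cball s \<times> {ym..yp}" using E_coords by blast
    then show "\<alpha> z = 1 \<and> bb z \<in> unit_cball s \<and> ym \<le> norm_y D z \<and> norm_y D z \<le> yp"
      by (simp add: block_coord_def \<alpha>_1 bb_def)
  next
    assume "\<alpha> z = 1 \<and> bb z \<in> unit_cball s \<and> ym \<le> norm_y D z \<and> norm_y D z \<le> yp"
    then have "block_coord D i \<beta> z \<in> block_coord D i \<beta> ` hs_set E"
      unfolding E_coords by (simp add: block_coord_def \<alpha>_1 bb_def)
    then obtain z' where "z' \<in> hs_set E" "block_coord D i \<beta> z = block_coord D i \<beta> z'" by blast
    moreover from this have "z = z'" by (intro coords_inj) (simp_all add: block_coord_def bb_def)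
    ultimately show "z \<in> hs_set E" by simp
  qed
  \<comment> \<open>Gradient and offset of the affine function \<alpha>, so that the face \<alpha> =
    1 is a hyperplane of known dimension.\<close>
  define w k where "w = (2 * a / (hi $ i - lo $ i)) *\<^sub>R nrm i"
    and "k = a * (2 * off i + lo $ i + hi $ i) / (hi $ i - lo $ i)"
  have \<alpha>_inner: "\<alpha> z = w \<bullet> z - k" for z
  proof -
    have "w \<bullet> z - k = (2 * a * (loc z $ i + off i) - a * (2 * off i + lo $ i + hi $ i)) / (hi $ i - lo $ i)"
      by (simp add: w_def k_def nrm_inner diff_divide_distrib)
    also have "\<dots> = \<alpha> z" by (simp add: \<alpha>_def norm_a_eq algebra_simps)
    finally show ?thesis ..
  qed
  define b0 :: "nat \<Rightarrow> real" where "b0 = (\<lambda>_. 0)"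
  have b0: "b0 \<in> unit_cball s - unit_sphere s" "b0 \<in> topspace (Euclidean_space s)"
    by (simp_all add: b0_def unit_cball_def unit_sphere_def topspace_Euclidean_space)
  define face_pt where "face_pt b y = G 1 b (flip y)" for b y
  have face_pt: "\<alpha> (face_pt b y) = 1" "bb (face_pt b y) = b" "norm_y D (face_pt b y) = y"
    if "b \<in> topspace (Euclidean_space s)" for b y
    using that by (simp_all add: face_pt_def \<alpha>_G bb_G y_flip \<nu>_G)
  have "w \<noteq> 0"
    using \<alpha>_inner \<alpha>_G [OF b0(2), of 0 0] \<alpha>_G [OF b0(2), of 1 0] by auto
  have hyper: "{z. \<alpha> z = 1} = {z. w \<bullet> z = 1 + k}" by (auto simp: \<alpha>_inner)
  define ymid where "ymid = (ym + yp) / 2"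
  have ymid: "ym < ymid" "ymid < yp" using y by (simp_all add: ymid_def)
  define U where "U = {z. bb z \<in> unit_cball s - unit_sphere s \<and> ym < norm_y D z \<and> norm_y D z < yp}"
  have "open U"
  proof -
    have "openin euclidean {z \<in> topspace euclidean. bb z \<in> unit_cball s - unit_sphere s}"
      by (rule openin_continuous_map_preimage [OF cont_bb])
        (simp add: open_ball_interior [symmetric])
    then have "open {z. bb z \<in> unit_cball s - unit_sphere s}" by simp
    moreover have "continuous_on UNIV (norm_y D)"
      unfolding norm_y_def [abs_def] using ylo_yhi by (auto intro!: continuous_intros)
    then have "open {z. ym < norm_y D z}" "open {z. norm_y D z < yp}"
      by (auto intro!: open_Collect_less)
    ultimately show ?thesis unfolding U_def by (intro open_Collect_conj)
  qed
  have U_E: "z \<in> hs_set E" if "z \<in> U" "\<alpha> z = 1" for z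
    using that by (auto simp: E_iff U_def)
  \<comment> \<open>\<open>hs_space E\<close> is an unspecified affine space around the face. A
    relatively interior point \<open>z0\<close> of the face forces the whole hyperplane \<alpha> = 1
    into it, and equal dimensions give equality.\<close>
  have space_E: "hs_space E = {z. \<alpha> z = 1}"
  proof -
    define z0 where "z0 = face_pt b0 ymid"
    have z0: "z0 \<in> U" "\<alpha> z0 = 1" using ymid b0 by (simp_all add: z0_def U_def face_pt)
    obtain e where e: "0 < e" "ball z0 e \<subseteq> U" using \<open>open U\<close> z0(1) open_contains_ball by blast
    have "{z. \<alpha> z = 1} \<subseteq> hs_space E"
    proof
      fix z assume "z \<in> {z. \<alpha> z = 1}"
      then have z: "\<alpha> z = 1" by simp
      \<comment> \<open>Small enough that shrinking \<open>z\<close> towards \<open>z0\<close> by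
        the factor \<open>t\<close> gives a point of \<open>E\<close>; then \<open>z\<close> is an
        affine combination of that point and \<open>z0\<close>.\<close>
      define t where "t = e / (2 * (1 + norm (z - z0)))"
      have t: "0 < t" "t * norm (z - z0) < e"
      proof -
        show "0 < t" using e by (simp add: t_def add_pos_nonneg)
        have "e * norm (z - z0) < e * (2 * (1 + norm (z - z0)))"
        proof (rule mult_strict_left_mono [OF _ e(1)])
          show "norm (z - z0) < 2 * (1 + norm (z - z0))" using norm_ge_zero [of "z - z0"] by argo
        qed
        then show "t * norm (z - z0) < e" by (simp add: t_def divide_less_eq add_pos_nonneg)
      qed
      define zt where "zt = z0 + t *\<^sub>R (z - z0)"
      have "dist z0 zt < e" using t by (simp add: zt_def dist_norm)
      then have "zt \<in> U" using e(2) by auto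
      moreover have "\<alpha> zt = 1"
      proof -
        have "w \<bullet> z = w \<bullet> z0" using z z0(2) by (simp add: \<alpha>_inner)
        then show ?thesis using z0(2) by (simp add: zt_def \<alpha>_inner inner_add_right inner_diff_right)
      qed
      ultimately have "zt \<in> hs_space E" "z0 \<in> hs_space E" using U_E z0 E_hset(3) by blast+
      then have "(1 - 1 / t) *\<^sub>R z0 + (1 / t) *\<^sub>R zt \<in> hs_space E"
        by (intro mem_affine [OF E_hset(1)]) auto
      also have "(1 - 1 / t) *\<^sub>R z0 + (1 / t) *\<^sub>R zt = z"
        using t by (simp add: zt_def scaleR_add_right scaleR_diff_left)
      finally show "z \<in> hs_space E" .
    qed
    moreover have "affine {z. \<alpha> z = 1}" unfolding hyper by (rule affine_hyperplane)
    moreover have "{z. \<alpha> z = 1} \<noteq> {}" using z0(2) by blast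
    moreover have "aff_dim {z. \<alpha> z = 1} = aff_dim (hs_space E)"
      using aff_dim_hyperplane [OF \<open>w \<noteq> 0\<close>] dim unfolding hyper E_hset(2) by simp
    ultimately show ?thesis using affine_dim_equal E_hset(1) by metis
  qed
  \<comment> \<open>The coordinate map is open, so it sends the relative interior of the face into
    the interior of the model. The stable coordinate depends on \<open>bb\<close> alone, so
    \<open>z\<close> may first be moved to the slow height \<open>ymid\<close>; hence its own slow
    height is unrestricted.\<close>
  have E_stable: "snd (hs_coord E z) \<in> unit_cball (hs_s E) - unit_sphere (hs_s E)"
    if z: "\<alpha> z = 1" "bb z \<in> unit_cball s - unit_sphere s" for z
  proof -
    let ?S = "hs_space E \<inter> U"
    have "openin (top_of_set (hs_space E)) ?S" using \<open>open U\<close> by (rule openin_open_Int)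
    then have "openin (split_space 1 s) (hs_coord E ` ?S)"
      using homeomorphic_map_openness_eq [OF E_hset(4)] by blast
    moreover have "hs_coord E ` ?S \<subseteq> unit_cball 1 \<times> unit_cball s"
      using E_hset(5) U_E space_E by blast
    ultimately have "hs_coord E ` ?S \<subseteq> split_space 1 s interior_of (unit_cball 1 \<times> unit_cball s)"
      by (rule interior_of_maximal [rotated])
    then have sub: "hs_coord E ` ?S \<subseteq> (unit_cball 1 - unit_sphere 1) \<times> (unit_cball s - unit_sphere s)"
      by (simp only: interior_of_Times open_ball_interior)
    define z' where "z' = face_pt (bb z) ymid"
    have z': "z' \<in> ?S" using z ymid by (simp add: z'_def U_def face_pt bb_space space_E)
    have "snd (hs_coord E z') \<in> unit_cball s - unit_sphere s"
      using subsetD [OF sub imageI [OF z']] by (simp only: mem_Times_iff)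
    moreover have "snd (hs_coord E z') = snd (hs_coord E z)"
      using l\<rho> [of z] l\<rho> [of z'] z z' by (simp add: space_E z'_def face_pt bb_space)
    ultimately show ?thesis by (simp add: E)
  qed
  \<comment> \<open>The unstable coordinate is examined along the slow line over \<open>b0\<close>
    in the hyperplane of the face.\<close>
  have "\<exists>\<tau>\<in>{1, -1}. (\<forall>y<ym. \<tau> * l y < -1) \<and> (\<forall>y>yp. 1 < \<tau> * l y)"
  proof (rule injective_crossing)
    define p where "p y = face_pt b0 y" for y
    have p: "p y \<in> hs_space E" "norm_y D (p y) = y" "bb (p y) = b0" for y
      by (simp_all add: p_def space_E face_pt b0)
    have p_coord: "hs_coord E (p y) = (line_embed (l y), \<rho> b0)" for y
      using l\<rho> [OF p(1)] by (simp add: p)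
    have "continuous_map euclideanreal euclidean p"
      unfolding p_def face_pt_def flip_def using b0(2)
      by (intro continuous_map_into_chart) (cases "q = 1"; auto intro!: continuous_intros)+
    then have "continuous_map euclideanreal (top_of_set (hs_space E)) p"
      using p(1) by (auto simp: continuous_map_in_subtopology)
    from continuous_map_compose [OF this homeomorphic_imp_continuous_map [OF E_hset(4)]]
    have "continuous_map euclideanreal (Euclidean_space 1) (\<lambda>y. line_embed (l y))"
      by (simp add: o_def p_coord continuous_map_pairwise)
    from continuous_map_Euclidean_space_coordinate [OF this, of 0] show "continuous_on UNIV l" by simp
    show "inj l"
    proof (rule injI)
      fix y y' assume "l y = l y'"
      then have "hs_coord E (p y) = hs_coord E (p y')" by (simp add: p_coord)
      then have "p y = p y'" using inj_onD [OF inj_E] p(1) by blast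
      then show "y = y'" using p(2) by metis
    qed
    show "ym < yp" by fact
    fix y
    have "\<rho> b0 \<in> unit_cball s" using E_stable [of "p y"] p b0 p_coord [of y] by (simp add: E space_E)
    then have "\<bar>l y\<bar> \<le> 1 \<longleftrightarrow> hs_coord E (p y) \<in> hs_coord E ` hs_set E"
      using unit_cball_1 [of "line_embed (l y)"] unfolding E_hset(5) p_coord by simp
    also have "\<dots> \<longleftrightarrow> p y \<in> hs_set E"
      by (rule inj_on_image_mem_iff [OF inj_E p(1) E_hset(3)])
    also have "\<dots> \<longleftrightarrow> ym \<le> y \<and> y \<le> yp"
      using b0 by (simp add: E_iff p_def face_pt)
    finally show "\<bar>l y\<bar> \<le> 1 \<longleftrightarrow> ym \<le> y \<and> y \<le> yp" .
  qed
  then obtain \<tau> where \<tau>: "\<tau> \<in> {1, -1}" "\<And>y. y < ym \<Longrightarrow> \<tau> * l y < -1" "\<And>y. yp < y \<Longrightarrow> 1 < \<tau> * l y" by blast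
  have coord_0: "fst (hs_coord E z) 0 = l (norm_y D z)" if "\<alpha> z = 1" for z
    using l\<rho> [of z] that by (simp add: space_E)
  have M_space: "hs_space M = UNIV"
  proof -
    have "affine (hs_space M)" "aff_dim (hs_space M) = DIM((real^'n) \<times> real)"
      using M_facts(6,8,9) dim by (simp_all add: is_hset_def)
    then show ?thesis by (metis aff_dim_eq_full affine_hull_eq)
  qed
  have M_coord: "hs_coord M z = (line_embed (a * \<alpha> z), \<theta> (fst (bb z, \<nu> z), flip (snd (bb z, \<nu> z))))" for z
    by (simp add: M_facts(10) \<alpha>_def \<nu>_flip bb_def)
  have a': "a \<in> {1, -1}" using a by auto
  have M': "hs_set M = blk" using M_facts(7) blk by simp
  have norm_y_unit: "0 \<le> norm_y D z" "norm_y D z \<le> 1" if "z \<in> hs_set M" for z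
    using that block_set_iff [of z] by (auto simp: M_facts(7) norm_y_faces)
  note exchange = exchange_coverings [OF cov N M_facts(6) M' M_facts(8,9) M_space M_coord a' E(1,2) space_E]
  have "\<exists>M'. is_hset M' \<and> hs_set M' \<subseteq> blk \<and> covers F N M' \<and> covers (exit_map X (block_set D)) M' E"
  proof (cases "q = 1")
    case True
    have \<nu>: "\<nu> z = norm_y D z" for z unfolding \<nu>_def using True by simp
    define S where "S = (SUP z\<in>F ` hs_set N \<inter> hs_set M. norm_y D z)"
    have "S < ym" unfolding S_def using above True by blast
    \<comment> \<open>The maximum keeps \<open>yb\<close> positive even when \<open>S\<close> is
      not, for instance if the intersection is empty and \<open>S\<close> an unspecified
      number.\<close>
    then have "max 0 S < ym" using y by simp
    then obtain yb where yb: "max 0 S < yb" "yb < ym" using dense by blast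
    have "\<nu> z < yb" if "z \<in> F ` hs_set N \<inter> blk" for z
    proof -
      have "norm_y D z \<le> S" unfolding S_def
        using that norm_y_unit(2) by (intro cSUP_upper bdd_aboveI2 [where M = 1]) (auto simp: M')
      then show ?thesis using yb by (simp add: \<nu>)
    qed
    then show ?thesis
      using yb y E_stable \<tau> coord_0 \<nu> by (intro exchange [of ym yp \<tau> yb]) auto
  next
    case False
    then have q': "q = -1" using q by auto
    have \<nu>: "\<nu> z = 1 - norm_y D z" for z unfolding \<nu>_def using False by simp
    define S where "S = (INF z\<in>F ` hs_set N \<inter> hs_set M. norm_y D z)"
    have "yp < S" unfolding S_def using below q' by blast
    then have "max 0 (1 - S) < 1 - yp" using y by simp
    then obtain yb where yb: "max 0 (1 - S) < yb" "yb < 1 - yp" using dense by blast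
    have "\<nu> z < yb" if "z \<in> F ` hs_set N \<inter> blk" for z
    proof -
      have "S \<le> norm_y D z" unfolding S_def
        using that norm_y_unit(1) by (intro cINF_lower bdd_belowI2 [where m = 0]) (auto simp: M')
      then show ?thesis using yb by (simp add: \<nu>)
    qed
    \<comment> \<open>In terms of \<nu> the interval [ym, yp] becomes [1 - yp, 1 - ym], and the
      direction of the unstable coordinate reverses.\<close>
    moreover have "- \<tau> * fst (hs_coord E z) 0 < -1" if "\<alpha> z = 1" "\<nu> z < 1 - yp" for z
      using \<tau>(3) [of "norm_y D z"] that coord_0 [OF that(1)] by (simp add: \<nu>)
    moreover have "1 < - \<tau> * fst (hs_coord E z) 0" if "\<alpha> z = 1" "1 - ym < \<nu> z" for z
      using \<tau>(2) [of "norm_y D z"] that coord_0 [OF that(1)] by (simp add: \<nu>)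
    ultimately show ?thesis
      using yb y E_stable \<tau>(1) by (intro exchange [of "1 - yp" "1 - ym" "- \<tau>" yb]) auto
  qed
  then show ?thesis by (simp add: M_facts(7) blk)
qed

end

theorem proposition4p5:
  fixes f :: "(real^('n::finite)) \<times> real \<times> real \<Rightarrow> real^'n"
    and g :: "(real^'n) \<times> real \<times> real \<Rightarrow> real"
    and fc :: "nat \<Rightarrow> (real^'n) \<times> real \<Rightarrow> real^'n"
    and gc :: "nat \<Rightarrow> (real^'n) \<times> real \<Rightarrow> real"
    and r m :: nat
    and \<epsilon>\<^sub>0 \<epsilon> T :: real
    and N M M_exit :: "((real^'n) \<times> real) hset"
  assumes "0 < \<epsilon>\<^sub>0"
    and "1 \<le> r"
    and "Cr_on r f (UNIV \<times> UNIV \<times> {0..\<epsilon>\<^sub>0})"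
    and "Cr_on r g (UNIV \<times> UNIV \<times> {0..\<epsilon>\<^sub>0})"
    and "eps_expansion f m fc" and "\<exists>p. fc 0 p \<noteq> 0"
    and "eps_expansion g m gc" and "\<exists>p. gc 0 p \<noteq> 0"
    and "0 < \<epsilon>" and "\<epsilon> \<le> \<epsilon>\<^sub>0"
    and "covering_exchange_pair f g \<epsilon>\<^sub>0 \<epsilon> T N M M_exit"
  shows "\<exists>M'. is_hset M' \<and> hs_set M' \<subseteq> hs_set M \<and>
           covers (flow (fast_slow_field f g \<epsilon>) T) N M' \<and>
           covers (exit_map (fast_slow_field f g \<epsilon>) (hs_set M)) M' M_exit"
proof -
  obtain D i \<beta> \<theta> q a y\<^sub>m y\<^sub>p where
    N: "is_hset N" "hs_u N = 1" and saddle: "fast_saddle_block f \<epsilon>\<^sub>0 D" and M: "block_hset D i \<beta> \<theta> M"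
    and q: "q \<in> {-1, 1}" "\<forall>(x, y)\<in>hs_set M. q * g (x, y, \<epsilon>) > 0"
    and cov: "covers (flow (fast_slow_field f g \<epsilon>) T) N M" and face: "fast_exit_face D i \<beta> a y\<^sub>m y\<^sub>p M_exit"
    and ends: "q = 1 \<longrightarrow> (SUP z\<in>flow (fast_slow_field f g \<epsilon>) T ` hs_set N \<inter> hs_set M. norm_y D z) < y\<^sub>m"
      "q = -1 \<longrightarrow> (INF z\<in>flow (fast_slow_field f g \<epsilon>) T ` hs_set N \<inter> hs_set M. norm_y D z) > y\<^sub>p"
    using assms(11) unfolding covering_exchange_pair_def Let_def by blast
  have lip: "\<exists>L. L-lipschitz_on (cball 0 R) (fast_slow_field f g \<epsilon>)" for R
    using assms by (intro fast_slow_field_locally_lipschitz) auto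
  have a: "a \<in> {-1, 1}" using face by (simp add: fast_exit_face_def)
  interpret fast_slow_block f g \<epsilon>\<^sub>0 \<epsilon> D i \<beta> \<theta> M q a "CARD('n) - 1"
    by unfold_locales (use assms saddle M q a lip in auto)
  show ?thesis by (rule block_exchange_coverings [OF N cov face ends])
qed

end
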